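(* Let $\mathrm{k}$ be a field and let $T$ be a forest on $n$ vertices $x_1,\ldots,x_n$. Let $U \subset V(T)$ be a subset of the vertices of $T$, and let $G$ be the forest obtained by adding a whisker to each vertex in $U$, namely $$V(G) = V(T) \cup \{y_i \mid x_i \in U\}, \qquad E(G) = E(T) \cup \{\{x_i,y_i\} \mid x_i \in U\},$$ where the $y_i$ are new distinct vertices. Let $R = \mathrm{k}[x_1,\ldots,x_n, y_j \mid x_j \in U]$ be the polynomial ring over the variables corresponding to the vertices of $G$. Then for all $t \ge 1$, $$\operatorname{depth}(R/I(G)^t) \ge |U| - t + 1.$$
   Context: A forest is a finite simple acyclic graph. The edge ideal $I(G)$ of a graph $G$ is the ideal, in the polynomial ring over $\mathrm{k}$ whose variables are the vertices of $G$, generated by the products $uv$ where $\{u,v\}$ is an edge of $G$ (zero if there are no edges). Depth is taken with respect to the maximal homogeneous ideal $\mathfrak m$ of the polynomial ring (generated by all variables): $\operatorname{depth}(L) = \min\{i \mid H^i_{\mathfrak m}(L)\ne 0\}$. *)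

theory Defs
  imports
    "HOL-Library.Poly_Mapping"
    "HOL-Library.Extended_Real"
    "HOL-Algebra.Ideal_Product"
    "HOL-Algebra.QuotRing"
    "HOL-Algebra.Module"
begin

section \<open>Graphs, forests and whiskers\<close>

definition simple_graph :: "'v set \<Rightarrow> 'v set set \<Rightarrow> bool" where
  "simple_graph V E \<longleftrightarrow> finite V \<and> (\<forall>e\<in>E. \<exists>u\<in>V. \<exists>v\<in>V. u \<noteq> v \<and> e = {u, v})"

definition is_cycle :: "'v set set \<Rightarrow> 'v list \<Rightarrow> bool" where
  "is_cycle E vs \<longleftrightarrow> length vs \<ge> 3 \<and> distinct vs \<and>
     (\<forall>i<length vs. {vs ! i, vs ! (Suc i mod length vs)} \<in> E)"

definition forest :: "'v set \<Rightarrow> 'v set set \<Rightarrow> bool" where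
  "forest V E \<longleftrightarrow> simple_graph V E \<and> (\<nexists>vs. is_cycle E vs)"

text \<open>The vertex \<open>x\<close> of the original graph becomes \<open>Inl x\<close>; the new leaf attached
  to \<open>x \<in> U\<close> is \<open>Inr x\<close>.\<close>

definition whisker_verts :: "'v set \<Rightarrow> 'v set \<Rightarrow> ('v + 'v) set" where
  "whisker_verts V U = Inl ` V \<union> Inr ` U"

definition whisker_edges :: "'v set set \<Rightarrow> 'v set \<Rightarrow> ('v + 'v) set set" where
  "whisker_edges E U = ((`) Inl) ` E \<union> {{Inl x, Inr x} |x. x \<in> U}"


section \<open>Polynomial rings and edge ideals\<close>

text \<open>A monomial is a finitely supported exponent vector \<open>'v \<Rightarrow>\<^sub>0 nat\<close>, a polynomial a
  finitely supported family of coefficients indexed by monomials.  The ring below is the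
  polynomial ring whose set of variables is \<open>V\<close>, not all of \<open>'v\<close>.\<close>

definition mpoly_ring :: "'v set \<Rightarrow> (('v \<Rightarrow>\<^sub>0 nat) \<Rightarrow>\<^sub>0 'k::field) ring" where
  "mpoly_ring V =
     \<lparr>carrier = {p. \<forall>m\<in>Poly_Mapping.keys p. Poly_Mapping.keys m \<subseteq> V},
      mult = (*), one = 1, zero = 0, add = (+)\<rparr>"

definition mvar :: "'v \<Rightarrow> ('v \<Rightarrow>\<^sub>0 nat) \<Rightarrow>\<^sub>0 'k::field" where
  "mvar v = Poly_Mapping.single (Poly_Mapping.single v 1) 1"

definition edge_ideal :: "'v set \<Rightarrow> 'v set set \<Rightarrow> (('v \<Rightarrow>\<^sub>0 nat) \<Rightarrow>\<^sub>0 'k::field) set" where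
  "edge_ideal V E = Idl\<^bsub>mpoly_ring V\<^esub> {mvar u * mvar v |u v. {u, v} \<in> E}"

definition max_hom_ideal :: "'v set \<Rightarrow> (('v \<Rightarrow>\<^sub>0 nat) \<Rightarrow>\<^sub>0 'k::field) set" where
  "max_hom_ideal V = Idl\<^bsub>mpoly_ring V\<^esub> (mvar ` V)"

lemma mpoly_ring_cring: "cring (mpoly_ring V :: (('v \<Rightarrow>\<^sub>0 nat) \<Rightarrow>\<^sub>0 'k::field) ring)"
proof -
  define C where "C = {p :: ('v \<Rightarrow>\<^sub>0 nat) \<Rightarrow>\<^sub>0 'k. \<forall>m\<in>Poly_Mapping.keys p. Poly_Mapping.keys m \<subseteq> V}"
  have R: "mpoly_ring V = \<lparr>carrier = C, mult = (*), one = 1, zero = 0, add = (+)\<rparr>"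
    by (simp add: mpoly_ring_def C_def)
  have add: "p + q \<in> C" if "p \<in> C" "q \<in> C" for p q
    using that Poly_Mapping.keys_add[of p q] unfolding C_def by blast
  have mult: "p * q \<in> C" if "p \<in> C" "q \<in> C" for p q
    unfolding C_def
  proof (intro CollectI ballI)
    fix m assume "m \<in> Poly_Mapping.keys (p * q)"
    then obtain a b where "a \<in> Poly_Mapping.keys p" "b \<in> Poly_Mapping.keys q" "m = a + b"
      using Poly_Mapping.keys_mult[of p q] by blast
    then show "Poly_Mapping.keys m \<subseteq> V"
      using that Poly_Mapping.keys_add[of a b] unfolding C_def by blast
  qed
  have neg: "- p \<in> C" if "p \<in> C" for p
    using that by (simp add: C_def)
  have zero: "0 \<in> C" and one: "1 \<in> C"
    by (simp_all add: C_def flip: single_one)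
  have "abelian_group \<lparr>carrier = C, mult = (*), one = 1, zero = 0, add = (+)\<rparr>"
    by (rule abelian_groupI) (auto simp: add zero ac_simps intro: bexI[OF _ neg])
  moreover have "comm_monoid \<lparr>carrier = C, mult = (*), one = 1, zero = 0, add = (+)\<rparr>"
    by (rule comm_monoidI) (simp_all add: mult one ac_simps)
  ultimately show ?thesis
    unfolding R by (rule cringI) (simp add: distrib_right)
qed


section \<open>Local cohomology and depth\<close>

text \<open>In the type \<open>('a, 'b) module\<close> only the additive structure and the scalar
  multiplication matter; the fields \<open>mult\<close> and \<open>one\<close> inherited from \<open>'b ring\<close> are ignored.\<close>

text \<open>The quotient \<open>R/I\<close> as an \<open>R\<close>-module: a scalar \<open>r\<close> acts as multiplication by its
  class.\<close>

definition quot_module :: "('a, 'm) ring_scheme \<Rightarrow> 'a set \<Rightarrow> ('a, 'a set) module" where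
  "quot_module R I =
     \<lparr>carrier = carrier (R Quot I), mult = mult (R Quot I), one = one (R Quot I),
      zero = zero (R Quot I), add = add (R Quot I),
      smult = (\<lambda>r X. (I +>\<^bsub>R\<^esub> r) \<otimes>\<^bsub>R Quot I\<^esub> X)\<rparr>"

lemma quot_module_module:
  assumes "cring R" "ideal I R"
  shows "module R (quot_module R I)"
proof -
  interpret R: cring R by fact
  interpret I: ideal I R by fact
  interpret Q: ring "R Quot I" by (rule I.quotient_is_ring)
  have cls: "I +>\<^bsub>R\<^esub> a \<in> carrier (R Quot I)" if "a \<in> carrier R" for a
    using that ring_hom_closed[OF I.rcos_ring_hom] by blast
  note hom = ring_hom_add[OF I.rcos_ring_hom] ring_hom_mult[OF I.rcos_ring_hom]
    ring_hom_one[OF I.rcos_ring_hom]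
  have ag: "abelian_group (quot_module R I)"
  proof (rule abelian_groupI)
    fix X assume "X \<in> carrier (quot_module R I)"
    then show "\<exists>Y\<in>carrier (quot_module R I). Y \<oplus>\<^bsub>quot_module R I\<^esub> X = \<zero>\<^bsub>quot_module R I\<^esub>"
      by (intro bexI[of _ "\<ominus>\<^bsub>R Quot I\<^esub> X"]) (simp_all add: quot_module_def Q.l_neg)
  qed (simp_all add: quot_module_def Q.a_assoc, simp_all add: Q.a_comm)
  show ?thesis
    by (rule moduleI[OF \<open>cring R\<close> ag])
      (simp_all add: quot_module_def cls hom Q.l_distr Q.r_distr Q.m_assoc)
qed

definition mod_hom ::
  "('a, 'm) ring_scheme \<Rightarrow> ('a, 'b, 'n) module_scheme \<Rightarrow> ('a, 'c, 'p) module_scheme \<Rightarrow> ('b \<Rightarrow> 'c) set"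
  where
  "mod_hom R M N = {f \<in> hom (add_monoid M) (add_monoid N).
     \<forall>r\<in>carrier R. \<forall>x\<in>carrier M. f (r \<odot>\<^bsub>M\<^esub> x) = r \<odot>\<^bsub>N\<^esub> f x}"

definition mod_ker :: "('a, 'b, 'n) module_scheme \<Rightarrow> ('a, 'c, 'p) module_scheme \<Rightarrow> ('b \<Rightarrow> 'c) \<Rightarrow> 'b set"
  where "mod_ker M N f = {x \<in> carrier M. f x = \<zero>\<^bsub>N\<^esub>}"

definition ring_as_module :: "('a, 'm) ring_scheme \<Rightarrow> ('a, 'a) module" where
  "ring_as_module R =
     \<lparr>carrier = carrier R, mult = mult R, one = one R, zero = zero R, add = add R,
      smult = mult R\<rparr>"

text \<open>Injective modules.  As HOL has no quantification over modules of all types,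
  injectivity is expressed in Baer's form: every linear map from an ideal of \<open>R\<close> to \<open>Q\<close>
  extends to \<open>R\<close>.\<close>

definition injective_module :: "('a, 'm) ring_scheme \<Rightarrow> ('a, 'b, 'n) module_scheme \<Rightarrow> bool" where
  "injective_module R Q \<longleftrightarrow> module R Q \<and>
     (\<forall>I f. ideal I R \<and> f \<in> mod_hom R (ring_as_module R\<lparr>carrier := I\<rparr>) Q \<longrightarrow>
        (\<exists>g\<in>mod_hom R (ring_as_module R) Q. \<forall>x\<in>I. g x = f x))"

text \<open>\<open>0 \<rightarrow> L \<rightarrow> J 0 \<rightarrow> J 1 \<rightarrow> \<dots>\<close> is exact with all \<open>J i\<close> injective; the augmentation is
  \<open>\<epsilon>\<close> and the differentials are \<open>\<delta> i : J i \<rightarrow> J (Suc i)\<close>.\<close>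

definition injective_resolution ::
  "('a, 'm) ring_scheme \<Rightarrow> ('a, 'b, 'n) module_scheme \<Rightarrow> ('b \<Rightarrow> 'c) \<Rightarrow>
     (nat \<Rightarrow> ('a, 'c) module) \<Rightarrow> (nat \<Rightarrow> 'c \<Rightarrow> 'c) \<Rightarrow> bool" where
  "injective_resolution R L \<epsilon> J \<delta> \<longleftrightarrow>
     (\<forall>i. injective_module R (J i)) \<and>
     \<epsilon> \<in> mod_hom R L (J 0) \<and> inj_on \<epsilon> (carrier L) \<and>
     (\<forall>i. \<delta> i \<in> mod_hom R (J i) (J (Suc i))) \<and>
     \<epsilon> ` carrier L = mod_ker (J 0) (J 1) (\<delta> 0) \<and>
     (\<forall>i. \<delta> i ` carrier (J i) = mod_ker (J (Suc i)) (J (Suc (Suc i))) (\<delta> (Suc i)))"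

text \<open>The \<open>\<mm>\<close>-torsion functor \<open>\<Gamma>\<^sub>\<mm>\<close>, here on objects.  On maps it is restriction.
  Ideal powers are powers in the multiplicative monoid \<^const>\<open>ideals_set\<close> of ideals.\<close>

definition torsion :: "('a, 'm) ring_scheme \<Rightarrow> 'a set \<Rightarrow> ('a, 'b) module \<Rightarrow> ('a, 'b) module" where
  "torsion R \<mm> M = M\<lparr>carrier :=
     {x \<in> carrier M. \<exists>N::nat. \<forall>a\<in>\<mm> [^]\<^bsub>ideals_set R\<^esub> N. a \<odot>\<^bsub>M\<^esub> x = \<zero>\<^bsub>M\<^esub>}\<rparr>"

definition cocycles :: "(nat \<Rightarrow> ('a, 'c) module) \<Rightarrow> (nat \<Rightarrow> 'c \<Rightarrow> 'c) \<Rightarrow> nat \<Rightarrow> 'c set" where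
  "cocycles C \<delta> i = mod_ker (C i) (C (Suc i)) (\<delta> i)"

definition coboundaries :: "(nat \<Rightarrow> ('a, 'c) module) \<Rightarrow> (nat \<Rightarrow> 'c \<Rightarrow> 'c) \<Rightarrow> nat \<Rightarrow> 'c set" where
  "coboundaries C \<delta> i = (case i of 0 \<Rightarrow> {\<zero>\<^bsub>C 0\<^esub>} | Suc j \<Rightarrow> \<delta> j ` carrier (C j))"

definition cohomology :: "(nat \<Rightarrow> ('a, 'c) module) \<Rightarrow> (nat \<Rightarrow> 'c \<Rightarrow> 'c) \<Rightarrow> nat \<Rightarrow> 'c set monoid" where
  "cohomology C \<delta> i = ((add_monoid (C i))\<lparr>carrier := cocycles C \<delta> i\<rparr>) Mod coboundaries C \<delta> i"

text \<open>\<open>H\<^sup>i\<^sub>\<mm>(L)\<close> is the \<open>i\<close>-th right derived functor of \<open>\<Gamma>\<^sub>\<mm>\<close> at \<open>L\<close>, that is, the \<open>i\<close>-th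
  cohomology of \<open>\<Gamma>\<^sub>\<mm>(J)\<close> for an injective resolution \<open>J\<close> of \<open>L\<close>; up to isomorphism it does not
  depend on \<open>J\<close>.

  The type argument \<open>TYPE('c)\<close> names the type whose elements make up the modules \<open>J i\<close>.  It
  is needed because HOL cannot quantify over types inside a formula; a statement with \<open>'c\<close> a
  free type variable ranges over the resolutions in all types.  The notions below have their
  usual meaning as soon as \<open>'c\<close> is large enough to hold some injective resolution of \<open>L\<close>: for
  Noetherian \<open>R\<close>, an infinite type of cardinality at least that of \<open>R\<close> and of \<open>L\<close> suffices.
  If \<open>'c\<close> is too small, the predicate is false and the depth is \<open>\<infinity>\<close>.\<close>

definition local_cohomology_nonzero ::
  "'c itself \<Rightarrow> ('a, 'm) ring_scheme \<Rightarrow> 'a set \<Rightarrow> ('a, 'b, 'n) module_scheme \<Rightarrow> nat \<Rightarrow> bool" where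
  "local_cohomology_nonzero (_ :: 'c itself) R \<mm> L i \<longleftrightarrow>
     (\<exists>\<epsilon> (J :: nat \<Rightarrow> ('a, 'c) module) \<delta>. injective_resolution R L \<epsilon> J \<delta> \<and>
        (let H = cohomology (\<lambda>i. torsion R \<mm> (J i)) \<delta> i in carrier H \<noteq> {\<one>\<^bsub>H\<^esub>}))"

text \<open>The infimum is a minimum unless the set is empty, as for \<open>L = 0\<close>, where it is \<open>\<infinity>\<close>.\<close>

definition depth ::
  "'c itself \<Rightarrow> ('a, 'm) ring_scheme \<Rightarrow> 'a set \<Rightarrow> ('a, 'b, 'n) module_scheme \<Rightarrow> enat" where
  "depth T R \<mm> L = Inf (enat ` {i. local_cohomology_nonzero T R \<mm> L i})"

end

theory Submission
  imports Defs "HOL-Library.Multiset"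
begin

text \<open>The depth of the powers of a whiskered forest is bounded by taking colons and sums with single
variables.  For a monomial ideal \<open>A\<close> and a variable \<open>v\<close>, the exact sequence
\<open>0 \<rightarrow> P/(A : v) \<rightarrow> P/A \<rightarrow> P/(A + v) \<rightarrow> 0\<close> bounds the depth of \<open>P/A\<close> from below by the depths of
the two outer terms.  Adjoining a new variable to the ring and to the ideal leaves the depth
unchanged; adjoining it to the ring only, where it is then called free, raises the depth by one.
Let \<open>x\<close> be a vertex of \<open>T\<close> of degree at most one and \<open>I\<close> the edge ideal of \<open>G\<close>.

\<^item> The sum \<open>I\<^sup>t + x\<close> is \<open>I(G - x)\<^sup>t + x\<close>.  If \<open>x \<in> U\<close>, then one element of \<open>U\<close> is lost but its
  whisker becomes a free variable.
\<^item> If \<open>x \<in> U\<close> with whisker \<open>y\<close>, then \<open>(I\<^sup>t : x) : y = I\<^bsup>t-1\<^esup>\<close>, whereas \<open>(I\<^sup>t : x) + y\<close> concerns the forest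
  without the whisker \<open>y\<close>.  This reduces \<open>I\<^sup>t : x\<close> to the next case, in which one more is gained.
\<^item> If \<open>x \<notin> U\<close> has the neighbour \<open>z\<close>, then \<open>(I\<^sup>t : x) : z = I\<^bsup>t-1\<^esup>\<close>, and \<open>(I\<^sup>t : x) + z\<close> equals
  \<open>I(G - z)\<^sup>t + z\<close>, in which \<open>x\<close>, and the whisker of \<open>z\<close> if there is one, is free.  If \<open>x\<close> has no
  neighbour, it is free from the start.

Induction on \<open>t\<close> and on the number of vertices gives \<open>|U| - t + 1\<close>
(\<open>colon_low_degree_vertex\<close>, \<open>whiskered_forest_depth\<close>).

The induction needs a notion of depth that does not mention resolutions of the many modules that
occur in it.  This is the vanishing of the cohomology of the Koszul cochain complex on the variables
with coefficients in \<open>P/A\<close>, expressed by polynomials modulo \<open>A\<close> (\<open>koszul_depth_ge\<close>).  The three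
depth rules above are short calculations with such cochains.

It remains to compare this with the given injective resolution \<open>J\<close> of the single module \<open>L = R/I\<^sup>t\<close>.
In the double complex of Koszul cochains with values in \<open>J\<close>, the rows are exact in positive degree
because the variables form a regular sequence in \<open>R\<close> and the modules are injective
(\<open>mkoszul_exact\<close>), and the columns are exact because \<open>J\<close> is a resolution.  A diagram chase turns the
vanishing of the Koszul cohomology of \<open>L\<close> into a lifting property for cocycles of \<open>J\<close> that are killed
by the variables (\<open>total_cocycle_lift\<close>).  Replacing the variables by their \<open>N\<close>-th powers does not
destroy the vanishing (\<open>koszul_depth_ge_power\<close>), and every torsion element is killed by such powers, so
the torsion subcomplex has no cohomology below the bound (\<open>local_cohomology_vanishes\<close>).\<close>

section \<open>Koszul cochains over a commutative ring\<close>

definition ring_ideal :: "'a::comm_ring_1 set \<Rightarrow> bool" where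
  "ring_ideal I \<longleftrightarrow> 0 \<in> I \<and> (\<forall>a\<in>I. \<forall>b\<in>I. a + b \<in> I) \<and> (\<forall>a\<in>I. \<forall>r. r * a \<in> I)"

lemma ring_ideal_zero: "ring_ideal I \<Longrightarrow> 0 \<in> I"
  and ring_ideal_add: "ring_ideal I \<Longrightarrow> a \<in> I \<Longrightarrow> b \<in> I \<Longrightarrow> a + b \<in> I"
  and ring_ideal_mult: "ring_ideal I \<Longrightarrow> a \<in> I \<Longrightarrow> r * a \<in> I"
  by (auto simp: ring_ideal_def)

lemma ring_ideal_minus: "ring_ideal I \<Longrightarrow> a \<in> I \<Longrightarrow> - a \<in> I"
  using ring_ideal_mult[of I a "-1"] by simp

lemma ring_ideal_diff: "ring_ideal I \<Longrightarrow> a \<in> I \<Longrightarrow> b \<in> I \<Longrightarrow> a - b \<in> I"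
  using ring_ideal_add[of I a "- b"] ring_ideal_minus[of I b] by simp

text \<open>The Koszul differential on functions on finite sets of indices.  A cochain for \<open>v # vs\<close> is a pair: its
values on the sets without \<open>v\<close> and its values on the sets with \<open>v\<close>.  This makes the complex for
\<open>v # vs\<close> the cone of multiplication by \<open>g v\<close> on the complex for \<open>vs\<close>, and no signs need to be written.
A cochain of degree \<open>p\<close> is one of which only the values on sets of cardinality \<open>p\<close> matter.\<close>

primrec koszul :: "('w \<Rightarrow> 'a::comm_ring_1) \<Rightarrow> 'w list \<Rightarrow> ('w set \<Rightarrow> 'a) \<Rightarrow> 'w set \<Rightarrow> 'a" where
  "koszul g [] z F = 0"
| "koszul g (v # vs) z F =
     (if v \<in> F then g v * z (F - {v}) - koszul g vs (\<lambda>G. z (insert v G)) (F - {v})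
      else koszul g vs z F)"

text \<open>The differential at \<open>F\<close> depends only on the facets of \<open>F\<close>, so values in other degrees are irrelevant.\<close>

lemma koszul_cong:
  "(\<And>u. u \<in> F \<Longrightarrow> z (F - {u}) = z' (F - {u})) \<Longrightarrow> koszul g vs z F = koszul g vs z' F"
proof (induction vs arbitrary: z z' F)
  case (Cons v vs)
  have "koszul g vs (\<lambda>G. z (insert v G)) (F - {v}) = koszul g vs (\<lambda>G. z' (insert v G)) (F - {v})"
    if "v \<in> F"
  proof (rule Cons.IH)
    fix u assume u: "u \<in> F - {v}"
    then have "insert v (F - {v} - {u}) = F - {u}" using that by auto
    then show "z (insert v (F - {v} - {u})) = z' (insert v (F - {v} - {u}))"
      using Cons.prems[of u] u by simp
  qed
  moreover have "koszul g vs z F = koszul g vs z' F" by (rule Cons.IH, rule Cons.prems)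
  ultimately show ?case using Cons.prems by auto
qed simp

lemma koszul_cong_coeff:
  "(\<And>u. u \<in> set vs \<Longrightarrow> g u = g' u) \<Longrightarrow> koszul g vs z F = koszul g' vs z F"
  by (induction vs arbitrary: z F) auto

lemma koszul_add: "koszul g vs (\<lambda>G. z G + z' G) F = koszul g vs z F + koszul g vs z' F"
  by (induction vs arbitrary: z z' F) (auto simp: algebra_simps)

lemma koszul_scale: "koszul g vs (\<lambda>G. r * z G) F = r * koszul g vs z F"
  by (induction vs arbitrary: z F) (auto simp: algebra_simps)

lemma koszul_minus: "koszul g vs (\<lambda>G. - z G) F = - koszul g vs z F"
  using koszul_scale[of g vs "-1" z F] by simp

lemma koszul_diff: "koszul g vs (\<lambda>G. z G - z' G) F = koszul g vs z F - koszul g vs z' F"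
  using koszul_add[of g vs z "\<lambda>G. - z' G" F] by (simp add: koszul_minus)

lemma koszul_in_ideal:
  assumes "ring_ideal I"
  shows "(\<And>u. u \<in> F \<Longrightarrow> z (F - {u}) \<in> I) \<Longrightarrow> koszul g vs z F \<in> I"
proof (induction vs arbitrary: z F)
  case Nil
  then show ?case by (simp add: ring_ideal_zero[OF assms])
next
  case (Cons v vs)
  have "koszul g vs (\<lambda>G. z (insert v G)) (F - {v}) \<in> I" if "v \<in> F"
  proof (rule Cons.IH)
    fix u assume u: "u \<in> F - {v}"
    then have "insert v (F - {v} - {u}) = F - {u}" using that by auto
    then show "z (insert v (F - {v} - {u})) \<in> I"
      using Cons.prems[of u] u by simp
  qed
  moreover have "koszul g vs z F \<in> I" by (rule Cons.IH, rule Cons.prems)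
  ultimately show ?case
    using Cons.prems by (auto intro!: ring_ideal_diff[OF assms] ring_ideal_mult[OF assms])
qed

lemma koszul_koszul: "koszul g vs (koszul g vs z) F = 0"
proof (induction vs arbitrary: z F)
  case (Cons v vs)
  show ?case
  proof (cases "v \<in> F")
    case False
    have "koszul g vs (koszul g (v # vs) z) F = koszul g vs (koszul g vs z) F"
      by (rule koszul_cong) (use False in auto)
    then show ?thesis using False Cons.IH by (simp del: koszul.simps add: koszul.simps(2)[of g v vs "koszul g (v # vs) z"])
  next
    case True
    have "koszul g vs (\<lambda>G. koszul g (v # vs) z (insert v G)) (F - {v})
        = koszul g vs (\<lambda>G. g v * z G - koszul g vs (\<lambda>G. z (insert v G)) G) (F - {v})"
      by (rule koszul_cong) auto
    also have "\<dots> = g v * koszul g vs z (F - {v})"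
      by (simp only: koszul_diff koszul_scale Cons.IH diff_0_right)
    finally show ?thesis using True by simp
  qed
qed simp

text \<open>The \<open>i\<close>-th Koszul cohomology of the quotient by \<open>I\<close> is zero.  Cochains have values in the ring and are
compared modulo \<open>I\<close>, so that all quotients live in one type.\<close>

definition koszul_vanishes :: "('w \<Rightarrow> 'a::comm_ring_1) \<Rightarrow> 'w list \<Rightarrow> nat \<Rightarrow> 'a set \<Rightarrow> bool" where
  "koszul_vanishes g vs i I \<longleftrightarrow>
     (\<forall>z. (\<forall>F\<subseteq>set vs. card F = Suc i \<longrightarrow> koszul g vs z F \<in> I) \<longrightarrow>
        (\<exists>w. \<forall>F\<subseteq>set vs. card F = i \<longrightarrow> z F - koszul g vs w F \<in> I))"

text \<open>The bound is an integer because \<open>|U| - t + 1\<close> becomes negative during the induction.\<close>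

definition koszul_depth_ge :: "('w \<Rightarrow> 'a::comm_ring_1) \<Rightarrow> 'w list \<Rightarrow> int \<Rightarrow> 'a set \<Rightarrow> bool" where
  "koszul_depth_ge g vs d I \<longleftrightarrow> (\<forall>i. int i < d \<longrightarrow> koszul_vanishes g vs i I)"

lemma koszul_vanishesD:
  assumes "koszul_vanishes g vs i I" and "\<forall>F\<subseteq>set vs. card F = Suc i \<longrightarrow> koszul g vs z F \<in> I"
  shows "\<exists>w. \<forall>F\<subseteq>set vs. card F = i \<longrightarrow> z F - koszul g vs w F \<in> I"
  using assms(1)[unfolded koszul_vanishes_def, THEN spec, of z] assms(2) by (rule mp)

lemma koszul_depth_geD:
  "koszul_depth_ge g vs d I \<Longrightarrow> int i < d \<Longrightarrow> koszul_vanishes g vs i I"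
  by (simp add: koszul_depth_ge_def)

lemma koszul_depth_ge_mono: "koszul_depth_ge g vs d I \<Longrightarrow> d' \<le> d \<Longrightarrow> koszul_depth_ge g vs d' I"
  by (auto simp: koszul_depth_ge_def)

lemma koszul_depth_ge_UNIV: "koszul_depth_ge g vs d UNIV"
  by (auto simp: koszul_depth_ge_def koszul_vanishes_def)

text \<open>Vanishing for \<open>v # vs\<close> in terms of the two components of a cochain.  The depth rules below use the cone
only in this form.\<close>

lemma koszul_vanishes_Cons:
  assumes "v \<notin> set vs"
  shows "koszul_vanishes g (v # vs) i I \<longleftrightarrow>
     (\<forall>z0 z1. (\<forall>F\<subseteq>set vs. card F = Suc i \<longrightarrow> koszul g vs z0 F \<in> I) \<longrightarrow>
        (\<forall>F\<subseteq>set vs. card F = i \<longrightarrow> g v * z0 F - koszul g vs z1 F \<in> I) \<longrightarrow>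
        (\<exists>w0 w1. (\<forall>F\<subseteq>set vs. card F = i \<longrightarrow> z0 F - koszul g vs w0 F \<in> I) \<and>
           (\<forall>F\<subseteq>set vs. Suc (card F) = i \<longrightarrow> z1 F - (g v * w0 F - koszul g vs w1 F) \<in> I)))"
    (is "?L \<longleftrightarrow> ?R")
proof -
  define join :: "('a set \<Rightarrow> 'b) \<Rightarrow> ('a set \<Rightarrow> 'b) \<Rightarrow> 'a set \<Rightarrow> 'b" where
    "join z0 z1 F = (if v \<in> F then z1 (F - {v}) else z0 F)" for z0 z1 F
  have k0: "koszul g (v # vs) z F = koszul g vs z F" if "F \<subseteq> set vs" for z F
    using that assms by auto
  have k1: "koszul g (v # vs) z (insert v F) = g v * z F - koszul g vs (\<lambda>G. z (insert v G)) F"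
    if "F \<subseteq> set vs" for z F
  proof -
    have "insert v F - {v} = F" using that assms by auto
    then show ?thesis by simp
  qed
  have j0: "join z0 z1 F = z0 F" and j1: "join z0 z1 (insert v F) = z1 F" if "F \<subseteq> set vs" for z0 z1 F
  proof -
    have "insert v F - {v} = F" and "v \<notin> F" using that assms by auto
    then show "join z0 z1 F = z0 F" "join z0 z1 (insert v F) = z1 F" by (simp_all add: join_def)
  qed
  have kj0: "koszul g vs (join z0 z1) F = koszul g vs z0 F"
    and kj1: "koszul g vs (\<lambda>G. join z0 z1 (insert v G)) F = koszul g vs z1 F"
    if "F \<subseteq> set vs" for z0 z1 F
  proof -
    show "koszul g vs (join z0 z1) F = koszul g vs z0 F"
      by (rule koszul_cong, rule j0) (use that in auto)
    show "koszul g vs (\<lambda>G. join z0 z1 (insert v G)) F = koszul g vs z1 F"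
      by (rule koszul_cong, rule j1) (use that in auto)
  qed
  have cins: "card (insert v F) = Suc (card F)" if "F \<subseteq> set vs" for F
    using that assms by (meson List.finite_set card_insert_disjoint finite_subset subsetD)
  have split: "(\<forall>F\<subseteq>set (v # vs). card F = n \<longrightarrow> P F) \<longleftrightarrow>
      (\<forall>F\<subseteq>set vs. card F = n \<longrightarrow> P F) \<and> (\<forall>F\<subseteq>set vs. Suc (card F) = n \<longrightarrow> P (insert v F))" for n P
  proof (intro iffI conjI allI impI)
    fix F assume "\<forall>F\<subseteq>set (v # vs). card F = n \<longrightarrow> P F" "F \<subseteq> set vs" "card F = n"
    then show "P F" by auto
  next
    fix F assume *: "\<forall>F\<subseteq>set (v # vs). card F = n \<longrightarrow> P F" "F \<subseteq> set vs" "Suc (card F) = n"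
    have "insert v F \<subseteq> set (v # vs)" using *(2) by auto
    then show "P (insert v F)" using * cins by metis
  next
    fix F assume *: "(\<forall>F\<subseteq>set vs. card F = n \<longrightarrow> P F) \<and> (\<forall>F\<subseteq>set vs. Suc (card F) = n \<longrightarrow> P (insert v F))"
      "F \<subseteq> set (v # vs)" "card F = n"
    show "P F"
    proof (cases "v \<in> F")
      case True
      then have "F - {v} \<subseteq> set vs" "insert v (F - {v}) = F" using *(2) by auto
      then show ?thesis using * cins by metis
    next
      case False
      then have "F \<subseteq> set vs" using *(2) by auto
      then show ?thesis using * by blast
    qed
  qed
  show ?thesis
  proof
    assume L: ?L
    show ?R
    proof (intro allI impI)
      fix z0 z1
      assume z0: "\<forall>F\<subseteq>set vs. card F = Suc i \<longrightarrow> koszul g vs z0 F \<in> I"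
        and z1: "\<forall>F\<subseteq>set vs. card F = i \<longrightarrow> g v * z0 F - koszul g vs z1 F \<in> I"
      have "\<forall>F\<subseteq>set (v # vs). card F = Suc i \<longrightarrow> koszul g (v # vs) (join z0 z1) F \<in> I"
        unfolding split by (simp add: k0 k1 kj0 kj1 j0 z0 z1 del: koszul.simps)
      from koszul_vanishesD[OF L this]
      obtain w where w: "\<forall>F\<subseteq>set (v # vs). card F = i \<longrightarrow> join z0 z1 F - koszul g (v # vs) w F \<in> I"
        by blast
      show "\<exists>w0 w1. (\<forall>F\<subseteq>set vs. card F = i \<longrightarrow> z0 F - koszul g vs w0 F \<in> I) \<and>
           (\<forall>F\<subseteq>set vs. Suc (card F) = i \<longrightarrow> z1 F - (g v * w0 F - koszul g vs w1 F) \<in> I)"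
        by (rule exI[of _ w], rule exI[of _ "\<lambda>G. w (insert v G)"])
          (use w[unfolded split] in \<open>simp add: k0 k1 j0 j1 del: koszul.simps\<close>)
    qed
  next
    assume R: ?R
    show ?L unfolding koszul_vanishes_def
    proof (intro allI impI)
      fix z
      assume z: "\<forall>F\<subseteq>set (v # vs). card F = Suc i \<longrightarrow> koszul g (v # vs) z F \<in> I"
      obtain w0 w1 where w: "\<forall>F\<subseteq>set vs. card F = i \<longrightarrow> z F - koszul g vs w0 F \<in> I"
        "\<forall>F\<subseteq>set vs. Suc (card F) = i \<longrightarrow> z (insert v F) - (g v * w0 F - koszul g vs w1 F) \<in> I"
        using R[rule_format, of z "\<lambda>G. z (insert v G)"] z[unfolded split]
        by (auto simp add: k0 k1 simp del: koszul.simps)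
      show "\<exists>w. \<forall>F\<subseteq>set (v # vs). card F = i \<longrightarrow> z F - koszul g (v # vs) w F \<in> I"
        unfolding split
        by (rule exI[of _ "join w0 w1"]) (simp add: k0 k1 kj0 kj1 j0 w del: koszul.simps)
    qed
  qed
qed

lemma koszul_vanishes_ConsD:
  assumes "koszul_vanishes g (v # vs) i I" "v \<notin> set vs"
    and "\<forall>F\<subseteq>set vs. card F = Suc i \<longrightarrow> koszul g vs z0 F \<in> I"
    and "\<forall>F\<subseteq>set vs. card F = i \<longrightarrow> g v * z0 F - koszul g vs z1 F \<in> I"
  shows "\<exists>w0 w1. (\<forall>F\<subseteq>set vs. card F = i \<longrightarrow> z0 F - koszul g vs w0 F \<in> I) \<and>
     (\<forall>F\<subseteq>set vs. Suc (card F) = i \<longrightarrow> z1 F - (g v * w0 F - koszul g vs w1 F) \<in> I)"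
  using assms(1)[unfolded koszul_vanishes_Cons[OF assms(2)], THEN spec, THEN spec, of z0 z1]
    assms(3,4) by (elim impE) assumption+

text \<open>The depth lemma for \<open>0 \<rightarrow> P/A \<rightarrow> P/I \<rightarrow> P/B \<rightarrow> 0\<close>, whose first map is multiplication by \<open>f\<close>.  A cocycle
modulo \<open>I\<close> is a boundary modulo \<open>B\<close>; modulo \<open>I\<close>, the difference is \<open>f\<close> times a cocycle modulo \<open>A\<close>.\<close>

lemma koszul_depth_ge_colon:
  assumes I: "ring_ideal I" and IB: "I \<subseteq> B"
    and A: "\<And>p. f * p \<in> I \<longleftrightarrow> p \<in> A"
    and B: "\<And>q. q \<in> B \<Longrightarrow> \<exists>u. q - f * u \<in> I"
    and dA: "koszul_depth_ge g vs d A" and dB: "koszul_depth_ge g vs d B"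
  shows "koszul_depth_ge g vs d I"
  unfolding koszul_depth_ge_def koszul_vanishes_def
proof (intro allI impI)
  fix i z assume i: "int i < d" and z: "\<forall>F\<subseteq>set vs. card F = Suc i \<longrightarrow> koszul g vs z F \<in> I"
  have "\<forall>F\<subseteq>set vs. card F = Suc i \<longrightarrow> koszul g vs z F \<in> B" using z IB by auto
  then obtain w where w: "\<And>F. F \<subseteq> set vs \<Longrightarrow> card F = i \<Longrightarrow> z F - koszul g vs w F \<in> B"
    using koszul_vanishesD[OF koszul_depth_geD[OF dB i], of z] by auto
  have "\<forall>F. \<exists>u. F \<subseteq> set vs \<longrightarrow> card F = i \<longrightarrow> z F - koszul g vs w F - f * u \<in> I"
  proof
    fix F show "\<exists>u. F \<subseteq> set vs \<longrightarrow> card F = i \<longrightarrow> z F - koszul g vs w F - f * u \<in> I"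
      using w[of F] B[of "z F - koszul g vs w F"] by auto
  qed
  then obtain u where u: "\<And>F. F \<subseteq> set vs \<Longrightarrow> card F = i \<Longrightarrow> z F - koszul g vs w F - f * u F \<in> I"
    by metis
  have "koszul g vs u F \<in> A" if F: "F \<subseteq> set vs" "card F = Suc i" for F
  proof -
    have fin: "finite F" using F by (meson List.finite_set finite_subset)
    have "koszul g vs (\<lambda>F. z F - koszul g vs w F - f * u F) F \<in> I"
      by (rule koszul_in_ideal[OF I], rule u) (use F fin in auto)
    then have "koszul g vs z F - f * koszul g vs u F \<in> I"
      by (simp add: koszul_diff koszul_scale koszul_koszul)
    note * = this
    have "koszul g vs z F - (koszul g vs z F - f * koszul g vs u F) \<in> I"
      by (rule ring_ideal_diff[OF I _ *]) (use z F in auto)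
    then show ?thesis using A by simp
  qed
  then obtain w' where w': "\<And>F. F \<subseteq> set vs \<Longrightarrow> card F = i \<Longrightarrow> u F - koszul g vs w' F \<in> A"
    using koszul_vanishesD[OF koszul_depth_geD[OF dA i], of u] by auto
  show "\<exists>w. \<forall>F\<subseteq>set vs. card F = i \<longrightarrow> z F - koszul g vs w F \<in> I"
  proof (rule exI[of _ "\<lambda>G. w G + f * w' G"], intro allI impI)
    fix F assume F: "F \<subseteq> set vs" "card F = i"
    have "z F - koszul g vs w F - f * u F + f * (u F - koszul g vs w' F) \<in> I"
      using u[OF F] w'[OF F] A by (intro ring_ideal_add[OF I]) auto
    then show "z F - koszul g vs (\<lambda>G. w G + f * w' G) F \<in> I"
      by (simp add: koszul_add koszul_scale algebra_simps)
  qed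
qed

text \<open>If \<open>g v\<close> acts as zero, the cone is a direct sum of two copies of the complex for \<open>vs\<close>, one of them
shifted up by one degree.\<close>

lemma koszul_depth_ge_Cons_zero:
  assumes I: "ring_ideal I" and v: "v \<notin> set vs" "g v \<in> I" and d: "koszul_depth_ge g vs d I"
  shows "koszul_depth_ge g (v # vs) d I"
  unfolding koszul_depth_ge_def koszul_vanishes_Cons[OF v(1)]
proof (intro allI impI)
  fix i z0 z1
  assume i: "int i < d" and z0: "\<forall>F\<subseteq>set vs. card F = Suc i \<longrightarrow> koszul g vs z0 F \<in> I"
    and z1: "\<forall>F\<subseteq>set vs. card F = i \<longrightarrow> g v * z0 F - koszul g vs z1 F \<in> I"
  have gv: "g v * a \<in> I" for a
    using ring_ideal_mult[OF I v(2), of a] by (simp add: mult.commute)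
  obtain w0 where w0: "\<forall>F\<subseteq>set vs. card F = i \<longrightarrow> z0 F - koszul g vs w0 F \<in> I"
    using koszul_vanishesD[OF koszul_depth_geD[OF d i] z0] by blast
  have "\<exists>w1. \<forall>F\<subseteq>set vs. Suc (card F) = i \<longrightarrow> z1 F - koszul g vs w1 F \<in> I"
  proof (cases i)
    case (Suc j)
    have "koszul g vs z1 F \<in> I" if "F \<subseteq> set vs" "card F = Suc j" for F
    proof -
      have "g v * z0 F - (g v * z0 F - koszul g vs z1 F) \<in> I"
        by (rule ring_ideal_diff[OF I]) (use that z1 Suc gv in auto)
      then show ?thesis by simp
    qed
    moreover have "koszul_vanishes g vs j I" using d i Suc by (simp add: koszul_depth_ge_def)
    ultimately obtain w where "\<forall>F\<subseteq>set vs. card F = j \<longrightarrow> z1 F - koszul g vs w F \<in> I"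
      using koszul_vanishesD[of g vs j I z1] by auto
    then show ?thesis using Suc by (intro exI[of _ w]) simp
  qed auto
  then obtain w1 where w1: "\<forall>F\<subseteq>set vs. Suc (card F) = i \<longrightarrow> z1 F - koszul g vs w1 F \<in> I" by blast
  show "\<exists>w0 w1. (\<forall>F\<subseteq>set vs. card F = i \<longrightarrow> z0 F - koszul g vs w0 F \<in> I) \<and>
           (\<forall>F\<subseteq>set vs. Suc (card F) = i \<longrightarrow> z1 F - (g v * w0 F - koszul g vs w1 F) \<in> I)"
  proof (rule exI[of _ w0], rule exI[of _ "\<lambda>G. - w1 G"], intro conjI w0 allI impI)
    fix F assume "F \<subseteq> set vs" "Suc (card F) = i"
    then have "z1 F - koszul g vs w1 F \<in> I" using w1 by auto
    then have "z1 F - koszul g vs w1 F - g v * w0 F \<in> I"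
      by (rule ring_ideal_diff[OF I _ gv])
    then show "z1 F - (g v * w0 F - koszul g vs (\<lambda>G. - w1 G) F) \<in> I"
      by (simp add: koszul_minus algebra_simps)
  qed
qed

text \<open>If \<open>g v\<close> is regular modulo \<open>I\<close>, the cone computes the cohomology for \<open>B = I + (g v)\<close> shifted by one
degree.\<close>

lemma koszul_depth_ge_Cons_regular:
  assumes I: "ring_ideal I" and v: "v \<notin> set vs" and reg: "\<And>p. g v * p \<in> I \<Longrightarrow> p \<in> I"
    and IB: "I \<subseteq> B" and gB: "\<And>p. g v * p \<in> B" and idB: "ring_ideal B"
    and B: "\<And>q. q \<in> B \<Longrightarrow> \<exists>u. q - g v * u \<in> I"
    and d: "koszul_depth_ge g vs d B"
  shows "koszul_depth_ge g (v # vs) (d + 1) I"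
  unfolding koszul_depth_ge_def koszul_vanishes_Cons[OF v(1)]
proof (intro allI impI)
  fix i z0 z1
  assume i: "int i < d + 1" and z0: "\<forall>F\<subseteq>set vs. card F = Suc i \<longrightarrow> koszul g vs z0 F \<in> I"
    and z1: "\<forall>F\<subseteq>set vs. card F = i \<longrightarrow> g v * z0 F - koszul g vs z1 F \<in> I"
  have "\<exists>w1. \<forall>F\<subseteq>set vs. Suc (card F) = i \<longrightarrow> z1 F - koszul g vs w1 F \<in> B"
  proof (cases i)
    case (Suc j)
    have "koszul g vs z1 F \<in> B" if "F \<subseteq> set vs" "card F = Suc j" for F
    proof -
      have "g v * z0 F - (g v * z0 F - koszul g vs z1 F) \<in> B"
        by (rule ring_ideal_diff[OF idB]) (use that z1 Suc gB IB in auto)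
      then show ?thesis by simp
    qed
    moreover have "koszul_vanishes g vs j B" using d i Suc by (simp add: koszul_depth_ge_def)
    ultimately obtain w where "\<forall>F\<subseteq>set vs. card F = j \<longrightarrow> z1 F - koszul g vs w F \<in> B"
      using koszul_vanishesD[of g vs j B z1] by auto
    then show ?thesis using Suc by (intro exI[of _ w]) simp
  qed auto
  then obtain w1 where w1: "\<And>F. F \<subseteq> set vs \<Longrightarrow> Suc (card F) = i \<Longrightarrow> z1 F - koszul g vs w1 F \<in> B"
    by blast
  have "\<forall>F. \<exists>u. F \<subseteq> set vs \<longrightarrow> Suc (card F) = i \<longrightarrow> z1 F - koszul g vs w1 F - g v * u \<in> I"
  proof
    fix F show "\<exists>u. F \<subseteq> set vs \<longrightarrow> Suc (card F) = i \<longrightarrow> z1 F - koszul g vs w1 F - g v * u \<in> I"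
      using w1[of F] B[of "z1 F - koszul g vs w1 F"] by auto
  qed
  then obtain w0 where w0: "\<And>F. F \<subseteq> set vs \<Longrightarrow> Suc (card F) = i \<Longrightarrow>
      z1 F - koszul g vs w1 F - g v * w0 F \<in> I"
    by metis
  show "\<exists>w0 w1. (\<forall>F\<subseteq>set vs. card F = i \<longrightarrow> z0 F - koszul g vs w0 F \<in> I) \<and>
           (\<forall>F\<subseteq>set vs. Suc (card F) = i \<longrightarrow> z1 F - (g v * w0 F - koszul g vs w1 F) \<in> I)"
  proof (rule exI[of _ w0], rule exI[of _ "\<lambda>G. - w1 G"], intro conjI allI impI)
    fix F assume "F \<subseteq> set vs" "Suc (card F) = i"
    then show "z1 F - (g v * w0 F - koszul g vs (\<lambda>G. - w1 G) F) \<in> I"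
      using w0[of F] by (simp add: koszul_minus algebra_simps)
  next
    fix F assume F: "F \<subseteq> set vs" "card F = i"
    have fin: "finite F" using F by (meson List.finite_set finite_subset)
    have "koszul g vs (\<lambda>F. z1 F - koszul g vs w1 F - g v * w0 F) F \<in> I"
      by (rule koszul_in_ideal[OF I], rule w0) (use F fin card_Suc_Diff1[of F] in auto)
    then have "koszul g vs z1 F - g v * koszul g vs w0 F \<in> I"
      by (simp add: koszul_diff koszul_scale koszul_koszul)
    moreover have "g v * z0 F - koszul g vs z1 F \<in> I" using z1 F by blast
    ultimately have "(koszul g vs z1 F - g v * koszul g vs w0 F) + (g v * z0 F - koszul g vs z1 F) \<in> I"
      by (rule ring_ideal_add[OF I])
    then have "g v * (z0 F - koszul g vs w0 F) \<in> I" by (simp add: algebra_simps)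
    then show "z0 F - koszul g vs w0 F \<in> I" by (rule reg)
  qed
qed

text \<open>Vanishing for \<open>b\<close> and for \<open>c\<close> says that both are injective on one cohomology module of \<open>vs\<close> and surjective
on the one before; the product inherits this.\<close>

lemma koszul_depth_ge_Cons_mult:
  assumes v: "v \<notin> set vs" and I: "ring_ideal I"
    and b: "koszul_depth_ge (g(v := b)) (v # vs) d I"
    and c: "koszul_depth_ge (g(v := c)) (v # vs) d I"
  shows "koszul_depth_ge (g(v := b * c)) (v # vs) d I"
  unfolding koszul_depth_ge_def koszul_vanishes_Cons[OF v(1)]
proof (intro allI impI)
  fix i z0 z1
  have k: "koszul (g(v := x)) vs z F = koszul g vs z F" for x z F
    by (rule koszul_cong_coeff) (use v in auto)
  assume i: "int i < d" 
    and z0: "\<forall>F\<subseteq>set vs. card F = Suc i \<longrightarrow> koszul (g(v := b * c)) vs z0 F \<in> I"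
    and z1: "\<forall>F\<subseteq>set vs. card F = i \<longrightarrow> (g(v := b * c)) v * z0 F - koszul (g(v := b * c)) vs z1 F \<in> I"
  have vb: "koszul_vanishes (g(v := b)) (v # vs) i I" and vc: "koszul_vanishes (g(v := c)) (v # vs) i I"
    by (rule koszul_depth_geD[OF b i], rule koszul_depth_geD[OF c i])
  have "\<forall>F\<subseteq>set vs. card F = Suc i \<longrightarrow> koszul g vs (\<lambda>G. c * z0 G) F \<in> I"
    using z0 ring_ideal_mult[OF I] by (simp add: koszul_scale k)
  moreover have "\<forall>F\<subseteq>set vs. card F = i \<longrightarrow> b * (c * z0 F) - koszul g vs z1 F \<in> I"
    using z1 by (simp add: k mult.assoc)
  ultimately obtain w0 w1 where w: "\<forall>F\<subseteq>set vs. card F = i \<longrightarrow> c * z0 F - koszul g vs w0 F \<in> I"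
    "\<forall>F\<subseteq>set vs. Suc (card F) = i \<longrightarrow> z1 F - (b * w0 F - koszul g vs w1 F) \<in> I"
    using koszul_vanishes_ConsD[OF vb v, unfolded k fun_upd_same, of "\<lambda>G. c * z0 G" z1] by auto
  obtain u0 u1 where u: "\<forall>F\<subseteq>set vs. card F = i \<longrightarrow> z0 F - koszul g vs u0 F \<in> I"
    "\<forall>F\<subseteq>set vs. Suc (card F) = i \<longrightarrow> w0 F - (c * u0 F - koszul g vs u1 F) \<in> I"
    using koszul_vanishes_ConsD[OF vc v, unfolded k fun_upd_same, OF z0[unfolded k] w(1)] by auto
  show "\<exists>w0 w1. (\<forall>F\<subseteq>set vs. card F = i \<longrightarrow> z0 F - koszul (g(v := b * c)) vs w0 F \<in> I) \<and>
     (\<forall>F\<subseteq>set vs. Suc (card F) = i \<longrightarrow>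
        z1 F - ((g(v := b * c)) v * w0 F - koszul (g(v := b * c)) vs w1 F) \<in> I)"
    unfolding k fun_upd_same
  proof (rule exI[of _ u0], rule exI[of _ "\<lambda>G. b * u1 G + w1 G"], intro conjI u(1) allI impI)
    fix F assume F: "F \<subseteq> set vs" "Suc (card F) = i"
    have "z1 F - (b * w0 F - koszul g vs w1 F) + b * (w0 F - (c * u0 F - koszul g vs u1 F)) \<in> I"
      by (intro ring_ideal_add[OF I] ring_ideal_mult[OF I]) (use w(2) u(2) F in auto)
    then show "z1 F - (b * c * u0 F - koszul g vs (\<lambda>G. b * u1 G + w1 G) F) \<in> I"
      by (simp add: koszul_add koszul_scale algebra_simps)
  qed
qed

text \<open>The order of the variables changes the complex only by signs, one for each index set.\<close>

definition koszul_signed_iso :: "'w list \<Rightarrow> 'w list \<Rightarrow> ('w \<Rightarrow> 'a::comm_ring_1) \<Rightarrow> bool" where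
  "koszul_signed_iso vs vs' g \<longleftrightarrow> (\<exists>s. (\<forall>F. s F = 1 \<or> s F = -1) \<and>
     (\<forall>z F. koszul g vs (\<lambda>G. s G * z G) F = s F * koszul g vs' z F))"

lemma koszul_signed_iso_trans:
  assumes "koszul_signed_iso us vs g" "koszul_signed_iso vs ws g"
  shows "koszul_signed_iso us ws g"
proof -
  obtain s where s: "\<And>F. s F = 1 \<or> s F = -1"
      "\<And>z F. koszul g us (\<lambda>G. s G * z G) F = s F * koszul g vs z F"
    using assms(1) unfolding koszul_signed_iso_def by blast
  obtain s' where s': "\<And>F. s' F = 1 \<or> s' F = -1"
      "\<And>z F. koszul g vs (\<lambda>G. s' G * z G) F = s' F * koszul g ws z F"
    using assms(2) unfolding koszul_signed_iso_def by blast
  have "koszul g us (\<lambda>G. s G * s' G * z G) F = s F * s' F * koszul g ws z F" for z F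
    using s(2)[of "\<lambda>G. s' G * z G" F] by (simp add: s'(2) mult.assoc)
  moreover have "s F * s' F = 1 \<or> s F * s' F = -1" for F
    using s(1)[of F] s'(1)[of F] by auto
  ultimately show ?thesis
    unfolding koszul_signed_iso_def by (intro exI[of _ "\<lambda>F. s F * s' F"]) simp
qed

lemma koszul_signed_iso_Cons:
  assumes "koszul_signed_iso us vs g"
  shows "koszul_signed_iso (a # us) (a # vs) g"
proof -
  obtain s where s: "\<And>F. s F = 1 \<or> s F = -1"
      "\<And>z F. koszul g us (\<lambda>G. s G * z G) F = s F * koszul g vs z F"
    using assms(1) unfolding koszul_signed_iso_def by blast
  have "koszul g (a # us) (\<lambda>G. s (G - {a}) * z G) F = s (F - {a}) * koszul g (a # vs) z F" for z F
  proof (cases "a \<in> F")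
    case True
    have "koszul g us (\<lambda>G. s (insert a G - {a}) * z (insert a G)) (F - {a})
        = koszul g us (\<lambda>G. s G * z (insert a G)) (F - {a})"
    proof (rule koszul_cong)
      fix u assume "u \<in> F - {a}"
      have "insert a (F - {a} - {u}) - {a} = F - {a} - {u}" by auto
      then show "s (insert a (F - {a} - {u}) - {a}) * z (insert a (F - {a} - {u}))
        = s (F - {a} - {u}) * z (insert a (F - {a} - {u}))" by simp
    qed
    also have "\<dots> = s (F - {a}) * koszul g vs (\<lambda>G. z (insert a G)) (F - {a})" by (rule s(2))
    finally show ?thesis using True by (simp add: algebra_simps)
  next
    case False
    have "koszul g us (\<lambda>G. s (G - {a}) * z G) F = koszul g us (\<lambda>G. s G * z G) F"
    proof (rule koszul_cong)
      fix u
      have "F - {u} - {a} = F - {u}" using False by auto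
      then show "s (F - {u} - {a}) * z (F - {u}) = s (F - {u}) * z (F - {u})" by simp
    qed
    then show ?thesis using False s(2) by simp
  qed
  then show ?thesis
    unfolding koszul_signed_iso_def using s(1) by (intro exI[of _ "\<lambda>G. s (G - {a})"]) simp
qed

lemma koszul_signed_iso_swap:
  assumes "a \<noteq> b"
  shows "koszul_signed_iso (a # b # vs) (b # a # vs) g"
proof -
  define s :: "'a set \<Rightarrow> 'b" where "s F = (if a \<in> F \<and> b \<in> F then -1 else 1)" for F
  have "koszul g (a # b # vs) (\<lambda>G. s G * z G) F = s F * koszul g (b # a # vs) z F" for z F
  proof -
    have "F - {a} - {b} = F - {b} - {a}" by auto
    moreover have "insert a (F - {a} - {b}) = F - {b}" if "a \<in> F" using that assms by auto
    moreover have "insert b (F - {a} - {b}) = F - {a}" if "b \<in> F" using that assms by auto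
    moreover have "insert b (F - {b} - {a}) = F - {a}" if "b \<in> F" using that assms by auto
    moreover have "insert a (F - {b}) = F - {b}" if "a \<in> F" using that assms by auto
    moreover have "insert b (F - {a}) = F - {a}" if "b \<in> F" using that assms by auto
    moreover have "koszul g vs (\<lambda>G. s (insert a (insert b G)) * z (insert a (insert b G))) H
      = - koszul g vs (\<lambda>G. z (insert b (insert a G))) H" for H
      by (simp add: s_def koszul_minus insert_commute)
    moreover have "koszul g vs (\<lambda>G. s (insert a G) * z (insert a G)) H = koszul g vs (\<lambda>G. z (insert a G)) H"
      if "b \<notin> H" for H
      by (rule koszul_cong) (use that assms in \<open>auto simp: s_def\<close>)
    moreover have "koszul g vs (\<lambda>G. s (insert b G) * z (insert b G)) H = koszul g vs (\<lambda>G. z (insert b G)) H"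
      if "a \<notin> H" for H
      by (rule koszul_cong) (use that assms in \<open>auto simp: s_def\<close>)
    moreover have "koszul g vs (\<lambda>G. s G * z G) H = koszul g vs z H" if "a \<notin> H" for H
      by (rule koszul_cong) (use that assms in \<open>auto simp: s_def\<close>)
    ultimately show ?thesis
      using assms by (cases "a \<in> F"; cases "b \<in> F") (simp_all add: s_def)
  qed
  moreover have "s F = 1 \<or> s F = -1" for F by (simp add: s_def)
  ultimately show ?thesis unfolding koszul_signed_iso_def by blast
qed

lemma koszul_signed_iso_refl: "koszul_signed_iso vs vs g"
  unfolding koszul_signed_iso_def by (intro exI[of _ "\<lambda>_. 1"]) simp

lemma koszul_signed_iso_front:
  "distinct (us @ v # vs) \<Longrightarrow> koszul_signed_iso (us @ v # vs) (v # us @ vs) g"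
proof (induction us)
  case (Cons a us)
  have "koszul_signed_iso (a # us @ v # vs) (a # v # us @ vs) g"
    using Cons by (intro koszul_signed_iso_Cons) simp
  then show ?case
    using koszul_signed_iso_trans koszul_signed_iso_swap[of a v] Cons.prems by fastforce
qed (simp add: koszul_signed_iso_refl)

lemma koszul_depth_ge_iso:
  assumes I: "ring_ideal I" and iso: "koszul_signed_iso us vs g" and set: "set us = set vs"
    and d: "koszul_depth_ge g vs d I"
  shows "koszul_depth_ge g us d I"
  unfolding koszul_depth_ge_def koszul_vanishes_def
proof (intro allI impI)
  fix i z assume i: "int i < d" and z: "\<forall>F\<subseteq>set us. card F = Suc i \<longrightarrow> koszul g us z F \<in> I"
  obtain s where s: "\<And>F. s F = 1 \<or> s F = -1"
      "\<And>z F. koszul g us (\<lambda>G. s G * z G) F = s F * koszul g vs z F"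
    using iso unfolding koszul_signed_iso_def by blast
  have ss: "s F * (s F * x) = x" for F x using s(1)[of F] by auto
  have "koszul g vs (\<lambda>G. s G * z G) F = s F * koszul g us z F" for z F
    using s(2)[of "\<lambda>G. s G * z G" F] by (simp add: ss)
  then have "\<forall>F\<subseteq>set vs. card F = Suc i \<longrightarrow> koszul g vs (\<lambda>G. s G * z G) F \<in> I"
    using z set ring_ideal_mult[OF I] by simp
  then obtain w where w: "\<forall>F\<subseteq>set vs. card F = i \<longrightarrow> s F * z F - koszul g vs w F \<in> I"
    using koszul_vanishesD[OF koszul_depth_geD[OF d i], of "\<lambda>G. s G * z G"] by auto
  show "\<exists>w. \<forall>F\<subseteq>set us. card F = i \<longrightarrow> z F - koszul g us w F \<in> I"
  proof (rule exI[of _ "\<lambda>G. s G * w G"], intro allI impI)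
    fix F assume "F \<subseteq> set us" "card F = i"
    then have "s F * (s F * z F - koszul g vs w F) \<in> I"
      using w set ring_ideal_mult[OF I] by simp
    then show "z F - koszul g us (\<lambda>G. s G * w G) F \<in> I"
      by (simp add: s(2) ss right_diff_distrib)
  qed
qed

lemma koszul_signed_iso_perm:
  "distinct us \<Longrightarrow> distinct vs \<Longrightarrow> set us = set vs \<Longrightarrow> koszul_signed_iso us vs g"
proof (induction vs arbitrary: us)
  case Nil
  then show ?case by (simp add: koszul_signed_iso_refl)
next
  case (Cons v vs)
  then have "v \<in> set us" by simp
  then obtain as bs where us: "us = as @ v # bs" by (meson split_list)
  have "set (as @ bs) = set vs" using Cons.prems us by auto
  then have "koszul_signed_iso (v # as @ bs) (v # vs) g"
    using Cons us by (intro koszul_signed_iso_Cons Cons.IH) auto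
  moreover have "koszul_signed_iso us (v # as @ bs) g"
    using koszul_signed_iso_front[of as v bs g] Cons.prems us by simp
  ultimately show ?case by (rule koszul_signed_iso_trans[rotated])
qed

lemma koszul_depth_ge_perm:
  assumes "ring_ideal I" "koszul_depth_ge g vs d I" "distinct us" "distinct vs" "set us = set vs"
  shows "koszul_depth_ge g us d I"
  using koszul_depth_ge_iso[OF assms(1) koszul_signed_iso_perm] assms by blast

text \<open>One variable at a time is moved to the front and replaced by its power.\<close>

lemma koszul_depth_ge_power:
  assumes I: "ring_ideal I" and dist: "distinct vs" and N: "N \<ge> 1" and d: "koszul_depth_ge g vs d I"
  shows "koszul_depth_ge (\<lambda>v. g v ^ N) vs d I"
proof -
  have one: "koszul_depth_ge (h(v := h v ^ N)) vs d I"
    if h: "koszul_depth_ge h vs d I" and v: "v \<in> set vs" for h v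
  proof -
    obtain as bs where vs: "vs = as @ v # bs" using v by (meson split_list)
    have v': "v \<notin> set (as @ bs)" using dist vs by auto
    have front: "koszul_depth_ge k vs d I \<longleftrightarrow> koszul_depth_ge k (v # as @ bs) d I" for k
      using koszul_depth_ge_perm[OF I, of k vs d "v # as @ bs"]
        koszul_depth_ge_perm[OF I, of k "v # as @ bs" d vs] dist vs by auto
    have "koszul_depth_ge (h(v := h v ^ Suc n)) (v # as @ bs) d I" for n
    proof (induction n)
      case 0
      then show ?case using h front by simp
    next
      case (Suc n)
      then show ?case
        using koszul_depth_ge_Cons_mult[OF v' I, of h "h v" d "h v ^ Suc n"] h front
        by (simp del: fun_upd_apply)
    qed
    from this[of "N - 1"] show ?thesis using front N vs by simp
  qed
  have "koszul_depth_ge (\<lambda>v. if v \<in> S then g v ^ N else g v) vs d I" if "S \<subseteq> set vs" "finite S" for S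
    using that(2,1)
  proof (induction S rule: finite_induct)
    case empty
    then show ?case using d by simp
  next
    case (insert v S)
    have "(\<lambda>u. if u \<in> S then g u ^ N else g u)(v := (if v \<in> S then g v ^ N else g v) ^ N)
      = (\<lambda>u. if u \<in> insert v S then g u ^ N else g u)" using insert by auto
    then show ?case using one[of "\<lambda>u. if u \<in> S then g u ^ N else g u" v] insert by simp
  qed
  from this[of "set vs"] have "koszul_depth_ge (\<lambda>v. if v \<in> set vs then g v ^ N else g v) vs d I" by simp
  moreover have "koszul (\<lambda>v. if v \<in> set vs then g v ^ N else g v) vs z F = koszul (\<lambda>v. g v ^ N) vs z F" for z F
    by (rule koszul_cong_coeff) auto
  ultimately show ?thesis by (simp add: koszul_depth_ge_def koszul_vanishes_def)
qed

section \<open>Monomial ideals\<close>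

abbreviation "lookup \<equiv> Poly_Mapping.lookup"
abbreviation "keys \<equiv> Poly_Mapping.keys"

text \<open>The premise for single terms is restricted to the terms of \<open>p\<close>: these are the ones known to have a
property such as membership in a monomial ideal.\<close>

lemma poly_mapping_additive_induct:
  fixes p :: "'m \<Rightarrow>\<^sub>0 'k::comm_monoid_add"
  assumes zero: "P 0" and add: "\<And>p q. P p \<Longrightarrow> P q \<Longrightarrow> P (p + q)"
    and single: "\<And>m. m \<in> keys p \<Longrightarrow> P (Poly_Mapping.single m (lookup p m))"
  shows "P p"
proof -
  have "p = (\<Sum>m\<in>keys p. Poly_Mapping.single m (lookup p m))"
    by (rule poly_mapping_eqI) (simp add: lookup_sum lookup_single when_def sum.delta in_keys_iff)
  moreover have "P (\<Sum>m\<in>S. Poly_Mapping.single m (lookup p m))"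
    if "S \<subseteq> keys p" "finite S" for S
    using that(2,1) by (induction S rule: finite_induct) (auto intro: zero add single)
  ultimately show ?thesis by (metis finite_keys order_refl)
qed

abbreviation pvar :: "'w \<Rightarrow> 'w \<Rightarrow>\<^sub>0 nat" where
  "pvar v \<equiv> Poly_Mapping.single v 1"

lemma lookup_single_mult_add:
  fixes p :: "('w \<Rightarrow>\<^sub>0 nat) \<Rightarrow>\<^sub>0 'k::comm_ring_1"
  shows "lookup (Poly_Mapping.single a c * p) (a + m) = c * lookup p m"
  by (rule poly_mapping_additive_induct[where p = p])
    (simp_all add: distrib_left lookup_add mult_single lookup_single when_def)

lemma keys_single_mult:
  fixes p :: "('w \<Rightarrow>\<^sub>0 nat) \<Rightarrow>\<^sub>0 'k::comm_ring_1"
  shows "keys (Poly_Mapping.single a 1 * p) = (+) a ` keys p"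
proof
  show "keys (Poly_Mapping.single a 1 * p) \<subseteq> (+) a ` keys p"
    using keys_mult[of "Poly_Mapping.single a 1" p] by (auto split: if_splits)
  show "(+) a ` keys p \<subseteq> keys (Poly_Mapping.single a 1 * p)"
    by (auto simp: in_keys_iff lookup_single_mult_add)
qed

lemma pvar_split: "lookup m v > 0 \<Longrightarrow> \<exists>n. m = pvar v + n"
  by (intro exI[of _ "m - pvar v"] poly_mapping_eqI) (auto simp: lookup_add lookup_minus lookup_single when_def)

lemma mvar_dvd:
  fixes p :: "('w \<Rightarrow>\<^sub>0 nat) \<Rightarrow>\<^sub>0 'k::field"
  assumes "\<And>m. m \<in> keys p \<Longrightarrow> lookup m v > 0"
  shows "mvar v dvd p"
proof (rule poly_mapping_additive_induct[where p = p])
  fix m assume "m \<in> keys p"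
  then obtain n where "m = pvar v + n" using pvar_split[OF assms] by blast
  then have "Poly_Mapping.single m (lookup p m) = mvar v * Poly_Mapping.single n (lookup p m)"
    by (simp add: mvar_def mult_single)
  then show "mvar v dvd Poly_Mapping.single m (lookup p m)" by (rule dvdI)
qed (rule dvd_0_right, rule dvd_add)

definition upset :: "('w \<Rightarrow>\<^sub>0 nat) set \<Rightarrow> bool" where
  "upset M \<longleftrightarrow> (\<forall>m\<in>M. \<forall>n. n + m \<in> M)"

text \<open>A monomial ideal is given by its set of monomials, which is closed under multiplication by monomials.
The ideal lies in the ring with all variables of the type, so that an ideal and its images in fewer
variables are written in the same way.\<close>

definition monomial_ideal :: "('w \<Rightarrow>\<^sub>0 nat) set \<Rightarrow> (('w \<Rightarrow>\<^sub>0 nat) \<Rightarrow>\<^sub>0 'k::field) set" where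
  "monomial_ideal M = {p. keys p \<subseteq> M}"

lemma ring_ideal_monomial_ideal:
  assumes "upset M" shows "ring_ideal (monomial_ideal M)"
  unfolding ring_ideal_def monomial_ideal_def
proof (intro conjI ballI allI)
  show "0 \<in> {p. keys p \<subseteq> M}" by simp
next
  fix a b :: "('a \<Rightarrow>\<^sub>0 nat) \<Rightarrow>\<^sub>0 'b" assume "a \<in> {p. keys p \<subseteq> M}" "b \<in> {p. keys p \<subseteq> M}"
  then show "a + b \<in> {p. keys p \<subseteq> M}" using Poly_Mapping.keys_add[of a b] by blast
next
  fix a r :: "('a \<Rightarrow>\<^sub>0 nat) \<Rightarrow>\<^sub>0 'b" assume a: "a \<in> {p. keys p \<subseteq> M}"
  have "m \<in> M" if m: "m \<in> keys (r * a)" for m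
  proof -
    obtain n k where "m = n + k" "k \<in> keys a" using keys_mult[of r a] m by blast
    then show ?thesis using a assms by (auto simp: upset_def)
  qed
  then show "r * a \<in> {p. keys p \<subseteq> M}" by blast
qed

text \<open>For a set \<open>A\<close> of monomials that is stable under multiplication and division by the variables in play,
this projection is linear over those variables.  It serves as the substitution of zero for the other
variables.\<close>

definition restrict_keys :: "'m set \<Rightarrow> ('m \<Rightarrow>\<^sub>0 'k::comm_monoid_add) \<Rightarrow> 'm \<Rightarrow>\<^sub>0 'k" where
  "restrict_keys A p = Poly_Mapping.mapp (\<lambda>m c. c when m \<in> A) p"

lemma lookup_restrict_keys: "lookup (restrict_keys A p) m = (lookup p m when m \<in> A)"
  by (simp add: restrict_keys_def lookup_mapp in_keys_iff when_def)

lemma keys_restrict_keys: "keys (restrict_keys A p) = keys p \<inter> A"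
  by (auto simp: in_keys_iff lookup_restrict_keys)

lemma restrict_keys_zero [simp]: "restrict_keys A 0 = 0"
  by (rule poly_mapping_eqI) (simp add: lookup_restrict_keys)

lemma restrict_keys_add: "restrict_keys A (p + q) = restrict_keys A p + restrict_keys A q"
  by (rule poly_mapping_eqI) (simp add: lookup_restrict_keys lookup_add when_def)

lemma restrict_keys_diff:
  "restrict_keys A (p - q) = restrict_keys A p - restrict_keys A (q :: _ \<Rightarrow>\<^sub>0 'k::ab_group_add)"
  by (rule poly_mapping_eqI) (simp add: lookup_restrict_keys lookup_minus when_def)

lemma restrict_keys_single_mult:
  fixes p :: "('w \<Rightarrow>\<^sub>0 nat) \<Rightarrow>\<^sub>0 'k::comm_ring_1"
  assumes "\<And>m. a + m \<in> A \<longleftrightarrow> m \<in> A"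
  shows "restrict_keys A (Poly_Mapping.single a c * p) = Poly_Mapping.single a c * restrict_keys A p"
proof (rule poly_mapping_additive_induct[where p = p])
  fix m assume "m \<in> keys p"
  have *: "restrict_keys A (Poly_Mapping.single n d) = (Poly_Mapping.single n d when n \<in> A)"
    for n and d :: 'k
    by (rule poly_mapping_eqI) (auto simp: lookup_restrict_keys lookup_single when_def)
  show "restrict_keys A (Poly_Mapping.single a c * Poly_Mapping.single m (lookup p m)) =
      Poly_Mapping.single a c * restrict_keys A (Poly_Mapping.single m (lookup p m))"
    using assms by (simp add: mult_single * when_def)
qed (simp_all add: restrict_keys_add distrib_left)

lemma restrict_keys_koszul:
  fixes z :: "'w set \<Rightarrow> ('w \<Rightarrow>\<^sub>0 nat) \<Rightarrow>\<^sub>0 'k::field"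
  assumes "\<And>u. u \<in> set vs \<Longrightarrow> g u = Poly_Mapping.single (a u) 1"
    and "\<And>u m. u \<in> set vs \<Longrightarrow> a u + m \<in> A \<longleftrightarrow> m \<in> A"
  shows "restrict_keys A (koszul g vs z F) = koszul g vs (\<lambda>G. restrict_keys A (z G)) F"
  using assms
  by (induction vs arbitrary: z F)
    (simp_all add: restrict_keys_diff restrict_keys_single_mult)

text \<open>The monomials of \<open>A + (v)\<close> and of \<open>A : v\<close>.\<close>

definition with_var :: "('w \<Rightarrow>\<^sub>0 nat) set \<Rightarrow> 'w \<Rightarrow> ('w \<Rightarrow>\<^sub>0 nat) set" where
  "with_var M v = M \<union> {m. lookup m v > 0}"

definition colon_var :: "('w \<Rightarrow>\<^sub>0 nat) set \<Rightarrow> 'w \<Rightarrow> ('w \<Rightarrow>\<^sub>0 nat) set" where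
  "colon_var M v = {m. pvar v + m \<in> M}"

lemma upset_with_var: "upset M \<Longrightarrow> upset (with_var M v)"
  by (auto simp: upset_def with_var_def lookup_add)

lemma upset_colon_var: "upset M \<Longrightarrow> upset (colon_var M v)"
  unfolding upset_def colon_var_def by (simp add: add.left_commute)

lemma colon_var_with_var: "x \<noteq> y \<Longrightarrow> colon_var (with_var M y) x = with_var (colon_var M x) y"
  by (auto simp: with_var_def colon_var_def lookup_add lookup_single)

lemma mvar_mult_in_monomial_ideal: "mvar v * p \<in> monomial_ideal M \<longleftrightarrow> p \<in> monomial_ideal (colon_var M v)"
  by (auto simp: monomial_ideal_def mvar_def keys_single_mult colon_var_def)

lemma monomial_ideal_with_var_decomp:
  assumes "q \<in> monomial_ideal (with_var M v)"
  shows "\<exists>u. q - mvar v * u \<in> monomial_ideal M"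
proof -
  define r where "r = restrict_keys {m. lookup m v > 0} q"
  have "mvar v dvd r" by (rule mvar_dvd) (auto simp: r_def keys_restrict_keys)
  then obtain u where u: "r = mvar v * u" by (auto simp: dvd_def)
  have "q - r = restrict_keys {m. lookup m v = 0} q"
    by (rule poly_mapping_eqI) (simp add: r_def lookup_restrict_keys lookup_minus when_def)
  then have "q - r \<in> monomial_ideal M"
    using assms by (auto simp: monomial_ideal_def keys_restrict_keys with_var_def)
  then show ?thesis using u by blast
qed

lemma mvar_mult_in_with_var: "mvar v * p \<in> monomial_ideal (with_var M v)"
  by (auto simp: monomial_ideal_def mvar_def keys_single_mult with_var_def lookup_add)

lemma monomial_ideal_mono: "M \<subseteq> M' \<Longrightarrow> monomial_ideal M \<subseteq> monomial_ideal M'"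
  by (auto simp: monomial_ideal_def)

text \<open>The field occurs only in the type of the polynomials, hence the type argument.\<close>

definition monomial_depth_ge ::
  "'k::field itself \<Rightarrow> 'w list \<Rightarrow> int \<Rightarrow> ('w \<Rightarrow>\<^sub>0 nat) set \<Rightarrow> bool" where
  "monomial_depth_ge (_ :: 'k itself) vs d M \<longleftrightarrow>
     koszul_depth_ge mvar vs d (monomial_ideal M :: (('w \<Rightarrow>\<^sub>0 nat) \<Rightarrow>\<^sub>0 'k) set)"

lemma monomial_depth_ge_colon_var:
  assumes "upset M" and "monomial_depth_ge K vs d (colon_var M v)"
    and "monomial_depth_ge K vs d (with_var M v)"
  shows "monomial_depth_ge K vs d M"
  unfolding monomial_depth_ge_def
proof (rule koszul_depth_ge_colon[OF _ _ _ _ assms(2,3)[unfolded monomial_depth_ge_def]])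
  show "ring_ideal (monomial_ideal M)" using assms(1) by (rule ring_ideal_monomial_ideal)
  show "monomial_ideal M \<subseteq> monomial_ideal (with_var M v)"
    by (rule monomial_ideal_mono) (simp add: with_var_def)
  show "mvar v * p \<in> monomial_ideal M \<longleftrightarrow> p \<in> monomial_ideal (colon_var M v)" for p
    by (rule mvar_mult_in_monomial_ideal)
  show "\<exists>u. q - mvar v * u \<in> monomial_ideal M" if "q \<in> monomial_ideal (with_var M v)" for q
    using that by (rule monomial_ideal_with_var_decomp)
qed

text \<open>Substituting zero for \<open>v\<close> makes a cocycle modulo \<open>A + (v)\<close> into one modulo \<open>A\<close> and changes it by a
multiple of \<open>v\<close>.  The variable \<open>v\<close> is not among those of the complex, so the differential commutes with
the substitution.\<close>

lemma monomial_depth_ge_with_var: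
  fixes K :: "'k::field itself" and vs :: "'w list"
  assumes M: "upset M" and v: "v \<notin> set vs" and d: "monomial_depth_ge K vs d M"
  shows "monomial_depth_ge K vs d (with_var M v)"
  unfolding monomial_depth_ge_def koszul_depth_ge_def koszul_vanishes_def
proof (intro allI impI)
  fix i and z :: "'w set \<Rightarrow> ('w \<Rightarrow>\<^sub>0 nat) \<Rightarrow>\<^sub>0 'k"
  assume i: "int i < d"
    and z: "\<forall>F\<subseteq>set vs. card F = Suc i \<longrightarrow> koszul mvar vs z F \<in> monomial_ideal (with_var M v)"
  let ?r = "restrict_keys {m. lookup m v = 0} :: (('w \<Rightarrow>\<^sub>0 nat) \<Rightarrow>\<^sub>0 'k) \<Rightarrow> _"
  have r: "?r p \<in> monomial_ideal M" if "p \<in> monomial_ideal (with_var M v)" for p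
    using that by (auto simp: monomial_ideal_def keys_restrict_keys with_var_def)
  have "koszul mvar vs (\<lambda>G. ?r (z G)) F = ?r (koszul mvar vs z F)" for F
    by (rule restrict_keys_koszul[where a = pvar, symmetric])
      (use v in \<open>auto simp: mvar_def lookup_add lookup_single when_def\<close>)
  then have "\<forall>F\<subseteq>set vs. card F = Suc i \<longrightarrow> koszul mvar vs (\<lambda>G. ?r (z G)) F \<in> monomial_ideal M"
    using z r by simp
  from koszul_vanishesD[OF koszul_depth_geD[OF d[unfolded monomial_depth_ge_def] i] this]
  obtain w where w: "\<forall>F\<subseteq>set vs. card F = i \<longrightarrow> ?r (z F) - koszul mvar vs w F \<in> monomial_ideal M" by blast
  have id: "ring_ideal (monomial_ideal (with_var M v) :: (('w \<Rightarrow>\<^sub>0 nat) \<Rightarrow>\<^sub>0 'k) set)"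
    using M by (intro ring_ideal_monomial_ideal upset_with_var)
  have sub: "monomial_ideal M \<subseteq> monomial_ideal (with_var M v)"
    by (rule monomial_ideal_mono) (simp add: with_var_def)
  show "\<exists>w. \<forall>F\<subseteq>set vs. card F = i \<longrightarrow> z F - koszul mvar vs w F \<in> monomial_ideal (with_var M v)"
  proof (rule exI[of _ w], intro allI impI)
    fix F assume F: "F \<subseteq> set vs" "card F = i"
    have "z F - ?r (z F) = restrict_keys {m. lookup m v > 0} (z F)"
      by (rule poly_mapping_eqI) (simp add: lookup_restrict_keys lookup_minus when_def)
    then have "z F - ?r (z F) \<in> monomial_ideal (with_var M v)"
      by (auto simp: monomial_ideal_def keys_restrict_keys with_var_def)
    moreover have "?r (z F) - koszul mvar vs w F \<in> monomial_ideal (with_var M v)"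
      using w F sub by blast
    ultimately have "(z F - ?r (z F)) + (?r (z F) - koszul mvar vs w F) \<in> monomial_ideal (with_var M v)"
      by (rule ring_ideal_add[OF id])
    then show "z F - koszul mvar vs w F \<in> monomial_ideal (with_var M v)" by simp
  qed
qed

lemma monomial_depth_ge_killed_var:
  assumes M: "upset M" and v: "v \<notin> set vs" and d: "monomial_depth_ge K vs d M"
  shows "monomial_depth_ge K (v # vs) d (with_var M v)"
  unfolding monomial_depth_ge_def
proof (rule koszul_depth_ge_Cons_zero[OF _ v])
  show "ring_ideal (monomial_ideal (with_var M v))"
    using M by (intro ring_ideal_monomial_ideal upset_with_var)
  show "mvar v \<in> monomial_ideal (with_var M v)"
    using mvar_mult_in_with_var[of v 1] by simp
qed (rule monomial_depth_ge_with_var[OF M v d, unfolded monomial_depth_ge_def])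

lemma monomial_depth_ge_free_var:
  assumes M: "upset M" and v: "v \<notin> set vs" and free: "colon_var M v = M"
    and d: "monomial_depth_ge K vs d M"
  shows "monomial_depth_ge K (v # vs) (d + 1) M"
  unfolding monomial_depth_ge_def
proof (rule koszul_depth_ge_Cons_regular[OF _ v _ _ _ _ _
      monomial_depth_ge_with_var[OF M v d, unfolded monomial_depth_ge_def]])
  show "ring_ideal (monomial_ideal M)" "ring_ideal (monomial_ideal (with_var M v))"
    using M by (intro ring_ideal_monomial_ideal upset_with_var; assumption)+
  show "mvar v * p \<in> monomial_ideal M \<Longrightarrow> p \<in> monomial_ideal M" for p
    by (simp add: mvar_mult_in_monomial_ideal free)
  show "monomial_ideal M \<subseteq> monomial_ideal (with_var M v)"
    by (rule monomial_ideal_mono) (simp add: with_var_def)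
  show "mvar v * p \<in> monomial_ideal (with_var M v)" for p
    by (rule mvar_mult_in_with_var)
  show "\<exists>u. q - mvar v * u \<in> monomial_ideal M" if "q \<in> monomial_ideal (with_var M v)" for q
    using that by (rule monomial_ideal_with_var_decomp)
qed

lemma monomial_depth_ge_perm:
  "upset M \<Longrightarrow> monomial_depth_ge K vs d M \<Longrightarrow> distinct us \<Longrightarrow> distinct vs \<Longrightarrow> set us = set vs \<Longrightarrow>
     monomial_depth_ge K us d M"
  unfolding monomial_depth_ge_def by (rule koszul_depth_ge_perm[OF ring_ideal_monomial_ideal])

lemma monomial_depth_ge_mono: "monomial_depth_ge K vs d M \<Longrightarrow> d' \<le> d \<Longrightarrow> monomial_depth_ge K vs d' M"
  unfolding monomial_depth_ge_def by (rule koszul_depth_ge_mono)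

lemma monomial_depth_ge_UNIV: "monomial_depth_ge K vs d UNIV"
  unfolding monomial_depth_ge_def monomial_ideal_def by (simp add: koszul_depth_ge_UNIV)

section \<open>Forests and powers of edge ideals\<close>

lemma forest_remove_vertex: "forest V E \<Longrightarrow> forest (V - {x}) {e\<in>E. x \<notin> e}"
  by (fastforce simp: forest_def simple_graph_def is_cycle_def)

text \<open>The first vertex \<open>x\<close> of a path of maximal length has all its neighbours on the path.  A neighbour other
than the second vertex of the path would close a cycle.\<close>

lemma forest_low_degree:
  assumes "forest V E" "V \<noteq> {}"
  obtains x where "x \<in> V" "\<And>e. e \<in> E \<Longrightarrow> x \<notin> e"
    | x z where "x \<in> V" "z \<in> V" "x \<noteq> z" "{e\<in>E. x \<in> e} = {{x, z}}"
proof -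
  have fin: "finite V" and edge: "\<And>e. e \<in> E \<Longrightarrow> \<exists>u\<in>V. \<exists>v\<in>V. u \<noteq> v \<and> e = {u, v}"
    and nocycle: "\<And>vs. \<not> is_cycle E vs"
    using assms(1) by (auto simp: forest_def simple_graph_def)
  define path where "path vs \<longleftrightarrow> vs \<noteq> [] \<and> distinct vs \<and> set vs \<subseteq> V \<and>
    (\<forall>i. Suc i < length vs \<longrightarrow> {vs ! i, vs ! Suc i} \<in> E)" for vs
  obtain v0 where "v0 \<in> V" using assms(2) by blast
  then have "path [v0]" by (simp add: path_def)
  moreover have bound: "length vs < Suc (card V)" if "path vs" for vs
    using that fin card_mono[of V "set vs"] by (auto simp: path_def distinct_card)
  ultimately obtain vs where vs: "path vs" and max: "\<And>ws. path ws \<Longrightarrow> length ws \<le> length vs"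
    using ex_has_greatest_nat[of path "[v0]" length "Suc (card V)"] by (meson less_imp_le)
  then obtain x ws where xs: "vs = x # ws" by (cases vs) (auto simp: path_def)
  have xV: "x \<in> V" using vs xs by (simp add: path_def)
  have inpath: "u \<in> set ws" if u: "{x, u} \<in> E" for u
  proof (rule ccontr)
    assume nu: "u \<notin> set ws"
    obtain a b where ab: "a \<in> V" "b \<in> V" "a \<noteq> b" "{x, u} = {a, b}" using edge[OF u] by blast
    then have "u \<in> V" "u \<noteq> x" by (auto simp: doubleton_eq_iff)
    then have "path (u # vs)"
      using vs nu u xs by (auto simp: path_def nth_Cons insert_commute split: nat.splits)
    from max[OF this] show False by simp
  qed
  have first: "u = ws ! 0" if u: "{x, u} \<in> E" for u
  proof (rule ccontr)
    assume ne: "u \<noteq> ws ! 0"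
    obtain j where j: "j < length ws" "u = ws ! j" using inpath[OF u] by (auto simp: in_set_conv_nth)
    with ne have j0: "j \<noteq> 0" by metis
    define cs where "cs = take (Suc (Suc j)) vs"
    have len: "length cs = Suc (Suc j)" using j xs by (simp add: cs_def)
    have "{cs ! i, cs ! (Suc i mod length cs)} \<in> E" if i: "i < length cs" for i
    proof (cases "Suc i < length cs")
      case True
      then have "cs ! i = vs ! i" "cs ! Suc i = vs ! Suc i" "Suc i < length vs"
        using len j by (simp_all add: cs_def xs del: take_Suc_Cons)
      then show ?thesis using vs True by (simp add: path_def)
    next
      case False
      then have "Suc i = length cs" using i by simp
      then have "cs ! (Suc i mod length cs) = x" "cs ! i = u"
        using len j xs by (auto simp: cs_def)
      then show ?thesis using u by (simp add: insert_commute)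
    qed
    moreover have "distinct cs" using vs by (auto simp: path_def cs_def)
    ultimately have "is_cycle E cs" using len j0 by (simp add: is_cycle_def)
    with nocycle show False by blast
  qed
  have xedge: "\<exists>u\<in>V. u \<noteq> x \<and> e = {x, u}" if "e \<in> E" "x \<in> e" for e
    using edge[OF that(1)] that(2) by (auto simp: doubleton_eq_iff)
  show thesis
  proof (cases "\<exists>e\<in>E. x \<in> e")
    case False
    then show thesis using xV that(1) by blast
  next
    case True
    then obtain e z where z: "e \<in> E" "z \<in> V" "z \<noteq> x" "e = {x, z}" using xedge by blast
    have "{e\<in>E. x \<in> e} = {{x, z}}"
    proof (intro equalityI subsetI)
      fix e' assume "e' \<in> {e\<in>E. x \<in> e}"
      then obtain u where "{x, u} \<in> E" "e' = {x, u}" using xedge by blast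
      moreover have "z = ws ! 0" using z first by blast
      ultimately show "e' \<in> {{x, z}}" using first by blast
    qed (use z in auto)
    then show thesis using that(2)[of x z] xV z by blast
  qed
qed

text \<open>The degree of \<open>v\<close> in a multigraph, that is, the exponent of \<open>v\<close> in the product of the edges.\<close>

definition incidence :: "'w set multiset \<Rightarrow> 'w \<Rightarrow> nat" where
  "incidence A v = size {#e \<in># A. v \<in> e#}"

text \<open>The monomials of the \<open>t\<close>-th power of the edge ideal: those divisible by a product of \<open>t\<close> edges.\<close>

definition edge_power :: "'w set set \<Rightarrow> nat \<Rightarrow> ('w \<Rightarrow>\<^sub>0 nat) set" where
  "edge_power E t = {m. \<exists>A. size A = t \<and> set_mset A \<subseteq> E \<and> (\<forall>v. incidence A v \<le> lookup m v)}"

lemma edge_powerI: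
  "size A = t \<Longrightarrow> set_mset A \<subseteq> E \<Longrightarrow> (\<And>v. incidence A v \<le> lookup m v) \<Longrightarrow> m \<in> edge_power E t"
  by (auto simp: edge_power_def)

lemma edge_powerE:
  assumes "m \<in> edge_power E t"
  obtains A where "size A = t" "set_mset A \<subseteq> E" "\<And>v. incidence A v \<le> lookup m v"
  using assms by (auto simp: edge_power_def)

lemma incidence_add_mset: "incidence (add_mset e A) v = incidence A v + (if v \<in> e then 1 else 0)"
  by (simp add: incidence_def)

lemma incidence_empty [simp]: "incidence {#} v = 0"
  by (simp add: incidence_def)

lemma incidence_zero_iff: "incidence A v = 0 \<longleftrightarrow> (\<forall>e\<in>#A. v \<notin> e)"
  by (auto simp: incidence_def)

lemma edge_power_0 [simp]: "edge_power E 0 = UNIV"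
  by (auto simp: edge_power_def)

lemma edge_power_mono: "E \<subseteq> E' \<Longrightarrow> edge_power E t \<subseteq> edge_power E' t"
  unfolding edge_power_def by (blast intro: order_trans)

lemma upset_edge_power: "upset (edge_power E t)"
  unfolding upset_def
proof (intro ballI allI)
  fix m n assume m: "m \<in> edge_power E t"
  obtain A where A: "size A = t" "set_mset A \<subseteq> E" "\<And>v. incidence A v \<le> lookup m v"
    using edge_powerE[OF m] by blast
  then show "n + m \<in> edge_power E t"
    by (intro edge_powerI[of A]) (auto simp: lookup_add intro: trans_le_add2)
qed

text \<open>A monomial not divisible by \<open>x\<close> is divisible only by products of edges that avoid \<open>x\<close>.\<close>

lemma with_var_edge_power:
  "with_var (edge_power E t) x = with_var (edge_power {e\<in>E. x \<notin> e} t) x"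
proof -
  have "m \<in> edge_power {e\<in>E. x \<notin> e} t" if m: "m \<in> edge_power E t" and x: "lookup m x = 0" for m
  proof -
    obtain A where A: "size A = t" "set_mset A \<subseteq> E" "\<And>v. incidence A v \<le> lookup m v"
      using edge_powerE[OF m] by blast
    have "incidence A x = 0" using A(3)[of x] x by simp
    then have "set_mset A \<subseteq> {e\<in>E. x \<notin> e}" using A(2) by (auto simp: incidence_zero_iff)
    then show ?thesis by (rule edge_powerI[OF A(1) _ A(3)])
  qed
  moreover have "edge_power {e\<in>E. x \<notin> e} t \<subseteq> edge_power E t" by (rule edge_power_mono) auto
  ultimately show ?thesis unfolding with_var_def by blast
qed

lemma colon_var_edge_power_isolated:
  assumes "\<And>e. e \<in> E \<Longrightarrow> x \<notin> e"
  shows "colon_var (edge_power E t) x = edge_power E t"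
proof -
  have "m \<in> edge_power E t" if m: "pvar x + m \<in> edge_power E t" for m
  proof -
    obtain A where A: "size A = t" "set_mset A \<subseteq> E" "\<And>v. incidence A v \<le> lookup (pvar x + m) v"
      using edge_powerE[OF m] by blast
    have "incidence A v \<le> lookup m v" for v
    proof (cases "v = x")
      case True
      have "incidence A x = 0" using assms A(2) by (auto simp: incidence_zero_iff)
      then show ?thesis using True by simp
    next
      case False
      then show ?thesis using A(3)[of v] by (simp add: lookup_add lookup_single)
    qed
    then show ?thesis by (rule edge_powerI[OF A(1,2)])
  qed
  moreover have "pvar x + m \<in> edge_power E t" if "m \<in> edge_power E t" for m
    using upset_edge_power that unfolding upset_def by blast
  ultimately show ?thesis unfolding colon_var_def by blast
qed

text \<open>Let \<open>t + 1\<close> edges divide \<open>x z m\<close>, where \<open>x\<close> is a leaf with neighbour \<open>z\<close>.  If \<open>x z\<close> is one of them, omit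
it.  Otherwise no edge contains \<open>x\<close>, and one omits an edge at \<open>z\<close>, or any edge if there is none at \<open>z\<close>.
In each case the remaining \<open>t\<close> edges divide \<open>m\<close>.\<close>

lemma colon_leaf_edge:
  assumes leaf: "{e\<in>E. x \<in> e} = {{x, z}}" and xz: "x \<noteq> z"
  shows "colon_var (colon_var (edge_power E (Suc t)) x) z = edge_power E t"
proof (intro equalityI subsetI)
  fix m assume m: "m \<in> edge_power E t"
  obtain A where A: "size A = t" "set_mset A \<subseteq> E" "\<And>v. incidence A v \<le> lookup m v"
    using edge_powerE[OF m] by blast
  have "pvar x + (pvar z + m) \<in> edge_power E (Suc t)"
  proof (rule edge_powerI[of "add_mset {x, z} A"])
    show "incidence (add_mset {x, z} A) v \<le> lookup (pvar x + (pvar z + m)) v" for v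
      using A(3)[of v] xz by (auto simp: incidence_add_mset lookup_add lookup_single when_def)
  qed (use A leaf in auto)
  then show "m \<in> colon_var (colon_var (edge_power E (Suc t)) x) z" by (simp add: colon_var_def)
next
  fix m assume "m \<in> colon_var (colon_var (edge_power E (Suc t)) x) z"
  then obtain A where A: "size A = Suc t" "set_mset A \<subseteq> E"
      "\<And>v. incidence A v \<le> lookup (pvar x + (pvar z + m)) v"
    unfolding colon_var_def by (auto elim!: edge_powerE)
  have lookup: "lookup (pvar x + (pvar z + m)) v =
      lookup m v + (if v = x then 1 else 0) + (if v = z then 1 else 0)" for v
    using xz by (simp add: lookup_add lookup_single when_def)
  note A3 = A(3)[unfolded lookup]
  obtain e where e: "e \<in># A" "incidence (A - {#e#}) x \<le> lookup m x" "incidence (A - {#e#}) z \<le> lookup m z"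
  proof (cases "{x, z} \<in># A")
    case True
    then obtain B where B: "A = add_mset {x, z} B" by (meson multi_member_split)
    show thesis
      by (rule that[OF True]) (use A3[of x] A3[of z] xz B in \<open>simp_all add: incidence_add_mset\<close>)
  next
    case False
    have "x \<notin> e" if "e \<in># A" for e
      using that A(2) leaf False by (metis (mono_tags, lifting) mem_Collect_eq singletonD subsetD)
    then have Ax: "incidence A x = 0" by (simp add: incidence_zero_iff)
    obtain e where e: "e \<in># A" "incidence A z = 0 \<or> z \<in> e"
    proof (cases "incidence A z = 0")
      case True
      have "A \<noteq> {#}" using A(1) by auto
      then show thesis using that True by blast
    next
      case False
      then show thesis using that by (auto simp: incidence_zero_iff)
    qed
    obtain B where B: "A = add_mset e B" using e by (meson multi_member_split)
    show thesis
      by (rule that[OF e(1)]) (use A3[of z] Ax xz e(2) B in \<open>auto simp: incidence_add_mset split: if_splits\<close>)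
  qed
  obtain B where B: "A = add_mset e B" using e(1) by (meson multi_member_split)
  show "m \<in> edge_power E t"
  proof (rule edge_powerI[of B])
    fix v
    have "incidence B v \<le> incidence A v" using B by (simp add: incidence_add_mset)
    then show "incidence B v \<le> lookup m v"
      using A3[of v] e(2,3) B by (cases "v = x"; cases "v = z") auto
  qed (use A B in auto)
qed

lemma with_var_colon_edge_power:
  assumes xz: "x \<noteq> z"
  shows "with_var (colon_var (edge_power E t) x) z = with_var (colon_var (edge_power {e\<in>E. z \<notin> e} t) x) z"
proof -
  have "with_var (colon_var (edge_power E t) x) z = colon_var (with_var (edge_power E t) z) x"
    by (rule colon_var_with_var[OF xz, symmetric])
  also have "\<dots> = colon_var (with_var (edge_power {e\<in>E. z \<notin> e} t) z) x"
    by (simp only: with_var_edge_power[of E t z])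
  also have "\<dots> = with_var (colon_var (edge_power {e\<in>E. z \<notin> e} t) x) z"
    by (rule colon_var_with_var[OF xz])
  finally show ?thesis .
qed

text \<open>Once \<open>z\<close> is removed, \<open>x\<close> is isolated, so the colon by \<open>x\<close> has no effect.\<close>

lemma with_neighbour_colon_leaf:
  assumes leaf: "{e\<in>E. x \<in> e} = {{x, z}}" and xz: "x \<noteq> z"
  shows "with_var (colon_var (edge_power E t) x) z = with_var (edge_power {e\<in>E. z \<notin> e} t) z"
proof -
  have iso: "colon_var (edge_power {e\<in>E. z \<notin> e} t) x = edge_power {e\<in>E. z \<notin> e} t"
    by (rule colon_var_edge_power_isolated) (use leaf in blast)
  show ?thesis using with_var_colon_edge_power[OF xz, of E t] unfolding iso .
qed

section \<open>The depth of powers of a whiskered forest\<close>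

lemma whisker_edges_remove_vertex:
  "{e \<in> whisker_edges E U. Inl x \<notin> e} = whisker_edges {e\<in>E. x \<notin> e} (U - {x})"
  by (auto simp: whisker_edges_def)

lemma whisker_edges_remove_whisker:
  "{e \<in> whisker_edges E U. Inr x \<notin> e} = whisker_edges E (U - {x})"
  by (auto simp: whisker_edges_def)

lemma whisker_edges_at_whisker:
  "x \<in> U \<Longrightarrow> {e \<in> whisker_edges E U. Inr x \<in> e} = {{Inr x, Inl x}}"
  by (auto simp: whisker_edges_def)

lemma whisker_edges_at_vertex:
  "x \<notin> U \<Longrightarrow> {e \<in> whisker_edges E U. Inl x \<in> e} = (`) Inl ` {e\<in>E. x \<in> e}"
  by (auto simp: whisker_edges_def)

text \<open>The statement of the induction.  All enumerations of the vertices are admitted, so that any convenient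
one may be chosen.\<close>

definition whisker_depth_bound ::
  "'k::field itself \<Rightarrow> 'v set \<Rightarrow> 'v set set \<Rightarrow> 'v set \<Rightarrow> nat \<Rightarrow> bool" where
  "whisker_depth_bound K V E U t \<longleftrightarrow>
     (\<forall>vs. distinct vs \<longrightarrow> set vs = whisker_verts V U \<longrightarrow>
        monomial_depth_ge K vs (int (card U) - int t + 1) (edge_power (whisker_edges E U) t))"

lemma whisker_depth_boundD:
  "whisker_depth_bound K V E U t \<Longrightarrow> distinct vs \<Longrightarrow> set vs = whisker_verts V U \<Longrightarrow>
     d \<le> int (card U) - int t + 1 \<Longrightarrow> monomial_depth_ge K vs d (edge_power (whisker_edges E U) t)"
  unfolding whisker_depth_bound_def by (blast intro: monomial_depth_ge_mono)

text \<open>The colon by a vertex of low degree without a whisker gains one, since the exponent is \<open>Suc t\<close> and the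
bound for the power itself is \<open>|U| - t\<close>.  The reason is that \<open>x\<close> is a free variable,
either of the ideal itself or of its sum with the neighbour \<open>z\<close>, and that the colon by the edge \<open>x z\<close>
lowers the exponent.\<close>

lemma colon_low_degree_vertex:
  fixes V U :: "'v set"
  assumes fo: "forest V E" and UV: "U \<subseteq> V" and x: "x \<in> V" "x \<notin> U"
    and low: "(\<forall>e\<in>E. x \<notin> e) \<or> (\<exists>z\<in>V. x \<noteq> z \<and> {e\<in>E. x \<in> e} = {{x, z}})"
    and prev: "whisker_depth_bound K V E U t"
    and smaller: "\<And>(V' :: 'v set) E' U'. forest V' E' \<Longrightarrow> U' \<subseteq> V' \<Longrightarrow> card V' < card V \<Longrightarrow>
      whisker_depth_bound K V' E' U' (Suc t)"
    and vs: "distinct vs" "set vs = whisker_verts V U"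
  shows "monomial_depth_ge K vs (int (card U) - int t + 1)
     (colon_var (edge_power (whisker_edges E U) (Suc t)) (Inl x))"
proof -
  have finV: "finite V" using fo by (simp add: forest_def simple_graph_def)
  have finU: "finite U" using finV UV by (rule rev_finite_subset)
  have fin: "finite (whisker_verts A B)" if "A \<subseteq> V" "B \<subseteq> V" for A B
    using that finV by (auto simp: whisker_verts_def intro: finite_subset)
  show ?thesis
    using low
  proof
    assume iso: "\<forall>e\<in>E. x \<notin> e"
    then have E: "{e\<in>E. x \<notin> e} = E" by auto
    have iso': "colon_var (edge_power (whisker_edges E U) (Suc t)) (Inl x) = edge_power (whisker_edges E U) (Suc t)"
      by (rule colon_var_edge_power_isolated) (use iso x in \<open>auto simp: whisker_edges_def\<close>)
    obtain ws where ws: "set ws = whisker_verts (V - {x}) U" "distinct ws"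
      using finite_distinct_list[OF fin[of "V - {x}" U]] UV by auto
    have "whisker_depth_bound K (V - {x}) {e\<in>E. x \<notin> e} U (Suc t)"
    proof (rule smaller)
      show "forest (V - {x}) {e\<in>E. x \<notin> e}" using fo by (rule forest_remove_vertex)
      show "U \<subseteq> V - {x}" using UV x by auto
      show "card (V - {x}) < card V" using finV x by (intro card_Diff1_less)
    qed
    then have "monomial_depth_ge K ws (int (card U) - int t) (edge_power (whisker_edges E U) (Suc t))"
      unfolding E using ws by (intro whisker_depth_boundD) auto
    from monomial_depth_ge_free_var[OF upset_edge_power _ iso' this]
    have "monomial_depth_ge K (Inl x # ws) (int (card U) - int t + 1) (edge_power (whisker_edges E U) (Suc t))"
      using ws by (auto simp: whisker_verts_def)
    then show ?thesis unfolding iso'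
      by (rule monomial_depth_ge_perm[OF upset_edge_power])
        (use vs ws x in \<open>auto simp: whisker_verts_def\<close>)
  next
    assume "\<exists>z\<in>V. x \<noteq> z \<and> {e\<in>E. x \<in> e} = {{x, z}}"
    then obtain z where z: "z \<in> V" "x \<noteq> z" "{e\<in>E. x \<in> e} = {{x, z}}" by blast
    let ?W = "whisker_edges E U"
    let ?E' = "{e\<in>E. z \<notin> e}"
    let ?N = "edge_power (whisker_edges ?E' (U - {z})) (Suc t)"
    have leaf: "{e \<in> ?W. Inl x \<in> e} = {{Inl x, Inl z}}"
      using whisker_edges_at_vertex[OF x(2), of E] z(3) by simp
    have xE': "x \<notin> e" if "e \<in> E" "z \<notin> e" for e using z(3) that by blast
    then have E': "{e\<in>?E'. x \<notin> e} = ?E'" by blast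
    have iso: "colon_var ?N (Inl x) = ?N"
      by (rule colon_var_edge_power_isolated) (use xE' x in \<open>auto simp: whisker_edges_def\<close>)
    have upN: "upset ?N" "upset (with_var ?N (Inl z))" by (simp_all add: upset_edge_power upset_with_var)
    obtain ws where ws: "set ws = whisker_verts (V - {z} - {x}) (U - {z})" "distinct ws"
      using finite_distinct_list[OF fin[of "V - {z} - {x}" "U - {z}"]] UV by auto
    have "whisker_depth_bound K (V - {z} - {x}) {e\<in>?E'. x \<notin> e} (U - {z}) (Suc t)"
    proof (rule smaller)
      show "forest (V - {z} - {x}) {e\<in>?E'. x \<notin> e}" using fo by (intro forest_remove_vertex)
      show "U - {z} \<subseteq> V - {z} - {x}" using UV x by auto
      show "card (V - {z} - {x}) < card V" using finV x z(1,2) by (intro psubset_card_mono) auto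
    qed
    then have wsN: "monomial_depth_ge K ws (int (card (U - {z})) - int t) ?N"
      unfolding E' using ws by (intro whisker_depth_boundD) auto
    define us where "us = (if z \<in> U then Inr z # ws else ws)"
    have us: "set us = whisker_verts (V - {z} - {x}) (U - {z}) \<union> (if z \<in> U then {Inr z} else {})" "distinct us"
      using ws by (auto simp: us_def whisker_verts_def)
    have usN: "monomial_depth_ge K us (int (card U) - int t) ?N"
    proof (cases "z \<in> U")
      case True
      have "colon_var ?N (Inr z) = ?N"
        by (rule colon_var_edge_power_isolated) (auto simp: whisker_edges_def)
      then have "monomial_depth_ge K (Inr z # ws) (int (card (U - {z})) - int t + 1) ?N"
        by (intro monomial_depth_ge_free_var upN wsN) (use ws in \<open>auto simp: whisker_verts_def\<close>)
      then have "monomial_depth_ge K (Inr z # ws) (int (card U) - int t) ?N"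
        by (rule monomial_depth_ge_mono) (use card.remove[OF finU True] in linarith)
      then show ?thesis using True by (simp add: us_def)
    next
      case False
      then show ?thesis using wsN by (simp add: us_def)
    qed
    have "monomial_depth_ge K (Inl z # us) (int (card U) - int t) (with_var ?N (Inl z))"
      by (rule monomial_depth_ge_killed_var[OF upN(1) _ usN]) (use us in \<open>auto simp: whisker_verts_def\<close>)
    moreover have "colon_var (with_var ?N (Inl z)) (Inl x) = with_var ?N (Inl z)"
      using z(2) by (simp add: colon_var_with_var iso)
    ultimately have "monomial_depth_ge K (Inl x # Inl z # us) (int (card U) - int t + 1) (with_var ?N (Inl z))"
      by (intro monomial_depth_ge_free_var upN) (use us z(2) in \<open>auto simp: whisker_verts_def\<close>)
    then have "monomial_depth_ge K vs (int (card U) - int t + 1) (with_var ?N (Inl z))"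
      by (rule monomial_depth_ge_perm[OF upN(2)])
        (use vs us x z(1,2) UV in \<open>auto simp: whisker_verts_def split: if_splits\<close>)
    then have B: "monomial_depth_ge K vs (int (card U) - int t + 1)
        (with_var (colon_var (edge_power ?W (Suc t)) (Inl x)) (Inl z))"
      using with_neighbour_colon_leaf[OF leaf, of "Suc t"] z(2) by (simp add: whisker_edges_remove_vertex)
    have "monomial_depth_ge K vs (int (card U) - int t + 1)
        (colon_var (colon_var (edge_power ?W (Suc t)) (Inl x)) (Inl z))"
      using whisker_depth_boundD[OF prev vs] colon_leaf_edge[OF leaf, of t] z(2) by simp
    then show ?thesis
      using B by (rule monomial_depth_ge_colon_var[OF upset_colon_var[OF upset_edge_power]])
  qed
qed

lemma whiskered_forest_depth:
  fixes V U :: "'v set"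
  shows "forest V E \<Longrightarrow> U \<subseteq> V \<Longrightarrow> whisker_depth_bound K V E U t"
proof (induction t arbitrary: V E U)
  case 0
  then show ?case by (simp add: whisker_depth_bound_def monomial_depth_ge_UNIV)
next
  case (Suc t)
  note prev = Suc.IH
  show ?case using Suc.prems
  proof (induction "card V" arbitrary: V E U rule: less_induct)
    case less
    note fo = less.prems(1) and UV = less.prems(2)
    have smaller: "whisker_depth_bound K V' E' U' (Suc t)"
      if "forest V' E'" "U' \<subseteq> V'" "card V' < card V" for V' U' :: "'v set" and E'
      using less.hyps that by blast
    have finV: "finite V" using fo by (simp add: forest_def simple_graph_def)
    have finU: "finite U" using finV UV by (rule rev_finite_subset)
    have fin: "finite (whisker_verts A B)" if "A \<subseteq> V" "B \<subseteq> V" for A B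
      using that finV by (auto simp: whisker_verts_def intro: finite_subset)
    show ?case
    proof (cases "V = {}")
      case True
      then have "U = {}" using UV by simp
      have "\<not> int i < int (card U) - int (Suc t) + 1" for i
        unfolding \<open>U = {}\<close> by simp
      then show ?thesis
        unfolding whisker_depth_bound_def monomial_depth_ge_def koszul_depth_ge_def by blast
    next
      case False
      obtain x where x: "x \<in> V"
        and low: "(\<forall>e\<in>E. x \<notin> e) \<or> (\<exists>z\<in>V. x \<noteq> z \<and> {e\<in>E. x \<in> e} = {{x, z}})"
        by (rule forest_low_degree[OF fo False]) blast+
      let ?W = "whisker_edges E U"
      let ?M = "edge_power ?W (Suc t)"
      let ?N = "edge_power (whisker_edges {e\<in>E. x \<notin> e} (U - {x})) (Suc t)"
      show ?thesis unfolding whisker_depth_bound_def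
      proof (intro allI impI)
        fix vs :: "('v + 'v) list"
        assume vs: "distinct vs" "set vs = whisker_verts V U"
        obtain ws where ws: "set ws = whisker_verts (V - {x}) (U - {x})" "distinct ws"
          using finite_distinct_list[OF fin[of "V - {x}" "U - {x}"]] UV by auto
        have "whisker_depth_bound K (V - {x}) {e\<in>E. x \<notin> e} (U - {x}) (Suc t)"
        proof (rule smaller)
          show "forest (V - {x}) {e\<in>E. x \<notin> e}" using fo by (rule forest_remove_vertex)
          show "U - {x} \<subseteq> V - {x}" using UV x by auto
          show "card (V - {x}) < card V" using finV x by (intro card_Diff1_less)
        qed
        then have "monomial_depth_ge K ws (int (card (U - {x})) - int t) ?N"
          using ws by (intro whisker_depth_boundD) auto
        then have wsN: "monomial_depth_ge K (Inl x # ws) (int (card (U - {x})) - int t) (with_var ?N (Inl x))"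
          by (rule monomial_depth_ge_killed_var[OF upset_edge_power, rotated])
            (use ws in \<open>auto simp: whisker_verts_def\<close>)
        have upN: "upset (with_var ?N (Inl x))" by (simp add: upset_edge_power upset_with_var)
        have kill: "with_var ?M (Inl x) = with_var ?N (Inl x)"
          using with_var_edge_power[of ?W "Suc t" "Inl x"] unfolding whisker_edges_remove_vertex .
        \<comment> \<open>Without \<open>x\<close> the set \<open>U\<close> may shrink by one, and then the whisker of \<open>x\<close> is free.\<close>
        have B: "monomial_depth_ge K vs (int (card U) - int t) (with_var ?M (Inl x))"
        proof (cases "x \<in> U")
          case False
          then have U: "U - {x} = U" by simp
          have "set vs = set (Inl x # ws)" unfolding vs(2) list.set ws(1) U
            using x by (auto simp: whisker_verts_def)
          moreover have "distinct (Inl x # ws)" using ws by (auto simp: whisker_verts_def)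
          moreover have "monomial_depth_ge K (Inl x # ws) (int (card U) - int t) (with_var ?N (Inl x))"
            using wsN unfolding U .
          ultimately show ?thesis unfolding kill
            using monomial_depth_ge_perm[OF upN _ vs(1)] by blast
        next
          case True
          have "colon_var (with_var ?N (Inl x)) (Inr x) = with_var ?N (Inl x)"
          proof -
            have "colon_var ?N (Inr x) = ?N"
              by (rule colon_var_edge_power_isolated) (auto simp: whisker_edges_def)
            then show ?thesis by (simp add: colon_var_with_var)
          qed
          then have "monomial_depth_ge K (Inr x # Inl x # ws) (int (card (U - {x})) - int t + 1) (with_var ?N (Inl x))"
            by (intro monomial_depth_ge_free_var upN wsN) (use ws in \<open>auto simp: whisker_verts_def\<close>)
          then have "monomial_depth_ge K (Inr x # Inl x # ws) (int (card U) - int t) (with_var ?N (Inl x))"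
            by (rule monomial_depth_ge_mono) (use card.remove[OF finU True] in linarith)
          moreover have "set vs = set (Inr x # Inl x # ws)" unfolding vs(2) list.set ws(1)
            using x True by (auto simp: whisker_verts_def)
          moreover have "distinct (Inr x # Inl x # ws)" using ws by (auto simp: whisker_verts_def)
          ultimately show ?thesis unfolding kill
            using monomial_depth_ge_perm[OF upN _ vs(1)] by blast
        qed
        have "monomial_depth_ge K vs (int (card U) - int t) (colon_var ?M (Inl x))"
        proof (cases "x \<in> U")
          case False
          from colon_low_degree_vertex[OF fo UV x False low prev[OF fo UV] smaller vs]
          show ?thesis by (rule monomial_depth_ge_mono) auto
        next
          case True
          \<comment> \<open>The second colon, by the whisker: \<open>?M'\<close> belongs to the forest without it.\<close>
          let ?M' = "edge_power (whisker_edges E (U - {x})) (Suc t)"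
          obtain us where us: "set us = whisker_verts V (U - {x})" "distinct us"
            using finite_distinct_list[OF fin[of V "U - {x}"]] UV by auto
          have UxV: "U - {x} \<subseteq> V" and xU: "x \<notin> U - {x}" using UV by auto
          have "int (card U) = int (card (U - {x})) + 1"
            unfolding card.remove[OF finU True] by simp
          then have le: "int (card U) - int t \<le> int (card (U - {x})) - int t + 1" by linarith
          have "monomial_depth_ge K us (int (card U) - int t) (colon_var ?M' (Inl x))"
            by (rule monomial_depth_ge_mono[OF
                  colon_low_degree_vertex[OF fo UxV x xU low prev[OF fo UxV] smaller us(2,1)] le])
          then have "monomial_depth_ge K (Inr x # us) (int (card U) - int t) (with_var (colon_var ?M' (Inl x)) (Inr x))"
            by (rule monomial_depth_ge_killed_var[OF upset_colon_var[OF upset_edge_power], rotated])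
              (use us in \<open>auto simp: whisker_verts_def\<close>)
          then have "monomial_depth_ge K vs (int (card U) - int t) (with_var (colon_var ?M' (Inl x)) (Inr x))"
            by (rule monomial_depth_ge_perm[OF upset_with_var[OF upset_colon_var[OF upset_edge_power]]])
              (use vs us True in \<open>auto simp: whisker_verts_def\<close>)
          moreover have "with_var (colon_var ?M (Inl x)) (Inr x) = with_var (colon_var ?M' (Inl x)) (Inr x)"
            using with_var_colon_edge_power[of "Inl x" "Inr x" ?W "Suc t"]
            by (simp add: whisker_edges_remove_whisker)
          ultimately have C: "monomial_depth_ge K vs (int (card U) - int t) (with_var (colon_var ?M (Inl x)) (Inr x))"
            by simp
          have leaf: "colon_var (colon_var ?M (Inl x)) (Inr x) = edge_power ?W t"
          proof -
            have "colon_var (colon_var ?M (Inl x)) (Inr x) = colon_var (colon_var ?M (Inr x)) (Inl x)"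
              by (simp add: colon_var_def add.left_commute)
            then show ?thesis using colon_leaf_edge[OF whisker_edges_at_whisker[OF True]] by auto
          qed
          have "monomial_depth_ge K vs (int (card U) - int t) (colon_var (colon_var ?M (Inl x)) (Inr x))"
            unfolding leaf by (rule whisker_depth_boundD[OF prev[OF fo UV] vs]) simp
          then show ?thesis
            using C by (rule monomial_depth_ge_colon_var[OF upset_colon_var[OF upset_edge_power]])
        qed
        then show "monomial_depth_ge K vs (int (card U) - int (Suc t) + 1) ?M"
          using B by (intro monomial_depth_ge_colon_var[OF upset_edge_power]) auto
      qed
    qed
  qed
qed

section \<open>Koszul cochains with values in injective modules\<close>

lemma (in abelian_group) diff_zero: "x \<in> carrier G \<Longrightarrow> x \<ominus> \<zero> = x"
  using r_neg[of \<zero>] by (simp add: minus_eq)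

lemma (in abelian_group) diff_self: "x \<in> carrier G \<Longrightarrow> x \<ominus> x = \<zero>"
  by (simp add: minus_eq r_neg)

lemma (in abelian_group) diff_eq_zero:
  assumes "x \<in> carrier G" "y \<in> carrier G" "x \<ominus> y = \<zero>" shows "x = y"
proof -
  have "x = (x \<ominus> y) \<oplus> y" using assms(1,2) by (simp add: minus_eq a_assoc l_neg)
  then show ?thesis using assms by simp
qed

lemma (in abelian_group) diff_diff:
  "x \<in> carrier G \<Longrightarrow> y \<in> carrier G \<Longrightarrow> x \<ominus> (x \<ominus> y) = y"
  by (simp add: minus_eq minus_add a_assoc[symmetric] r_neg)

lemma (in module) smult_r_diff:
  "a \<in> carrier R \<Longrightarrow> x \<in> carrier M \<Longrightarrow> y \<in> carrier M \<Longrightarrow>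
     a \<odot>\<^bsub>M\<^esub> (x \<ominus>\<^bsub>M\<^esub> y) = a \<odot>\<^bsub>M\<^esub> x \<ominus>\<^bsub>M\<^esub> a \<odot>\<^bsub>M\<^esub> y"
  by (simp add: M.minus_eq smult_r_distr smult_r_minus)

lemma mod_homD:
  assumes M: "module R M" and N: "module R N" and f: "f \<in> mod_hom R M N"
  shows "\<And>x. x \<in> carrier M \<Longrightarrow> f x \<in> carrier N"
    and "\<And>x y. x \<in> carrier M \<Longrightarrow> y \<in> carrier M \<Longrightarrow> f (x \<oplus>\<^bsub>M\<^esub> y) = f x \<oplus>\<^bsub>N\<^esub> f y"
    and "\<And>a x. a \<in> carrier R \<Longrightarrow> x \<in> carrier M \<Longrightarrow> f (a \<odot>\<^bsub>M\<^esub> x) = a \<odot>\<^bsub>N\<^esub> f x"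
    and "f \<zero>\<^bsub>M\<^esub> = \<zero>\<^bsub>N\<^esub>"
    and "\<And>x y. x \<in> carrier M \<Longrightarrow> y \<in> carrier M \<Longrightarrow> f (x \<ominus>\<^bsub>M\<^esub> y) = f x \<ominus>\<^bsub>N\<^esub> f y"
proof -
  interpret M: module R M by fact
  interpret N: module R N by fact
  have hom: "f \<in> hom (add_monoid M) (add_monoid N)" using f by (simp add: mod_hom_def)
  interpret group_hom "add_monoid M" "add_monoid N" f
    by (intro group_hom.intro group_hom_axioms.intro hom M.M.a_group N.M.a_group)
  show cl: "f x \<in> carrier N" if "x \<in> carrier M" for x
    using hom_closed[of x] that by simp
  show add: "f (x \<oplus>\<^bsub>M\<^esub> y) = f x \<oplus>\<^bsub>N\<^esub> f y" if "x \<in> carrier M" "y \<in> carrier M" for x y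
    using hom_mult[of x y] that by simp
  show "f (a \<odot>\<^bsub>M\<^esub> x) = a \<odot>\<^bsub>N\<^esub> f x" if "a \<in> carrier R" "x \<in> carrier M" for a x
    using f that by (simp add: mod_hom_def)
  show "f \<zero>\<^bsub>M\<^esub> = \<zero>\<^bsub>N\<^esub>" using hom_one by simp
  have "f (\<ominus>\<^bsub>M\<^esub> y) = \<ominus>\<^bsub>N\<^esub> f y" if "y \<in> carrier M" for y
    using hom_inv[of y] that by (simp add: a_inv_def)
  then show "f (x \<ominus>\<^bsub>M\<^esub> y) = f x \<ominus>\<^bsub>N\<^esub> f y" if "x \<in> carrier M" "y \<in> carrier M" for x y
    using that add[of x "\<ominus>\<^bsub>M\<^esub> y"] by (simp add: M.M.minus_eq N.M.minus_eq)
qed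

text \<open>The same complex as \<^const>\<open>koszul\<close>, with values in a module that is given by a carrier.\<close>

primrec mkoszul :: "('a, 'b, 'n) module_scheme \<Rightarrow> ('w \<Rightarrow> 'a) \<Rightarrow> 'w list \<Rightarrow> ('w set \<Rightarrow> 'b) \<Rightarrow> 'w set \<Rightarrow> 'b" where
  "mkoszul M g [] z F = \<zero>\<^bsub>M\<^esub>"
| "mkoszul M g (v # vs) z F =
     (if v \<in> F then g v \<odot>\<^bsub>M\<^esub> z (F - {v}) \<ominus>\<^bsub>M\<^esub> mkoszul M g vs (\<lambda>G. z (insert v G)) (F - {v})
      else mkoszul M g vs z F)"

lemma mkoszul_cong:
  "(\<And>u. u \<in> F \<Longrightarrow> z (F - {u}) = z' (F - {u})) \<Longrightarrow> mkoszul M g vs z F = mkoszul M g vs z' F"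
proof (induction vs arbitrary: z z' F)
  case (Cons v vs)
  have "mkoszul M g vs (\<lambda>G. z (insert v G)) (F - {v}) = mkoszul M g vs (\<lambda>G. z' (insert v G)) (F - {v})"
    if "v \<in> F"
  proof (rule Cons.IH)
    fix u assume u: "u \<in> F - {v}"
    then have "insert v (F - {v} - {u}) = F - {u}" using that by auto
    then show "z (insert v (F - {v} - {u})) = z' (insert v (F - {v} - {u}))"
      using Cons.prems[of u] u by simp
  qed
  moreover have "mkoszul M g vs z F = mkoszul M g vs z' F" by (rule Cons.IH, rule Cons.prems)
  ultimately show ?case using Cons.prems by auto
qed simp

lemma mkoszul_hom:
  assumes M: "module R M" and N: "module R N" and f: "f \<in> mod_hom R M N"
    and g: "g ` set vs \<subseteq> carrier R" and z: "\<And>F. z F \<in> carrier M"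
  shows "mkoszul M g vs z F \<in> carrier M \<and> mkoszul N g vs (\<lambda>G. f (z G)) F = f (mkoszul M g vs z F)"
  using g z
proof (induction vs arbitrary: z F)
  case Nil
  interpret M: module R M by fact
  show ?case by (simp add: mod_homD(4)[OF M N f])
next
  case (Cons v vs)
  interpret M: module R M by fact
  note IH = Cons.IH[OF _ Cons.prems(2)] Cons.IH[of "\<lambda>G. z (insert v G)", OF _ Cons.prems(2)]
  have cl: "g v \<odot>\<^bsub>M\<^esub> z (F - {v}) \<in> carrier M" using Cons.prems by simp
  show ?case using Cons.prems IH cl
    by (simp add: mod_homD(3,5)[OF M N f])
qed

context module
begin

lemma mkoszul_closed:
  "g ` set vs \<subseteq> carrier R \<Longrightarrow> (\<And>F. z F \<in> carrier M) \<Longrightarrow> mkoszul M g vs z F \<in> carrier M"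
  by (induction vs arbitrary: z F) auto

lemma mkoszul_scale:
  assumes "a \<in> carrier R"
  shows "g ` set vs \<subseteq> carrier R \<Longrightarrow> (\<And>F. z F \<in> carrier M) \<Longrightarrow>
    mkoszul M g vs (\<lambda>G. a \<odot>\<^bsub>M\<^esub> z G) F = a \<odot>\<^bsub>M\<^esub> mkoszul M g vs z F"
proof (induction vs arbitrary: z F)
  case (Cons v vs)
  then show ?case using assms
    by (simp add: smult_r_diff mkoszul_closed smult_assoc1[symmetric] R.m_comm)
qed (simp add: assms)

lemma mkoszul_diff:
  "g ` set vs \<subseteq> carrier R \<Longrightarrow> (\<And>F. z F \<in> carrier M) \<Longrightarrow> (\<And>F. z' F \<in> carrier M) \<Longrightarrow>
    mkoszul M g vs (\<lambda>G. z G \<ominus>\<^bsub>M\<^esub> z' G) F = mkoszul M g vs z F \<ominus>\<^bsub>M\<^esub> mkoszul M g vs z' F"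
proof (induction vs arbitrary: z z' F)
  case (Cons v vs)
  have *: "(a \<ominus>\<^bsub>M\<^esub> b) \<ominus>\<^bsub>M\<^esub> (c \<ominus>\<^bsub>M\<^esub> d) = (a \<ominus>\<^bsub>M\<^esub> c) \<ominus>\<^bsub>M\<^esub> (b \<ominus>\<^bsub>M\<^esub> d)"
    if "a \<in> carrier M" "b \<in> carrier M" "c \<in> carrier M" "d \<in> carrier M" for a b c d
    using that by (simp add: M.minus_eq M.minus_add M.a_ac)
  show ?case using Cons by (simp add: smult_r_diff mkoszul_closed *)
qed (simp add: M.diff_zero)

lemma mkoszul_mkoszul:
  "g ` set vs \<subseteq> carrier R \<Longrightarrow> (\<And>F. z F \<in> carrier M) \<Longrightarrow>
    mkoszul M g vs (mkoszul M g vs z) F = \<zero>\<^bsub>M\<^esub>"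
proof (induction vs arbitrary: z F)
  case (Cons v vs)
  have g: "g v \<in> carrier R" "g ` set vs \<subseteq> carrier R" using Cons.prems by auto
  note cl = mkoszul_closed[OF g(2)] and IH = Cons.IH[OF g(2)]
  show ?case
  proof (cases "v \<in> F")
    case False
    have "mkoszul M g vs (mkoszul M g (v # vs) z) F = mkoszul M g vs (mkoszul M g vs z) F"
      by (rule mkoszul_cong) (use False in auto)
    then show ?thesis using False IH[OF Cons.prems(2)]
      by (simp del: mkoszul.simps add: mkoszul.simps(2)[of M g v vs "mkoszul M g (v # vs) z"])
  next
    case True
    have "mkoszul M g vs (\<lambda>G. mkoszul M g (v # vs) z (insert v G)) (F - {v})
        = mkoszul M g vs (\<lambda>G. g v \<odot>\<^bsub>M\<^esub> z G \<ominus>\<^bsub>M\<^esub> mkoszul M g vs (\<lambda>G. z (insert v G)) G) (F - {v})"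
      by (rule mkoszul_cong) auto
    also have "\<dots> = mkoszul M g vs (\<lambda>G. g v \<odot>\<^bsub>M\<^esub> z G) (F - {v}) \<ominus>\<^bsub>M\<^esub>
        mkoszul M g vs (mkoszul M g vs (\<lambda>G. z (insert v G))) (F - {v})"
      by (rule mkoszul_diff[OF g(2)]) (use g Cons.prems cl in auto)
    also have "\<dots> = g v \<odot>\<^bsub>M\<^esub> mkoszul M g vs z (F - {v})"
      using g Cons.prems cl IH by (simp add: mkoszul_scale M.diff_zero)
    finally have *: "mkoszul M g vs (\<lambda>G. mkoszul M g (v # vs) z (insert v G)) (F - {v}) =
      g v \<odot>\<^bsub>M\<^esub> mkoszul M g vs z (F - {v})" .
    have "mkoszul M g (v # vs) z (F - {v}) = mkoszul M g vs z (F - {v})" by simp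
    then show ?thesis using True g cl Cons.prems *
      by (simp del: mkoszul.simps add: mkoszul.simps(2)[of M g v vs "mkoszul M g (v # vs) z"] M.diff_self)
  qed
qed simp

lemma mkoszul_singleton:
  assumes "g ` set vs \<subseteq> carrier R" "\<And>F. z F \<in> carrier M" "u \<in> set vs" "distinct vs"
  shows "mkoszul M g vs z {u} = g u \<odot>\<^bsub>M\<^esub> z {}"
  using assms
proof (induction vs)
  case (Cons v vs)
  have e: "mkoszul M g vs y {} = \<zero>\<^bsub>M\<^esub>" for y by (induction vs arbitrary: y) auto
  show ?case using Cons e by (auto simp: M.diff_zero)
qed simp

text \<open>This is surjectivity of \<open>Hom(R/K, M) \<rightarrow> Hom(R/K, M)\<close> for multiplication by \<open>a\<close>, which is injective on
\<open>R/K\<close>.  Baer's criterion applies to the linear map on \<open>K + aR\<close> that sends \<open>k + a r\<close> to \<open>r x\<close>; it is well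
defined because \<open>a\<close> is regular modulo \<open>K\<close>.\<close>

lemma injective_division:
  assumes inj: "injective_module R M" and K: "ideal K R" and a: "a \<in> carrier R"
    and reg: "\<And>r. r \<in> carrier R \<Longrightarrow> a \<otimes>\<^bsub>R\<^esub> r \<in> K \<Longrightarrow> r \<in> K"
    and x: "x \<in> carrier M" and Kx: "\<And>k. k \<in> K \<Longrightarrow> k \<odot>\<^bsub>M\<^esub> x = \<zero>\<^bsub>M\<^esub>"
  shows "\<exists>y\<in>carrier M. a \<odot>\<^bsub>M\<^esub> y = x \<and> (\<forall>k\<in>K. k \<odot>\<^bsub>M\<^esub> y = \<zero>\<^bsub>M\<^esub>)"
proof -
  interpret K: ideal K R by fact
  let ?rep = "\<lambda>p r. r \<in> carrier R \<and> (\<exists>k\<in>K. p = k \<oplus>\<^bsub>R\<^esub> a \<otimes>\<^bsub>R\<^esub> r)"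
  define A where "A = K <+>\<^bsub>R\<^esub> PIdl\<^bsub>R\<^esub> a"
  have idA: "ideal A R" unfolding A_def by (intro R.add_ideals K R.cgenideal_ideal a)
  have memA: "p \<in> A \<longleftrightarrow> (\<exists>r. ?rep p r)" for p
    unfolding A_def set_add_def' cgenideal_def using a R.m_comm by (auto; metis)
  define f where "f p = (SOME r. ?rep p r) \<odot>\<^bsub>M\<^esub> x" for p
  have f: "f p = r \<odot>\<^bsub>M\<^esub> x" if r: "?rep p r" for p r
  proof -
    define s where "s = (SOME r. ?rep p r)"
    have "?rep p s" unfolding s_def by (rule someI[of _ r]) (rule r)
    then obtain k where s: "s \<in> carrier R" "k \<in> K" "p = k \<oplus>\<^bsub>R\<^esub> a \<otimes>\<^bsub>R\<^esub> s" by blast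
    obtain k' where k': "r \<in> carrier R" "k' \<in> K" "p = k' \<oplus>\<^bsub>R\<^esub> a \<otimes>\<^bsub>R\<^esub> r" using r by blast
    have kc: "k \<in> carrier R" "k' \<in> carrier R" using s k' K.a_Hcarr by auto
    have eq: "k \<oplus>\<^bsub>R\<^esub> a \<otimes>\<^bsub>R\<^esub> s = k' \<oplus>\<^bsub>R\<^esub> a \<otimes>\<^bsub>R\<^esub> r" using s k' by simp
    have "a \<otimes>\<^bsub>R\<^esub> (s \<ominus>\<^bsub>R\<^esub> r) = (k \<oplus>\<^bsub>R\<^esub> a \<otimes>\<^bsub>R\<^esub> s) \<ominus>\<^bsub>R\<^esub> k \<ominus>\<^bsub>R\<^esub> a \<otimes>\<^bsub>R\<^esub> r"
      using a kc s(1) k'(1) by algebra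
    also have "\<dots> = k' \<ominus>\<^bsub>R\<^esub> k"
      unfolding eq using a kc s(1) k'(1) by algebra
    also have "\<dots> \<in> K" using s k' by (simp add: R.minus_eq)
    finally have "s \<ominus>\<^bsub>R\<^esub> r \<in> K" using reg s k' by simp
    then have 0: "(s \<ominus>\<^bsub>R\<^esub> r) \<odot>\<^bsub>M\<^esub> x = \<zero>\<^bsub>M\<^esub>" by (rule Kx)
    have "s = (s \<ominus>\<^bsub>R\<^esub> r) \<oplus>\<^bsub>R\<^esub> r" using s(1) k'(1) by algebra
    then have "s \<odot>\<^bsub>M\<^esub> x = (s \<ominus>\<^bsub>R\<^esub> r) \<odot>\<^bsub>M\<^esub> x \<oplus>\<^bsub>M\<^esub> r \<odot>\<^bsub>M\<^esub> x"
      using s(1) k'(1) x by (metis R.minus_closed smult_l_distr)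
    then show ?thesis using 0 k'(1) x by (simp add: f_def s_def)
  qed
  have "f \<in> mod_hom R (ring_as_module R\<lparr>carrier := A\<rparr>) M"
    unfolding mod_hom_def hom_def
  proof (simp add: ring_as_module_def, intro conjI ballI Pi_I)
    fix p assume "p \<in> A"
    then obtain r where "?rep p r" using memA by blast
    then show "f p \<in> carrier M" using f x by simp
  next
    fix p q assume "p \<in> A" "q \<in> A"
    then obtain r k s l where r: "r \<in> carrier R" "k \<in> K" "p = k \<oplus>\<^bsub>R\<^esub> a \<otimes>\<^bsub>R\<^esub> r"
      and s: "s \<in> carrier R" "l \<in> K" "q = l \<oplus>\<^bsub>R\<^esub> a \<otimes>\<^bsub>R\<^esub> s" using memA by metis
    have kl: "k \<in> carrier R" "l \<in> carrier R" using r s K.a_Hcarr by auto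
    have "p \<oplus>\<^bsub>R\<^esub> q = (k \<oplus>\<^bsub>R\<^esub> l) \<oplus>\<^bsub>R\<^esub> a \<otimes>\<^bsub>R\<^esub> (r \<oplus>\<^bsub>R\<^esub> s)"
      unfolding r(3) s(3) using a kl r(1) s(1) by algebra
    then have "?rep (p \<oplus>\<^bsub>R\<^esub> q) (r \<oplus>\<^bsub>R\<^esub> s)" using r s by blast
    then have "f (p \<oplus>\<^bsub>R\<^esub> q) = (r \<oplus>\<^bsub>R\<^esub> s) \<odot>\<^bsub>M\<^esub> x" by (rule f)
    moreover have "f p = r \<odot>\<^bsub>M\<^esub> x" by (rule f) (use r in blast)
    moreover have "f q = s \<odot>\<^bsub>M\<^esub> x" by (rule f) (use s in blast)
    ultimately show "f (p \<oplus>\<^bsub>R\<^esub> q) = f p \<oplus>\<^bsub>M\<^esub> f q"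
      using r s x by (simp add: smult_l_distr)
  next
    fix b p assume b: "b \<in> carrier R" "p \<in> A"
    then obtain r k where r: "r \<in> carrier R" "k \<in> K" "p = k \<oplus>\<^bsub>R\<^esub> a \<otimes>\<^bsub>R\<^esub> r" using memA by metis
    have kc: "k \<in> carrier R" using r K.a_Hcarr by auto
    have "b \<otimes>\<^bsub>R\<^esub> p = b \<otimes>\<^bsub>R\<^esub> k \<oplus>\<^bsub>R\<^esub> a \<otimes>\<^bsub>R\<^esub> (b \<otimes>\<^bsub>R\<^esub> r)"
      unfolding r(3) using a b kc r(1) by algebra
    then have "?rep (b \<otimes>\<^bsub>R\<^esub> p) (b \<otimes>\<^bsub>R\<^esub> r)" using r b K.I_l_closed by blast
    then have "f (b \<otimes>\<^bsub>R\<^esub> p) = (b \<otimes>\<^bsub>R\<^esub> r) \<odot>\<^bsub>M\<^esub> x" by (rule f)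
    moreover have "f p = r \<odot>\<^bsub>M\<^esub> x" by (rule f) (use r in blast)
    ultimately show "f (b \<otimes>\<^bsub>R\<^esub> p) = b \<odot>\<^bsub>M\<^esub> f p"
      using r b x by (simp add: smult_assoc1)
  qed
  then obtain h where h: "h \<in> mod_hom R (ring_as_module R) M" and hf: "\<And>p. p \<in> A \<Longrightarrow> h p = f p"
    using inj idA unfolding injective_module_def by blast
  have h1: "h \<one>\<^bsub>R\<^esub> \<in> carrier M"
    using h by (auto simp: mod_hom_def hom_def ring_as_module_def)
  have hs: "r \<odot>\<^bsub>M\<^esub> h \<one>\<^bsub>R\<^esub> = h r" if "r \<in> carrier R" for r
  proof -
    have "\<forall>r\<in>carrier R. \<forall>s\<in>carrier R. h (r \<otimes>\<^bsub>R\<^esub> s) = r \<odot>\<^bsub>M\<^esub> h s"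
      using h by (simp add: mod_hom_def ring_as_module_def)
    from this[rule_format, OF that R.one_closed] show ?thesis using that by simp
  qed
  have "?rep a \<one>\<^bsub>R\<^esub>" using a by (auto intro!: bexI[of _ "\<zero>\<^bsub>R\<^esub>"])
  then have "a \<in> A" "f a = \<one>\<^bsub>R\<^esub> \<odot>\<^bsub>M\<^esub> x" using memA f by (blast, blast)
  then have "a \<odot>\<^bsub>M\<^esub> h \<one>\<^bsub>R\<^esub> = x" using hs[OF a] hf x by simp
  moreover have "k \<odot>\<^bsub>M\<^esub> h \<one>\<^bsub>R\<^esub> = \<zero>\<^bsub>M\<^esub>" if k: "k \<in> K" for k
  proof -
    have kc: "k \<in> carrier R" using k K.a_Hcarr by auto
    have "?rep k \<zero>\<^bsub>R\<^esub>" using k kc a by (auto intro!: bexI[of _ k])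
    then have "k \<in> A" "f k = \<zero>\<^bsub>R\<^esub> \<odot>\<^bsub>M\<^esub> x" using memA f by (blast, blast)
    then show ?thesis using hs[OF kc] hf x by simp
  qed
  ultimately show ?thesis using h1 by blast
qed

lemma annihilator_ideal:
  assumes "x \<in> carrier M"
  shows "ideal {a \<in> carrier R. a \<odot>\<^bsub>M\<^esub> x = \<zero>\<^bsub>M\<^esub>} R"
proof (rule idealI)
  show "ring R" by (rule R.ring_axioms)
  show "subgroup {a \<in> carrier R. a \<odot>\<^bsub>M\<^esub> x = \<zero>\<^bsub>M\<^esub>} (add_monoid R)"
    by (rule subgroup.intro)
      (use assms in \<open>auto simp: smult_l_distr smult_l_minus M.diff_self[OF M.zero_closed, unfolded M.minus_eq, simplified] simp flip: a_inv_def\<close>)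
  fix a b assume a: "a \<in> {a \<in> carrier R. a \<odot>\<^bsub>M\<^esub> x = \<zero>\<^bsub>M\<^esub>}" and b: "b \<in> carrier R"
  show "b \<otimes>\<^bsub>R\<^esub> a \<in> {a \<in> carrier R. a \<odot>\<^bsub>M\<^esub> x = \<zero>\<^bsub>M\<^esub>}"
    using a b assms by (simp add: smult_assoc1)
  then show "a \<otimes>\<^bsub>R\<^esub> b \<in> {a \<in> carrier R. a \<odot>\<^bsub>M\<^esub> x = \<zero>\<^bsub>M\<^esub>}"
    using a b by (simp add: R.m_comm)
qed

end

text \<open>A regular sequence, read from the end of the list; the last quotient may be zero.\<close>

primrec regular_list :: "('a, 'm) ring_scheme \<Rightarrow> ('w \<Rightarrow> 'a) \<Rightarrow> 'w list \<Rightarrow> bool" where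
  "regular_list R g [] \<longleftrightarrow> True"
| "regular_list R g (v # vs) \<longleftrightarrow> regular_list R g vs \<and>
     (\<forall>r\<in>carrier R. g v \<otimes>\<^bsub>R\<^esub> r \<in> Idl\<^bsub>R\<^esub> (g ` set vs) \<longrightarrow> r \<in> Idl\<^bsub>R\<^esub> (g ` set vs))"

context module
begin

text \<open>The Koszul complex on a regular sequence resolves the quotient of \<open>R\<close> by it, and an injective module keeps
it exact.  Induction along the cone needs the injectivity only in the lowest degree.\<close>

lemma mkoszul_exact:
  assumes inj: "injective_module R M" and g: "g ` set vs \<subseteq> carrier R" and "distinct vs"
    and "regular_list R g vs"
    and z: "\<And>F. z F \<in> carrier M"
    and cocycle: "\<forall>F\<subseteq>set vs. card F = Suc (Suc p) \<longrightarrow> mkoszul M g vs z F = \<zero>\<^bsub>M\<^esub>"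
  shows "\<exists>w. (\<forall>F. w F \<in> carrier M) \<and> (\<forall>F\<subseteq>set vs. card F = Suc p \<longrightarrow> z F = mkoszul M g vs w F)"
  using g assms(3,4) z cocycle
proof (induction vs arbitrary: p z)
  case Nil
  then show ?case by (intro exI[of _ z]) auto
next
  case (Cons v vs)
  have gv: "g v \<in> carrier R" and g: "g ` set vs \<subseteq> carrier R" using Cons.prems(1) by auto
  have v: "v \<notin> set vs" and dist: "distinct vs" using Cons.prems(2) by auto
  have reg: "regular_list R g vs"
    and regv: "\<And>r. r \<in> carrier R \<Longrightarrow> g v \<otimes>\<^bsub>R\<^esub> r \<in> Idl\<^bsub>R\<^esub> (g ` set vs) \<Longrightarrow> r \<in> Idl\<^bsub>R\<^esub> (g ` set vs)"
    using Cons.prems(3) by auto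
  note z = Cons.prems(4)
  note IH = Cons.IH[OF g dist reg]
  define z1 where "z1 G = z (insert v G)" for G
  have z1: "z1 G \<in> carrier M" for G by (simp add: z1_def z)
  have kz1: "mkoszul M g vs z1 F \<in> carrier M" for F by (rule mkoszul_closed[OF g]) (rule z1)
  have fin: "finite F" if "F \<subseteq> set vs" for F using that by (rule finite_subset) simp
  have notin: "v \<notin> F" if "F \<subseteq> set vs" for F using that v by auto
  have k1: "mkoszul M g (v # vs) y (insert v F) =
      g v \<odot>\<^bsub>M\<^esub> y F \<ominus>\<^bsub>M\<^esub> mkoszul M g vs (\<lambda>G. y (insert v G)) F" if "F \<subseteq> set vs" for y F
  proof -
    have "insert v F - {v} = F" using notin[OF that] by auto
    then show ?thesis by simp
  qed
  have c0: "\<forall>F\<subseteq>set vs. card F = Suc (Suc p) \<longrightarrow> mkoszul M g vs z F = \<zero>\<^bsub>M\<^esub>"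
  proof (intro allI impI)
    fix F assume F: "F \<subseteq> set vs" "card F = Suc (Suc p)"
    then have "mkoszul M g (v # vs) z F = \<zero>\<^bsub>M\<^esub>" using Cons.prems(5) by auto
    then show "mkoszul M g vs z F = \<zero>\<^bsub>M\<^esub>" using notin[OF F(1)] by simp
  qed
  have c1: "g v \<odot>\<^bsub>M\<^esub> z F = mkoszul M g vs z1 F" if F: "F \<subseteq> set vs" "card F = Suc p" for F
  proof -
    have "insert v F \<subseteq> set (v # vs)" "card (insert v F) = Suc (Suc p)"
      using F fin notin by auto
    then have "mkoszul M g (v # vs) z (insert v F) = \<zero>\<^bsub>M\<^esub>" using Cons.prems(5) by blast
    then have "g v \<odot>\<^bsub>M\<^esub> z F \<ominus>\<^bsub>M\<^esub> mkoszul M g vs z1 F = \<zero>\<^bsub>M\<^esub>"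
      unfolding k1[OF F(1)] z1_def .
    from M.diff_eq_zero[OF _ _ this] show ?thesis using gv z kz1 by blast
  qed
  obtain w0 where w0: "\<And>F. w0 F \<in> carrier M"
    and zw: "\<And>F. F \<subseteq> set vs \<Longrightarrow> card F = Suc p \<Longrightarrow> z F = mkoszul M g vs w0 F"
    using IH[of z, OF z c0] by blast
  define y where "y G = g v \<odot>\<^bsub>M\<^esub> w0 G \<ominus>\<^bsub>M\<^esub> z1 G" for G
  have y: "y G \<in> carrier M" for G using gv w0 z1 by (simp add: y_def)
  have ky: "mkoszul M g vs y F = \<zero>\<^bsub>M\<^esub>" if F: "F \<subseteq> set vs" "card F = Suc p" for F
  proof -
    have "mkoszul M g vs y F = g v \<odot>\<^bsub>M\<^esub> mkoszul M g vs w0 F \<ominus>\<^bsub>M\<^esub> mkoszul M g vs z1 F"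
      unfolding y_def using gv w0 z1 by (simp add: mkoszul_diff[OF g] mkoszul_scale[OF gv g])
    then show ?thesis
      using zw[OF F] c1[OF F] kz1 by (simp add: M.diff_self)
  qed
  \<comment> \<open>A bound of \<open>z\<close> is a pair with \<open>z = d w0\<close> and \<open>z1 = g v w0 - d w1\<close>, and the latter says
    \<open>y = d w1\<close>.  For \<open>p = 0\<close> this forces \<open>y = 0\<close>, so there \<open>w0\<close> has to be changed first.\<close>
  have "\<exists>w0 w1. (\<forall>F. w0 F \<in> carrier M) \<and> (\<forall>F. w1 F \<in> carrier M) \<and>
      (\<forall>F\<subseteq>set vs. card F = Suc p \<longrightarrow> z F = mkoszul M g vs w0 F) \<and>
      (\<forall>F\<subseteq>set vs. card F = p \<longrightarrow> z1 F = g v \<odot>\<^bsub>M\<^esub> w0 F \<ominus>\<^bsub>M\<^esub> mkoszul M g vs w1 F)"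
  proof (cases p)
    case (Suc q)
    have "\<forall>F\<subseteq>set vs. card F = Suc (Suc q) \<longrightarrow> mkoszul M g vs y F = \<zero>\<^bsub>M\<^esub>"
      using ky Suc by simp
    then obtain w1 where w1: "\<And>F. w1 F \<in> carrier M"
      and yw: "\<And>F. F \<subseteq> set vs \<Longrightarrow> card F = Suc q \<Longrightarrow> y F = mkoszul M g vs w1 F"
      using IH[of y q] y by blast
    have "z1 F = g v \<odot>\<^bsub>M\<^esub> w0 F \<ominus>\<^bsub>M\<^esub> mkoszul M g vs w1 F" if "F \<subseteq> set vs" "card F = p" for F
    proof -
      have "z1 F = g v \<odot>\<^bsub>M\<^esub> w0 F \<ominus>\<^bsub>M\<^esub> y F"
        unfolding y_def using gv w0[of F] z1[of F]
        by (simp add: M.diff_diff)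
      then show ?thesis using yw[of F] that Suc by simp
    qed
    then show ?thesis using w0 w1 zw by blast
  next
    case 0
    \<comment> \<open>The value \<open>y {}\<close> is killed by the ideal of \<open>vs\<close>.  Dividing it by \<open>g v\<close> within the elements
      killed by that ideal gives the correction of \<open>w0\<close>.\<close>
    have gy: "g u \<odot>\<^bsub>M\<^esub> y {} = \<zero>\<^bsub>M\<^esub>" if u: "u \<in> set vs" for u
      using ky[of "{u}"] mkoszul_singleton[OF g _ u dist, of y] y u 0 by simp
    have idl: "ideal (Idl\<^bsub>R\<^esub> (g ` set vs)) R" using g by (rule R.genideal_ideal)
    have "Idl\<^bsub>R\<^esub> (g ` set vs) \<subseteq> {a \<in> carrier R. a \<odot>\<^bsub>M\<^esub> y {} = \<zero>\<^bsub>M\<^esub>}"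
      using g gy by (intro R.genideal_minimal annihilator_ideal y) auto
    then have "k \<odot>\<^bsub>M\<^esub> y {} = \<zero>\<^bsub>M\<^esub>" if "k \<in> Idl\<^bsub>R\<^esub> (g ` set vs)" for k using that by blast
    from injective_division[OF inj idl gv regv y this]
    obtain e where e: "e \<in> carrier M" "g v \<odot>\<^bsub>M\<^esub> e = y {}"
      "\<And>k. k \<in> Idl\<^bsub>R\<^esub> (g ` set vs) \<Longrightarrow> k \<odot>\<^bsub>M\<^esub> e = \<zero>\<^bsub>M\<^esub>"
      by blast
    define w where "w F = w0 F \<ominus>\<^bsub>M\<^esub> e" for F
    have w: "w F \<in> carrier M" for F using w0 e by (simp add: w_def)
    have zw': "z F = mkoszul M g vs w F" if F: "F \<subseteq> set vs" "card F = Suc p" for F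
    proof -
      obtain u where u: "F = {u}" using F(2) 0 by (auto simp: card_1_singleton_iff)
      have uv: "u \<in> set vs" using F u by auto
      have "g u \<in> Idl\<^bsub>R\<^esub> (g ` set vs)" using R.genideal_self[OF g] uv by blast
      then have "mkoszul M g vs (\<lambda>_. e) F = \<zero>\<^bsub>M\<^esub>"
        using mkoszul_singleton[OF g _ uv dist, of "\<lambda>_. e"] e u by simp
      then show ?thesis unfolding w_def
        using e(1) w0 zw[OF F] by (simp add: mkoszul_diff[OF g] mkoszul_closed[OF g] M.diff_zero)
    qed
    have z1w': "z1 F = g v \<odot>\<^bsub>M\<^esub> w F \<ominus>\<^bsub>M\<^esub> mkoszul M g vs (\<lambda>_. \<zero>\<^bsub>M\<^esub>) F"
      if F: "F \<subseteq> set vs" "card F = p" for F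
    proof -
      have F: "F = {}" using F 0 fin by auto
      have "mkoszul M g us h {} = \<zero>\<^bsub>M\<^esub>" for us and h :: "_ set \<Rightarrow> _"
        by (induction us arbitrary: h) auto
      moreover have "g v \<odot>\<^bsub>M\<^esub> w F = g v \<odot>\<^bsub>M\<^esub> w0 F \<ominus>\<^bsub>M\<^esub> y F"
        unfolding w_def F using e gv w0 by (simp add: smult_r_diff)
      moreover have "z1 F = g v \<odot>\<^bsub>M\<^esub> w0 F \<ominus>\<^bsub>M\<^esub> y F"
        unfolding y_def using gv w0[of F] z1[of F]
        by (simp add: M.diff_diff)
      ultimately show ?thesis using F z1[of F] by (simp add: M.diff_zero)
    qed
    show ?thesis
      by (rule exI[of _ w], rule exI[of _ "\<lambda>_. \<zero>\<^bsub>M\<^esub>"], intro conjI allI impI)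
        (rule w M.zero_closed zw' z1w'; assumption?)+
  qed
  then obtain w0 w1 where w0: "\<And>F. w0 F \<in> carrier M" and w1: "\<And>F. w1 F \<in> carrier M"
    and zw: "\<And>F. F \<subseteq> set vs \<Longrightarrow> card F = Suc p \<Longrightarrow> z F = mkoszul M g vs w0 F"
    and z1w: "\<And>F. F \<subseteq> set vs \<Longrightarrow> card F = p \<Longrightarrow> z1 F = g v \<odot>\<^bsub>M\<^esub> w0 F \<ominus>\<^bsub>M\<^esub> mkoszul M g vs w1 F"
    by blast
  define w where "w F = (if v \<in> F then w1 (F - {v}) else w0 F)" for F
  have kw0: "mkoszul M g vs w F = mkoszul M g vs w0 F"
    and kw1: "mkoszul M g vs (\<lambda>G. w (insert v G)) F = mkoszul M g vs w1 F" if F: "F \<subseteq> set vs" for F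
  proof -
    have "w (F - {u}) = w0 (F - {u})" "w (insert v (F - {u})) = w1 (F - {u})" for u
    proof -
      have "insert v (F - {u}) - {v} = F - {u}" using notin[OF F] by auto
      then show "w (F - {u}) = w0 (F - {u})" "w (insert v (F - {u})) = w1 (F - {u})"
        using notin[OF F] by (auto simp: w_def)
    qed
    then show "mkoszul M g vs w F = mkoszul M g vs w0 F"
        "mkoszul M g vs (\<lambda>G. w (insert v G)) F = mkoszul M g vs w1 F"
      by (auto intro!: mkoszul_cong)
  qed
  show ?case
  proof (rule exI[of _ w], intro conjI allI impI)
    show "w F \<in> carrier M" for F using w0 w1 by (simp add: w_def)
    fix F assume F: "F \<subseteq> set (v # vs)" "card F = Suc p"
    show "z F = mkoszul M g (v # vs) w F"
    proof (cases "v \<in> F")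
      case True
      define G where "G = F - {v}"
      have FG: "F = insert v G" using True by (auto simp: G_def)
      have G: "G \<subseteq> set vs" "card G = p" using F True by (auto simp: G_def)
      have "w G = w0 G" using notin[OF G(1)] by (simp add: w_def)
      then show ?thesis using z1w[OF G] unfolding FG k1[OF G(1)] kw1[OF G(1)] z1_def by simp
    next
      case False
      then have G: "F \<subseteq> set vs" using F by auto
      then show ?thesis using False zw[OF G F(2)] kw0[OF G] by simp
    qed
  qed
qed

end

section \<open>From Koszul cohomology to injective resolutions\<close>

text \<open>The last assumption is the vanishing of the Koszul cohomology of the resolved module below \<open>d\<close>, with
this module replaced by its image in \<open>J 0\<close>, the kernel of \<open>\<delta> 0\<close>.\<close>

locale koszul_resolution =
  fixes R :: "('a, 'm) ring_scheme" and J :: "nat \<Rightarrow> ('a, 'c) module" and \<delta> :: "nat \<Rightarrow> 'c \<Rightarrow> 'c"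
    and g :: "'w \<Rightarrow> 'a" and vs :: "'w list" and d :: int
  assumes inj: "\<And>i. injective_module R (J i)"
    and hom: "\<And>i. \<delta> i \<in> mod_hom R (J i) (J (Suc i))"
    and exact: "\<And>i. \<delta> i ` carrier (J i) = mod_ker (J (Suc i)) (J (Suc (Suc i))) (\<delta> (Suc i))"
    and g: "g ` set vs \<subseteq> carrier R" and dist: "distinct vs" and reg: "regular_list R g vs"
    and vanish: "\<And>p z. int p < d \<Longrightarrow> (\<And>F. z F \<in> carrier (J 0)) \<Longrightarrow>
      \<forall>F\<subseteq>set vs. card F = p \<longrightarrow> \<delta> 0 (z F) = \<zero>\<^bsub>J 1\<^esub> \<Longrightarrow>
      \<forall>F\<subseteq>set vs. card F = Suc p \<longrightarrow> mkoszul (J 0) g vs z F = \<zero>\<^bsub>J 0\<^esub> \<Longrightarrow>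
      \<exists>w. (\<forall>F. w F \<in> carrier (J 0) \<and> \<delta> 0 (w F) = \<zero>\<^bsub>J 1\<^esub>) \<and>
          (\<forall>F\<subseteq>set vs. card F = p \<longrightarrow> z F = mkoszul (J 0) g vs w F)"
begin

lemma mods: "module R (J i)" using inj by (simp add: injective_module_def)

sublocale J: module R "J i" for i by (rule mods)

lemmas \<delta>_hom = mod_homD[OF mods mods hom]

lemma \<delta>_\<delta>: "x \<in> carrier (J i) \<Longrightarrow> \<delta> (Suc i) (\<delta> i x) = \<zero>\<^bsub>J (Suc (Suc i))\<^esub>"
  using exact[of i] by (auto simp: mod_ker_def)

lemma \<delta>_lift: "x \<in> carrier (J (Suc i)) \<Longrightarrow> \<delta> (Suc i) x = \<zero>\<^bsub>J (Suc (Suc i))\<^esub> \<Longrightarrow> \<exists>y\<in>carrier (J i). \<delta> i y = x"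
proof -
  assume "x \<in> carrier (J (Suc i))" "\<delta> (Suc i) x = \<zero>\<^bsub>J (Suc (Suc i))\<^esub>"
  then have "x \<in> \<delta> i ` carrier (J i)" unfolding exact mod_ker_def by simp
  then show ?thesis by blast
qed

lemma mkoszul_\<delta>:
  "(\<And>F. z F \<in> carrier (J i)) \<Longrightarrow> mkoszul (J (Suc i)) g vs (\<lambda>G. \<delta> i (z G)) F = \<delta> i (mkoszul (J i) g vs z F)"
  using mkoszul_hom[OF mods mods hom g] by blast

lemma cochain_lift:
  assumes z: "\<And>F. z F \<in> carrier (J (Suc i))"
    and 0: "\<forall>F\<subseteq>set vs. card F = p \<longrightarrow> \<delta> (Suc i) (z F) = \<zero>\<^bsub>J (Suc (Suc i))\<^esub>"
  obtains u where "\<And>F. u F \<in> carrier (J i)" "\<And>F. F \<subseteq> set vs \<Longrightarrow> card F = p \<Longrightarrow> \<delta> i (u F) = z F"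
proof -
  have "\<forall>F. \<exists>y. y \<in> carrier (J i) \<and> (F \<subseteq> set vs \<longrightarrow> card F = p \<longrightarrow> \<delta> i y = z F)"
  proof
    fix F show "\<exists>y. y \<in> carrier (J i) \<and> (F \<subseteq> set vs \<longrightarrow> card F = p \<longrightarrow> \<delta> i y = z F)"
    proof (cases "F \<subseteq> set vs \<and> card F = p")
      case True
      then show ?thesis using \<delta>_lift[OF z] 0 by blast
    next
      case False
      then show ?thesis using J.M.zero_closed[of i] by blast
    qed
  qed
  then obtain u where "\<forall>F. u F \<in> carrier (J i) \<and> (F \<subseteq> set vs \<longrightarrow> card F = p \<longrightarrow> \<delta> i (u F) = z F)"
    by (rule choice[THEN exE])
  then show thesis using that by blast
qed

lemma card_remove_vertex: "F \<subseteq> set vs \<Longrightarrow> card F = Suc p \<Longrightarrow> u \<in> F \<Longrightarrow> F - {u} \<subseteq> set vs \<and> card (F - {u}) = p"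
  by auto

text \<open>The chase in the double complex of Koszul degree \<open>p\<close> and resolution degree \<open>q + 1\<close>.  A cocycle \<open>z\<close> for
both differentials is \<open>\<delta> u\<close>, and the Koszul boundary of \<open>u\<close> is again a cocycle for both, one step down
the diagonal.  There it lifts, the lift is a Koszul boundary by exactness of the rows, and subtracting its
image from \<open>u\<close> makes \<open>u\<close> a Koszul cocycle.  At the bottom of the diagonal the assumed vanishing takes the
place of the induction hypothesis.\<close>

lemma total_cocycle_lift:
  assumes "int (p + Suc q) < d" "\<And>F. z F \<in> carrier (J (Suc q))"
    and "\<forall>F\<subseteq>set vs. card F = Suc p \<longrightarrow> mkoszul (J (Suc q)) g vs z F = \<zero>\<^bsub>J (Suc q)\<^esub>"
    and "\<forall>F\<subseteq>set vs. card F = p \<longrightarrow> \<delta> (Suc q) (z F) = \<zero>\<^bsub>J (Suc (Suc q))\<^esub>"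
  shows "\<exists>u. (\<forall>F. u F \<in> carrier (J q)) \<and>
     (\<forall>F\<subseteq>set vs. card F = Suc p \<longrightarrow> mkoszul (J q) g vs u F = \<zero>\<^bsub>J q\<^esub>) \<and>
     (\<forall>F\<subseteq>set vs. card F = p \<longrightarrow> \<delta> q (u F) = z F)"
  using assms
proof (induction q arbitrary: p z)
  case 0
  obtain u where u: "\<And>F. u F \<in> carrier (J 0)"
    and \<delta>u: "\<And>F. F \<subseteq> set vs \<Longrightarrow> card F = p \<Longrightarrow> \<delta> 0 (u F) = z F"
    by (rule cochain_lift[of z 0 p]) (use "0.prems" in auto)
  let ?v = "mkoszul (J 0) g vs u"
  have v: "?v F \<in> carrier (J 0)" for F by (intro J.mkoszul_closed[OF g] u)
  have "\<forall>F\<subseteq>set vs. card F = Suc p \<longrightarrow> \<delta> 0 (?v F) = \<zero>\<^bsub>J 1\<^esub>"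
  proof (intro allI impI)
    fix F assume F: "F \<subseteq> set vs" "card F = Suc p"
    have "\<delta> 0 (?v F) = mkoszul (J (Suc 0)) g vs (\<lambda>G. \<delta> 0 (u G)) F" by (intro mkoszul_\<delta>[symmetric] u)
    also have "\<dots> = mkoszul (J (Suc 0)) g vs z F"
      by (rule mkoszul_cong) (use \<delta>u card_remove_vertex[OF F] in auto)
    finally show "\<delta> 0 (?v F) = \<zero>\<^bsub>J 1\<^esub>" using "0.prems"(3) F by simp
  qed
  moreover have "\<forall>F\<subseteq>set vs. card F = Suc (Suc p) \<longrightarrow> mkoszul (J 0) g vs ?v F = \<zero>\<^bsub>J 0\<^esub>"
    by (intro allI impI J.mkoszul_mkoszul[OF g] u)
  ultimately obtain w where w: "\<forall>F. w F \<in> carrier (J 0) \<and> \<delta> 0 (w F) = \<zero>\<^bsub>J 1\<^esub>"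
    and vw: "\<forall>F\<subseteq>set vs. card F = Suc p \<longrightarrow> ?v F = mkoszul (J 0) g vs w F"
    using vanish[of "Suc p" ?v] v "0.prems"(1) by auto
  have wc: "w F \<in> carrier (J 0)" and \<delta>w: "\<delta> 0 (w F) = \<zero>\<^bsub>J (Suc 0)\<^esub>" for F using w by auto
  show ?case
  proof (rule exI[of _ "\<lambda>F. u F \<ominus>\<^bsub>J 0\<^esub> w F"], intro conjI allI impI)
    show "u F \<ominus>\<^bsub>J 0\<^esub> w F \<in> carrier (J 0)" for F using u wc by simp
  next
    fix F assume F: "F \<subseteq> set vs" "card F = Suc p"
    have "mkoszul (J 0) g vs (\<lambda>F. u F \<ominus>\<^bsub>J 0\<^esub> w F) F = ?v F \<ominus>\<^bsub>J 0\<^esub> mkoszul (J 0) g vs w F"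
      by (intro J.mkoszul_diff[OF g] u wc)
    also have "mkoszul (J 0) g vs w F = ?v F" using vw F by simp
    finally show "mkoszul (J 0) g vs (\<lambda>F. u F \<ominus>\<^bsub>J 0\<^esub> w F) F = \<zero>\<^bsub>J 0\<^esub>"
      using v by (simp add: J.M.diff_self)
  next
    fix F assume F: "F \<subseteq> set vs" "card F = p"
    have "\<delta> 0 (u F \<ominus>\<^bsub>J 0\<^esub> w F) = z F \<ominus>\<^bsub>J (Suc 0)\<^esub> \<zero>\<^bsub>J (Suc 0)\<^esub>"
      using \<delta>_hom(5)[OF u wc] \<delta>u[OF F] \<delta>w by simp
    then show "\<delta> 0 (u F \<ominus>\<^bsub>J 0\<^esub> w F) = z F" using "0.prems"(2) by (simp add: J.M.diff_zero)
  qed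
next
  case (Suc q)
  obtain u where u: "\<And>F. u F \<in> carrier (J (Suc q))"
    and \<delta>u: "\<And>F. F \<subseteq> set vs \<Longrightarrow> card F = p \<Longrightarrow> \<delta> (Suc q) (u F) = z F"
    by (rule cochain_lift[of z "Suc q" p]) (use Suc.prems in auto)
  let ?v = "mkoszul (J (Suc q)) g vs u"
  have v: "?v F \<in> carrier (J (Suc q))" for F by (intro J.mkoszul_closed[OF g] u)
  have \<delta>v: "\<forall>F\<subseteq>set vs. card F = Suc p \<longrightarrow> \<delta> (Suc q) (?v F) = \<zero>\<^bsub>J (Suc (Suc q))\<^esub>"
  proof (intro allI impI)
    fix F assume F: "F \<subseteq> set vs" "card F = Suc p"
    have "\<delta> (Suc q) (?v F) = mkoszul (J (Suc (Suc q))) g vs (\<lambda>G. \<delta> (Suc q) (u G)) F"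
      by (intro mkoszul_\<delta>[symmetric] u)
    also have "\<dots> = mkoszul (J (Suc (Suc q))) g vs z F"
      by (rule mkoszul_cong) (use \<delta>u card_remove_vertex[OF F] in auto)
    finally show "\<delta> (Suc q) (?v F) = \<zero>\<^bsub>J (Suc (Suc q))\<^esub>" using Suc.prems(3) F by simp
  qed
  have dv: "\<forall>F\<subseteq>set vs. card F = Suc (Suc p) \<longrightarrow> mkoszul (J (Suc q)) g vs ?v F = \<zero>\<^bsub>J (Suc q)\<^esub>"
    by (intro allI impI J.mkoszul_mkoszul[OF g] u)
  have "int (Suc p + Suc q) < d" using Suc.prems(1) by simp
  from Suc.IH[where z = ?v, OF this v dv \<delta>v]
  obtain x where x: "\<And>F. x F \<in> carrier (J q)"
    and dx: "\<forall>F\<subseteq>set vs. card F = Suc (Suc p) \<longrightarrow> mkoszul (J q) g vs x F = \<zero>\<^bsub>J q\<^esub>"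
    and \<delta>x: "\<forall>F\<subseteq>set vs. card F = Suc p \<longrightarrow> \<delta> q (x F) = ?v F" by blast
  from J.mkoszul_exact[where z = x, OF inj g dist reg x dx]
  obtain w where w: "\<And>F. w F \<in> carrier (J q)"
    and xw: "\<forall>F\<subseteq>set vs. card F = Suc p \<longrightarrow> x F = mkoszul (J q) g vs w F" by blast
  have \<delta>w: "\<delta> q (w F) \<in> carrier (J (Suc q))" for F by (rule \<delta>_hom(1)[OF w])
  show ?case
  proof (rule exI[of _ "\<lambda>F. u F \<ominus>\<^bsub>J (Suc q)\<^esub> \<delta> q (w F)"], intro conjI allI impI)
    show "u F \<ominus>\<^bsub>J (Suc q)\<^esub> \<delta> q (w F) \<in> carrier (J (Suc q))" for F using u \<delta>w by simp
  next
    fix F assume F: "F \<subseteq> set vs" "card F = Suc p"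
    have "mkoszul (J (Suc q)) g vs (\<lambda>F. u F \<ominus>\<^bsub>J (Suc q)\<^esub> \<delta> q (w F)) F =
        ?v F \<ominus>\<^bsub>J (Suc q)\<^esub> mkoszul (J (Suc q)) g vs (\<lambda>F. \<delta> q (w F)) F"
      by (intro J.mkoszul_diff[OF g] u \<delta>w)
    also have "mkoszul (J (Suc q)) g vs (\<lambda>F. \<delta> q (w F)) F = ?v F"
      using mkoszul_\<delta>[where z = w, OF w] xw \<delta>x F by simp
    finally show "mkoszul (J (Suc q)) g vs (\<lambda>F. u F \<ominus>\<^bsub>J (Suc q)\<^esub> \<delta> q (w F)) F = \<zero>\<^bsub>J (Suc q)\<^esub>"
      using v by (simp add: J.M.diff_self)
  next
    fix F assume F: "F \<subseteq> set vs" "card F = p"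
    have "\<delta> (Suc q) (u F \<ominus>\<^bsub>J (Suc q)\<^esub> \<delta> q (w F)) = z F \<ominus>\<^bsub>J (Suc (Suc q))\<^esub> \<zero>\<^bsub>J (Suc (Suc q))\<^esub>"
      using \<delta>_hom(5)[OF u \<delta>w] \<delta>u[OF F] \<delta>_\<delta>[OF w] by simp
    then show "\<delta> (Suc q) (u F \<ominus>\<^bsub>J (Suc q)\<^esub> \<delta> q (w F)) = z F" using Suc.prems(2) by (simp add: J.M.diff_zero)
  qed
qed

lemma cochain_vertex:
  "z \<in> carrier (J i) \<Longrightarrow> v \<in> set vs \<Longrightarrow> mkoszul (J i) g vs (\<lambda>_. z) {v} = g v \<odot>\<^bsub>J i\<^esub> z"
  using J.mkoszul_singleton[OF g _ _ dist, of "\<lambda>_. z"] by blast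

lemma killed_cocycle_zero:
  assumes "0 < d" and z: "z \<in> carrier (J 0)" "\<delta> 0 z = \<zero>\<^bsub>J 1\<^esub>"
    and gz: "\<And>v. v \<in> set vs \<Longrightarrow> g v \<odot>\<^bsub>J 0\<^esub> z = \<zero>\<^bsub>J 0\<^esub>"
  shows "z = \<zero>\<^bsub>J 0\<^esub>"
proof -
  have "mkoszul (J 0) g vs (\<lambda>_. z) F = \<zero>\<^bsub>J 0\<^esub>" if "F \<subseteq> set vs" "card F = Suc 0" for F
    using that cochain_vertex[OF z(1)] gz by (auto simp: card_1_singleton_iff)
  then obtain w where "\<forall>F\<subseteq>set vs. card F = 0 \<longrightarrow> z = mkoszul (J 0) g vs w F"
    using vanish[of 0 "\<lambda>_. z"] assms by auto
  then have "z = mkoszul (J 0) g vs w {}" by auto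
  moreover have "mkoszul (J 0) g us w {} = \<zero>\<^bsub>J 0\<^esub>" for us :: "'w list" and w
    by (induction us arbitrary: w) auto
  ultimately show ?thesis by simp
qed

text \<open>The cochains of degree zero are the elements of the modules, and their Koszul cocycles are the elements
killed by the sequence.\<close>

lemma killed_cocycle_lift:
  assumes "int (Suc q) < d" and z: "z \<in> carrier (J (Suc q))" "\<delta> (Suc q) z = \<zero>\<^bsub>J (Suc (Suc q))\<^esub>"
    and gz: "\<And>v. v \<in> set vs \<Longrightarrow> g v \<odot>\<^bsub>J (Suc q)\<^esub> z = \<zero>\<^bsub>J (Suc q)\<^esub>"
  shows "\<exists>y\<in>carrier (J q). \<delta> q y = z \<and> (\<forall>v\<in>set vs. g v \<odot>\<^bsub>J q\<^esub> y = \<zero>\<^bsub>J q\<^esub>)"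
proof -
  have dz: "\<forall>F\<subseteq>set vs. card F = Suc 0 \<longrightarrow> mkoszul (J (Suc q)) g vs (\<lambda>_. z) F = \<zero>\<^bsub>J (Suc q)\<^esub>"
    using cochain_vertex[OF z(1)] gz by (auto simp: card_1_singleton_iff)
  obtain u where u: "\<And>F. u F \<in> carrier (J q)"
    and du: "\<forall>F\<subseteq>set vs. card F = Suc 0 \<longrightarrow> mkoszul (J q) g vs u F = \<zero>\<^bsub>J q\<^esub>"
    and \<delta>u: "\<forall>F\<subseteq>set vs. card F = 0 \<longrightarrow> \<delta> q (u F) = z"
    using total_cocycle_lift[of 0 q "\<lambda>_. z", OF _ z(1) dz] assms by auto
  have "g v \<odot>\<^bsub>J q\<^esub> u {} = \<zero>\<^bsub>J q\<^esub>" if "v \<in> set vs" for v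
    using J.mkoszul_singleton[where z = u, OF g u that dist] du that by simp
  moreover have "\<delta> q (u {}) = z" using \<delta>u by simp
  ultimately show ?thesis using u by blast
qed

end

section \<open>Ideals of the polynomial ring\<close>

lemma in_carrier_mpoly_ring:
  "p \<in> carrier (mpoly_ring X) \<longleftrightarrow> (\<forall>m\<in>keys p. keys m \<subseteq> X)"
  by (simp add: mpoly_ring_def)

lemma mpoly_ring_simps [simp]:
  "monoid.mult (mpoly_ring X) = (*)" "one (mpoly_ring X) = 1" "zero (mpoly_ring X) = 0" "add (mpoly_ring X) = (+)"
  by (simp_all add: mpoly_ring_def)

lemma mpoly_ring_minus:
  fixes p q :: "('w \<Rightarrow>\<^sub>0 nat) \<Rightarrow>\<^sub>0 'k::field"
  assumes "p \<in> carrier (mpoly_ring X)" "q \<in> carrier (mpoly_ring X)"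
  shows "p \<ominus>\<^bsub>mpoly_ring X\<^esub> q = p - q"
proof -
  interpret R: cring "mpoly_ring X :: (('w \<Rightarrow>\<^sub>0 nat) \<Rightarrow>\<^sub>0 'k) ring" by (rule mpoly_ring_cring)
  have "\<ominus>\<^bsub>mpoly_ring X\<^esub> q = - q"
    by (rule R.minus_equality) (use assms in \<open>auto simp: in_carrier_mpoly_ring\<close>)
  then show ?thesis by (simp add: R.minus_eq)
qed

lemma keys_nat_add: "keys (m + n) = keys m \<union> keys (n :: 'w \<Rightarrow>\<^sub>0 nat)"
  by (auto simp: in_keys_iff lookup_add)

definition upclosure :: "('w \<Rightarrow>\<^sub>0 nat) set \<Rightarrow> ('w \<Rightarrow>\<^sub>0 nat) set" where
  "upclosure B = {b + n | b n. b \<in> B}"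

lemma upset_upclosure: "upset (upclosure B)"
proof -
  have "n + (b + k) \<in> upclosure B" if "b \<in> B" for n b k
  proof -
    have "n + (b + k) = b + (n + k)" by (simp add: ac_simps)
    then show ?thesis using that unfolding upclosure_def by blast
  qed
  then show ?thesis by (auto simp: upset_def upclosure_def)
qed

lemma ideal_monomial_ideal:
  fixes M :: "('w \<Rightarrow>\<^sub>0 nat) set"
  assumes "upset M"
  shows "ideal (monomial_ideal M \<inter> carrier (mpoly_ring X)) (mpoly_ring X :: (('w \<Rightarrow>\<^sub>0 nat) \<Rightarrow>\<^sub>0 'k::field) ring)"
proof -
  interpret R: cring "mpoly_ring X :: (('w \<Rightarrow>\<^sub>0 nat) \<Rightarrow>\<^sub>0 'k) ring" by (rule mpoly_ring_cring)
  note id = ring_ideal_monomial_ideal[OF assms, where ?'b = 'k]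
  have neg: "\<ominus>\<^bsub>mpoly_ring X\<^esub> a = - a" if "a \<in> carrier (mpoly_ring X)" for a :: "('w \<Rightarrow>\<^sub>0 nat) \<Rightarrow>\<^sub>0 'k"
    using mpoly_ring_minus[OF R.zero_closed that] that by (simp add: R.minus_eq)
  show ?thesis
  proof (rule idealI)
    show "ring (mpoly_ring X :: (('w \<Rightarrow>\<^sub>0 nat) \<Rightarrow>\<^sub>0 'k) ring)" by (rule R.ring_axioms)
    show "subgroup (monomial_ideal M \<inter> carrier (mpoly_ring X))
        (add_monoid (mpoly_ring X :: (('w \<Rightarrow>\<^sub>0 nat) \<Rightarrow>\<^sub>0 'k) ring))"
    proof (rule subgroup.intro)
      show "monomial_ideal M \<inter> carrier (mpoly_ring X) \<subseteq>
          carrier (add_monoid (mpoly_ring X :: (('w \<Rightarrow>\<^sub>0 nat) \<Rightarrow>\<^sub>0 'k) ring))" by simp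
    next
      fix a b :: "('w \<Rightarrow>\<^sub>0 nat) \<Rightarrow>\<^sub>0 'k"
      assume ab: "a \<in> monomial_ideal M \<inter> carrier (mpoly_ring X)" "b \<in> monomial_ideal M \<inter> carrier (mpoly_ring X)"
      then show "a \<otimes>\<^bsub>add_monoid (mpoly_ring X)\<^esub> b \<in> monomial_ideal M \<inter> carrier (mpoly_ring X)"
        using ring_ideal_add[OF id, of a b] R.a_closed[of a b] by simp
      have "- a \<in> carrier (mpoly_ring X)" using ab R.a_inv_closed[of a] neg[of a] by simp
      then show "inv\<^bsub>add_monoid (mpoly_ring X)\<^esub> a \<in> monomial_ideal M \<inter> carrier (mpoly_ring X)"
        using ab neg[of a] ring_ideal_minus[OF id, of a] unfolding a_inv_def by simp
    next
      show "\<one>\<^bsub>add_monoid (mpoly_ring X :: (('w \<Rightarrow>\<^sub>0 nat) \<Rightarrow>\<^sub>0 'k) ring)\<^esub> \<in> monomial_ideal M \<inter> carrier (mpoly_ring X)"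
        using ring_ideal_zero[OF id] R.zero_closed by simp
    qed
  next
    fix a x :: "('w \<Rightarrow>\<^sub>0 nat) \<Rightarrow>\<^sub>0 'k"
    assume a: "a \<in> monomial_ideal M \<inter> carrier (mpoly_ring X)" and x: "x \<in> carrier (mpoly_ring X)"
    show "x \<otimes>\<^bsub>mpoly_ring X\<^esub> a \<in> monomial_ideal M \<inter> carrier (mpoly_ring X)"
      using a ring_ideal_mult[OF id, of a x] R.m_closed[OF x, of a] by simp
    then show "a \<otimes>\<^bsub>mpoly_ring X\<^esub> x \<in> monomial_ideal M \<inter> carrier (mpoly_ring X)"
      by (simp add: mult.commute)
  qed
qed

lemma monomial_span:
  fixes J :: "(('w \<Rightarrow>\<^sub>0 nat) \<Rightarrow>\<^sub>0 'k::field) set"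
  assumes J: "ideal J (mpoly_ring X)"
    and single: "\<And>m c. m \<in> M \<Longrightarrow> keys m \<subseteq> X \<Longrightarrow> Poly_Mapping.single m c \<in> J"
  shows "monomial_ideal M \<inter> carrier (mpoly_ring X) \<subseteq> J"
proof
  fix p :: "('w \<Rightarrow>\<^sub>0 nat) \<Rightarrow>\<^sub>0 'k"
  assume p: "p \<in> monomial_ideal M \<inter> carrier (mpoly_ring X)"
  show "p \<in> J"
  proof (rule poly_mapping_additive_induct[where p = p])
    show "0 \<in> J" using additive_subgroup.zero_closed[OF ideal.axioms(1)[OF J]] by simp
    show "a + b \<in> J" if "a \<in> J" "b \<in> J" for a b using additive_subgroup.a_closed[OF ideal.axioms(1)[OF J] that] by simp
    show "Poly_Mapping.single m (lookup p m) \<in> J" if "m \<in> keys p" for m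
      using that p by (intro single) (auto simp: monomial_ideal_def in_carrier_mpoly_ring)
  qed
qed

lemma genideal_monomials:
  assumes B: "\<And>b. b \<in> B \<Longrightarrow> keys b \<subseteq> X"
  shows "Idl\<^bsub>mpoly_ring X\<^esub> ((\<lambda>b. Poly_Mapping.single b 1) ` B) =
    monomial_ideal (upclosure B) \<inter> carrier (mpoly_ring X :: (('w \<Rightarrow>\<^sub>0 nat) \<Rightarrow>\<^sub>0 'k::field) ring)"
proof -
  interpret R: cring "mpoly_ring X :: (('w \<Rightarrow>\<^sub>0 nat) \<Rightarrow>\<^sub>0 'k) ring" by (rule mpoly_ring_cring)
  let ?S = "(\<lambda>b. Poly_Mapping.single b 1) ` B :: (('w \<Rightarrow>\<^sub>0 nat) \<Rightarrow>\<^sub>0 'k) set"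
  have S: "?S \<subseteq> carrier (mpoly_ring X)" using B by (auto simp: in_carrier_mpoly_ring)
  interpret G: ideal "Idl\<^bsub>mpoly_ring X\<^esub> ?S" "mpoly_ring X" by (rule R.genideal_ideal[OF S])
  have mem: "b \<in> upclosure B" if "b \<in> B" for b
    using that unfolding upclosure_def by (metis (mono_tags, lifting) add.right_neutral mem_Collect_eq)
  show ?thesis
  proof
    show "Idl\<^bsub>mpoly_ring X\<^esub> ?S \<subseteq> monomial_ideal (upclosure B) \<inter> carrier (mpoly_ring X)"
    proof (rule R.genideal_minimal[OF ideal_monomial_ideal[OF upset_upclosure]])
      show "?S \<subseteq> monomial_ideal (upclosure B) \<inter> carrier (mpoly_ring X)"
        using S mem by (auto simp: monomial_ideal_def)
    qed
    show "monomial_ideal (upclosure B) \<inter> carrier (mpoly_ring X) \<subseteq> Idl\<^bsub>mpoly_ring X\<^esub> ?S"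
    proof (rule monomial_span[OF R.genideal_ideal[OF S]])
      fix m and c :: 'k assume "m \<in> upclosure B" and m: "keys m \<subseteq> X"
      then obtain b n where bn: "b \<in> B" "m = b + n" by (auto simp: upclosure_def)
      have "Poly_Mapping.single b 1 \<in> Idl\<^bsub>mpoly_ring X\<^esub> ?S"
        using R.genideal_self[OF S] bn by blast
      moreover have "Poly_Mapping.single n c \<in> carrier (mpoly_ring X)"
        using m bn by (auto simp: in_carrier_mpoly_ring keys_nat_add)
      ultimately have "Poly_Mapping.single b 1 * Poly_Mapping.single n c \<in> Idl\<^bsub>mpoly_ring X\<^esub> ?S"
        using G.I_r_closed by simp
      then show "Poly_Mapping.single m c \<in> Idl\<^bsub>mpoly_ring X\<^esub> ?S"
        using bn by (simp add: mult_single)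
    qed
  qed
qed

lemma ideal_prod_monomial_ideals:
  assumes M: "upset M" and N: "upset N"
  shows "ideal_prod (mpoly_ring X) (monomial_ideal M \<inter> carrier (mpoly_ring X)) (monomial_ideal N \<inter> carrier (mpoly_ring X))
    = monomial_ideal {m + n | m n. m \<in> M \<and> n \<in> N} \<inter> carrier (mpoly_ring X :: (('w \<Rightarrow>\<^sub>0 nat) \<Rightarrow>\<^sub>0 'k::field) ring)"
    (is "ideal_prod ?R ?I ?J = monomial_ideal ?P \<inter> _")
proof -
  interpret R: cring ?R by (rule mpoly_ring_cring)
  have I: "ideal ?I ?R" and J: "ideal ?J ?R" by (rule ideal_monomial_ideal[OF M], rule ideal_monomial_ideal[OF N])
  show ?thesis
  proof
    show "ideal_prod ?R ?I ?J \<subseteq> monomial_ideal ?P \<inter> carrier ?R"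
    proof
      fix p assume p: "p \<in> ideal_prod ?R ?I ?J"
      then have "keys p \<subseteq> ?P"
      proof (induction rule: ideal_prod.induct)
        case (prod i j)
        then show ?case using keys_mult[of i j] unfolding monomial_ideal_def by fastforce
      next
        case (sum a b)
        then show ?case using Poly_Mapping.keys_add[of a b] by (simp; blast)
      qed
      moreover have "p \<in> carrier ?R" using R.ideal_prod_in_carrier[OF I J] p by blast
      ultimately show "p \<in> monomial_ideal ?P \<inter> carrier ?R" by (simp add: monomial_ideal_def)
    qed
    show "monomial_ideal ?P \<inter> carrier ?R \<subseteq> ideal_prod ?R ?I ?J"
    proof (rule monomial_span[OF R.ideal_prod_is_ideal[OF I J]])
      fix k and c :: 'k assume "k \<in> ?P" and k: "keys k \<subseteq> X"
      then obtain m n where mn: "m \<in> M" "n \<in> N" "k = m + n" by blast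
      then have "keys m \<subseteq> X" "keys n \<subseteq> X" using k by (auto simp: keys_nat_add)
      then have "Poly_Mapping.single m c \<in> ?I" "Poly_Mapping.single n 1 \<in> ?J"
        using mn by (auto simp: monomial_ideal_def in_carrier_mpoly_ring)
      from ideal_prod.prod[OF this, of ?R]
      show "Poly_Mapping.single k c \<in> ideal_prod ?R ?I ?J"
        using mn by (simp add: mult_single)
    qed
  qed
qed

lemma edge_power_Suc:
  "edge_power E (Suc t) = {m + n | m n. m \<in> edge_power E t \<and> n \<in> edge_power E 1}" (is "_ = ?P")
proof (intro equalityI subsetI)
  fix k assume k: "k \<in> edge_power E (Suc t)"
  obtain A where A: "size A = Suc t" "set_mset A \<subseteq> E" "\<And>v. incidence A v \<le> lookup k v"
    using edge_powerE[OF k] by blast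
  then obtain e B where B: "A = add_mset e B" by (metis size_eq_Suc_imp_eq_union)
  have ev: "incidence {#e#} v \<le> lookup k v" for v
    using A(3)[of v] B incidence_add_mset[of e "{#}" v] by (simp add: incidence_add_mset)
  define n where "n = Poly_Mapping.mapp (\<lambda>v _. incidence {#e#} v) k"
  have n: "lookup n v = incidence {#e#} v" for v
    using ev[of v] by (simp add: n_def lookup_mapp when_def in_keys_iff)
  have "n \<in> edge_power E 1"
    by (rule edge_powerI[of "{#e#}"]) (use A(2) B n in auto)
  moreover have "k - n \<in> edge_power E t"
  proof (rule edge_powerI[of B])
    show "incidence B v \<le> lookup (k - n) v" for v
      using A(3)[of v] B n[of v] incidence_add_mset[of e "{#}" v]
      by (simp add: lookup_minus incidence_add_mset)
  qed (use A B in auto)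
  moreover have "k = (k - n) + n"
    by (rule poly_mapping_eqI) (use ev n in \<open>simp add: lookup_add lookup_minus\<close>)
  ultimately show "k \<in> ?P" by blast
next
  fix k assume "k \<in> ?P"
  then obtain m n where k: "k = m + n" and m: "m \<in> edge_power E t" and n: "n \<in> edge_power E 1" by blast
  obtain A where A: "size A = t" "set_mset A \<subseteq> E" "\<And>v. incidence A v \<le> lookup m v"
    using edge_powerE[OF m] by blast
  obtain B where B: "size B = 1" "set_mset B \<subseteq> E" "\<And>v. incidence B v \<le> lookup n v"
    using edge_powerE[OF n] by blast
  show "k \<in> edge_power E (Suc t)"
  proof (rule edge_powerI[of "A + B"])
    show "incidence (A + B) v \<le> lookup k v" for v
      using A(3)[of v] B(3)[of v] by (simp add: incidence_def k lookup_add)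
  qed (use A B in auto)
qed

lemma edge_power_1:
  assumes E: "\<And>e. e \<in> E \<Longrightarrow> \<exists>u v. u \<noteq> v \<and> e = {u, v}"
  shows "edge_power E 1 = upclosure {pvar u + pvar v | u v. u \<noteq> v \<and> {u, v} \<in> E}" (is "_ = upclosure ?B")
proof (intro equalityI subsetI)
  fix m assume m: "m \<in> edge_power E 1"
  obtain A where A: "size A = 1" "set_mset A \<subseteq> E" "\<And>v. incidence A v \<le> lookup m v"
    using edge_powerE[OF m] by blast
  then obtain e where e: "A = {#e#}" by (metis size_1_singleton_mset)
  then have eE: "e \<in> E" using A(2) by simp
  obtain u v where uv: "u \<noteq> v" "e = {u, v}" using E[OF eE] by blast
  have inc: "lookup (pvar u + pvar v) w \<le> lookup m w" for w
    using A(3)[of w] uv e incidence_add_mset[of e "{#}" w]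
    by (auto simp: lookup_add lookup_single when_def split: if_splits)
  have "m = (pvar u + pvar v) + (m - (pvar u + pvar v))"
    by (rule poly_mapping_eqI) (use inc in \<open>simp add: lookup_add lookup_minus\<close>)
  moreover have "pvar u + pvar v \<in> ?B" using uv e A(2) by auto
  ultimately show "m \<in> upclosure ?B" unfolding upclosure_def by blast
next
  fix m assume "m \<in> upclosure ?B"
  then obtain u v n where m: "m = (pvar u + pvar v) + n" and uv: "u \<noteq> v" "{u, v} \<in> E"
    unfolding upclosure_def by blast
  show "m \<in> edge_power E 1"
  proof (rule edge_powerI[of "{#{u, v}#}"])
    show "incidence {#{u, v}#} w \<le> lookup m w" for w
      using uv incidence_add_mset[of "{u, v}" "{#}" w] by (auto simp: m lookup_add lookup_single when_def)
  qed (use uv in auto)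
qed

text \<open>A product of monomial ideals is spanned by the products of their monomials, and a multiset of \<open>t + 1\<close>
edges is a multiset of \<open>t\<close> edges and one more edge.\<close>

lemma edge_ideal_power:
  fixes E :: "'w set set"
  assumes E: "simple_graph X E"
  shows "edge_ideal X E [^]\<^bsub>ideals_set (mpoly_ring X)\<^esub> t =
    monomial_ideal (edge_power E t) \<inter> carrier (mpoly_ring X :: (('w \<Rightarrow>\<^sub>0 nat) \<Rightarrow>\<^sub>0 'k::field) ring)"
proof -
  let ?R = "mpoly_ring X :: (('w \<Rightarrow>\<^sub>0 nat) \<Rightarrow>\<^sub>0 'k) ring"
  let ?B = "{pvar u + pvar v | u v. u \<noteq> v \<and> {u, v} \<in> E}"
  have edge: "\<exists>u v. u \<noteq> v \<and> e = {u, v}" if "e \<in> E" for e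
    using E that unfolding simple_graph_def by blast
  have vert: "u \<in> X \<and> v \<in> X \<and> u \<noteq> v" if "{u, v} \<in> E" for u v
    using E that unfolding simple_graph_def by (auto simp: doubleton_eq_iff)
  have gens: "{mvar u * mvar v | u v. {u, v} \<in> E} =
      (\<lambda>b. Poly_Mapping.single b 1 :: ('w \<Rightarrow>\<^sub>0 nat) \<Rightarrow>\<^sub>0 'k) ` ?B"
    using vert by (auto simp: mvar_def mult_single image_iff; blast)
  have B: "keys b \<subseteq> X" if "b \<in> ?B" for b
    using that vert by (auto simp: keys_nat_add)
  have one: "edge_ideal X E = monomial_ideal (edge_power E 1) \<inter> carrier ?R"
  proof -
    have "Idl\<^bsub>?R\<^esub> ((\<lambda>b. Poly_Mapping.single b 1) ` ?B) = monomial_ideal (upclosure ?B) \<inter> carrier ?R"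
      by (rule genideal_monomials) (rule B)
    moreover have "edge_power E 1 = upclosure ?B" by (rule edge_power_1) (rule edge)
    ultimately show ?thesis unfolding edge_ideal_def gens by (simp only:)
  qed
  show ?thesis
  proof (induction t)
    case 0
    then show ?case by (simp add: nat_pow_def ideals_set_def monomial_ideal_def)
  next
    case (Suc t)
    have "edge_ideal X E [^]\<^bsub>ideals_set ?R\<^esub> Suc t =
        ideal_prod ?R (edge_ideal X E [^]\<^bsub>ideals_set ?R\<^esub> t) (edge_ideal X E)"
      by (simp add: nat_pow_def ideals_set_def)
    also have "\<dots> = monomial_ideal (edge_power E (Suc t)) \<inter> carrier ?R"
      unfolding Suc unfolding one ideal_prod_monomial_ideals[OF upset_edge_power upset_edge_power]
        edge_power_Suc ..
    finally show ?case .
  qed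
qed

section \<open>Torsion and local cohomology\<close>

lemma mvar_power:
  "(mvar v :: ('w \<Rightarrow>\<^sub>0 nat) \<Rightarrow>\<^sub>0 'k::field) ^ N = Poly_Mapping.single (Poly_Mapping.single v N) 1"
proof (induction N)
  case (Suc N)
  have "(mvar v :: ('w \<Rightarrow>\<^sub>0 nat) \<Rightarrow>\<^sub>0 'k) ^ Suc N = mvar v * Poly_Mapping.single (Poly_Mapping.single v N) 1" using Suc by simp
  also have "\<dots> = Poly_Mapping.single (pvar v + Poly_Mapping.single v N) 1"
    by (simp only: mvar_def mult_single mult_1_right)
  also have "pvar v + Poly_Mapping.single v N = Poly_Mapping.single v (Suc N)"
    by (simp flip: single_add)
  finally show ?case .
qed (simp flip: single_one)

lemma mvar_power_in_carrier: "v \<in> X \<Longrightarrow> mvar v ^ N \<in> carrier (mpoly_ring X)"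
  by (auto simp: mvar_power in_carrier_mpoly_ring)

text \<open>The monomials of the ideal generated by the \<open>N\<close>-th powers of the variables in \<open>S\<close>.\<close>

definition powers_upset :: "nat \<Rightarrow> 'w set \<Rightarrow> ('w \<Rightarrow>\<^sub>0 nat) set" where
  "powers_upset N S = {m. \<exists>v\<in>S. N \<le> lookup m v}"

lemma genideal_powers:
  assumes "S \<subseteq> X"
  shows "Idl\<^bsub>mpoly_ring X\<^esub> ((\<lambda>v. mvar v ^ N) ` S) =
    monomial_ideal (powers_upset N S) \<inter> carrier (mpoly_ring X :: (('w \<Rightarrow>\<^sub>0 nat) \<Rightarrow>\<^sub>0 'k::field) ring)"
proof -
  let ?B = "(\<lambda>v. Poly_Mapping.single v N) ` S"
  have img: "(\<lambda>v. mvar v ^ N) ` S = (\<lambda>b. Poly_Mapping.single b 1 :: ('w \<Rightarrow>\<^sub>0 nat) \<Rightarrow>\<^sub>0 'k) ` ?B"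
    by (simp add: image_image mvar_power)
  have up: "upclosure ?B = powers_upset N S"
  proof (intro equalityI subsetI)
    fix m assume "m \<in> upclosure ?B"
    then obtain v n where "v \<in> S" "m = Poly_Mapping.single v N + n" by (auto simp: upclosure_def)
    then have "v \<in> S" "N \<le> lookup m v" by (simp_all add: lookup_add)
    then show "m \<in> powers_upset N S" unfolding powers_upset_def by blast
  next
    fix m assume "m \<in> powers_upset N S"
    then obtain v where v: "v \<in> S" "N \<le> lookup m v" by (auto simp: powers_upset_def)
    have "m = Poly_Mapping.single v N + (m - Poly_Mapping.single v N)"
      by (rule poly_mapping_eqI) (use v in \<open>auto simp: lookup_add lookup_minus lookup_single when_def\<close>)
    then show "m \<in> upclosure ?B" using v unfolding upclosure_def by blast
  qed
  have "Idl\<^bsub>mpoly_ring X\<^esub> ((\<lambda>b. Poly_Mapping.single b 1) ` ?B) =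
      monomial_ideal (upclosure ?B) \<inter> carrier (mpoly_ring X :: (('w \<Rightarrow>\<^sub>0 nat) \<Rightarrow>\<^sub>0 'k) ring)"
    by (rule genideal_monomials) (use assms in \<open>auto split: if_splits\<close>)
  then show ?thesis unfolding img up .
qed

lemma regular_list_powers:
  assumes "distinct vs" "set vs \<subseteq> X"
  shows "regular_list (mpoly_ring X :: (('w \<Rightarrow>\<^sub>0 nat) \<Rightarrow>\<^sub>0 'k::field) ring) (\<lambda>v. mvar v ^ N) vs"
  using assms
proof (induction vs)
  case (Cons v vs)
  have "r \<in> Idl\<^bsub>mpoly_ring X\<^esub> ((\<lambda>v. mvar v ^ N) ` set vs)"
    if r: "r \<in> carrier (mpoly_ring X)"
      and vr: "mvar v ^ N * r \<in> Idl\<^bsub>mpoly_ring X\<^esub> ((\<lambda>v. mvar v ^ N) ` set vs)"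
    for r :: "('w \<Rightarrow>\<^sub>0 nat) \<Rightarrow>\<^sub>0 'k"
  proof -
    have S: "set vs \<subseteq> X" using Cons.prems by simp
    have "mvar v ^ N * r \<in> monomial_ideal (powers_upset N (set vs))"
      using vr genideal_powers[OF S] by blast
    then have *: "Poly_Mapping.single v N + m \<in> powers_upset N (set vs)" if "m \<in> keys r" for m
      using that by (auto simp: mvar_power monomial_ideal_def keys_single_mult)
    have "m \<in> powers_upset N (set vs)" if m: "m \<in> keys r" for m
    proof -
      obtain u where u: "u \<in> set vs" "N \<le> lookup (Poly_Mapping.single v N + m) u"
        using *[OF m] by (auto simp: powers_upset_def)
      moreover have "v \<noteq> u" using u(1) Cons.prems(1) by auto
      ultimately have "N \<le> lookup m u" by (simp add: lookup_add lookup_single)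
      then show ?thesis using u(1) unfolding powers_upset_def by blast
    qed
    then show ?thesis using r genideal_powers[OF S, of N] by (auto simp: monomial_ideal_def)
  qed
  then show ?case using Cons by simp
qed simp

lemma power_in_ideal_power:
  assumes "cring R" "ideal I R" "a \<in> I"
  shows "a [^]\<^bsub>R\<^esub> (N::nat) \<in> I [^]\<^bsub>ideals_set R\<^esub> N"
proof (induction N)
  case 0
  interpret cring R by fact
  show ?case by (simp add: nat_pow_def ideals_set_def)
next
  case (Suc N)
  then show ?case using assms(3) by (simp add: nat_pow_def ideals_set_def ideal_prod.prod)
qed

lemma mpoly_ring_pow: "a [^]\<^bsub>mpoly_ring X\<^esub> (N::nat) = a ^ N"
  by (induction N) (simp_all add: nat_pow_def mult.commute)

lemma mvar_power_in_max_power: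
  assumes "v \<in> X"
  shows "mvar v ^ N \<in> max_hom_ideal X [^]\<^bsub>ideals_set (mpoly_ring X)\<^esub> N"
proof -
  interpret R: cring "mpoly_ring X" by (rule mpoly_ring_cring)
  have S: "mvar ` X \<subseteq> carrier (mpoly_ring X)" using mvar_power_in_carrier[of _ X 1] by auto
  have "ideal (max_hom_ideal X) (mpoly_ring X)" unfolding max_hom_ideal_def by (rule R.genideal_ideal[OF S])
  moreover have "mvar v \<in> max_hom_ideal X"
    unfolding max_hom_ideal_def using R.genideal_self[OF S] assms by blast
  ultimately show ?thesis
    using power_in_ideal_power[OF mpoly_ring_cring, of "max_hom_ideal X" X "mvar v" N]
    by (simp add: mpoly_ring_pow)
qed

lemma max_power_subset:
  assumes "finite X"
  shows "max_hom_ideal X [^]\<^bsub>ideals_set (mpoly_ring X)\<^esub> N \<subseteq>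
    monomial_ideal {m. N \<le> (\<Sum>v\<in>X. lookup m v)} \<inter> carrier (mpoly_ring X :: (('w \<Rightarrow>\<^sub>0 nat) \<Rightarrow>\<^sub>0 'k::field) ring)"
proof (induction N)
  case 0
  then show ?case by (simp add: nat_pow_def ideals_set_def monomial_ideal_def)
next
  case (Suc N)
  let ?R = "mpoly_ring X :: (('w \<Rightarrow>\<^sub>0 nat) \<Rightarrow>\<^sub>0 'k) ring"
  let ?D = "\<lambda>N. {m :: 'w \<Rightarrow>\<^sub>0 nat. N \<le> (\<Sum>v\<in>X. lookup m v)}"
  have up: "upset (?D N)" for N
    by (auto simp: upset_def lookup_add sum.distrib intro: trans_le_add2)
  have "max_hom_ideal X = monomial_ideal (powers_upset 1 X) \<inter> carrier ?R"
    unfolding max_hom_ideal_def using genideal_powers[of X X 1] by simp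
  moreover have "powers_upset 1 X \<subseteq> ?D 1"
  proof
    fix m assume "m \<in> powers_upset 1 X"
    then obtain v where "v \<in> X" "1 \<le> lookup m v" by (auto simp: powers_upset_def)
    then have "1 \<le> (\<Sum>v\<in>X. lookup m v)" using member_le_sum[of v X "lookup m"] assms by auto
    then show "m \<in> ?D 1" by simp
  qed
  ultimately have one: "max_hom_ideal X \<subseteq> monomial_ideal (?D 1) \<inter> carrier ?R"
    using monomial_ideal_mono[of "powers_upset 1 X" "?D 1"] by blast
  have mono: "ideal_prod ?R A B \<subseteq> ideal_prod ?R A' B'" if "A \<subseteq> A'" "B \<subseteq> B'" for A B A' B'
  proof
    fix p assume "p \<in> ideal_prod ?R A B"
    then show "p \<in> ideal_prod ?R A' B'"
      by (induction rule: ideal_prod.induct) (use that in \<open>blast intro: ideal_prod.intros\<close>)+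
  qed
  have "max_hom_ideal X [^]\<^bsub>ideals_set ?R\<^esub> Suc N =
      ideal_prod ?R (max_hom_ideal X [^]\<^bsub>ideals_set ?R\<^esub> N) (max_hom_ideal X)"
    by (simp add: nat_pow_def ideals_set_def)
  also have "\<dots> \<subseteq> ideal_prod ?R (monomial_ideal (?D N) \<inter> carrier ?R) (monomial_ideal (?D 1) \<inter> carrier ?R)"
    by (rule mono[OF Suc one])
  also have "\<dots> = monomial_ideal {m + n | m n. m \<in> ?D N \<and> n \<in> ?D 1} \<inter> carrier ?R"
    by (rule ideal_prod_monomial_ideals[OF up up])
  also have "\<dots> \<subseteq> monomial_ideal (?D (Suc N)) \<inter> carrier ?R"
  proof -
    have "{m + n | m n. m \<in> ?D N \<and> n \<in> ?D 1} \<subseteq> ?D (Suc N)"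
      by (auto simp: lookup_add sum.distrib)
    then show ?thesis using monomial_ideal_mono by blast
  qed
  finally show ?case .
qed

text \<open>The powers of the maximal ideal and the ideals of \<open>N\<close>-th powers of the variables are cofinal: a monomial of
degree greater than \<open>N |X|\<close> has some exponent at least \<open>N\<close>.\<close>

lemma torsion_iff:
  fixes R :: "(('w \<Rightarrow>\<^sub>0 nat) \<Rightarrow>\<^sub>0 'k::field) ring"
  assumes R: "R = mpoly_ring X" and X: "finite X" and M: "module R M"
  shows "x \<in> carrier (torsion R (max_hom_ideal X) M) \<longleftrightarrow>
    x \<in> carrier M \<and> (\<exists>N. \<forall>v\<in>X. (mvar v ^ N) \<odot>\<^bsub>M\<^esub> x = \<zero>\<^bsub>M\<^esub>)"
proof -
  interpret M: module R M by fact
  have "\<exists>N::nat. \<forall>a\<in>max_hom_ideal X [^]\<^bsub>ideals_set R\<^esub> N. a \<odot>\<^bsub>M\<^esub> x = \<zero>\<^bsub>M\<^esub>"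
    if x: "x \<in> carrier M" and N: "\<forall>v\<in>X. (mvar v ^ N) \<odot>\<^bsub>M\<^esub> x = \<zero>\<^bsub>M\<^esub>" for N :: nat
  proof (rule exI[of _ "Suc (N * card X)"], rule ballI)
    fix a assume "a \<in> max_hom_ideal X [^]\<^bsub>ideals_set R\<^esub> Suc (N * card X)"
    then have a: "a \<in> monomial_ideal {m. Suc (N * card X) \<le> (\<Sum>v\<in>X. lookup m v)}" "a \<in> carrier R"
      using max_power_subset[OF X] unfolding R by blast+
    have "m \<in> powers_upset N X" if m: "Suc (N * card X) \<le> (\<Sum>v\<in>X. lookup m v)" for m :: "'w \<Rightarrow>\<^sub>0 nat"
    proof (rule ccontr)
      assume "m \<notin> powers_upset N X"
      then have "(\<Sum>v\<in>X. lookup m v) \<le> (\<Sum>v\<in>X. N)"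
        by (intro sum_mono) (auto simp: powers_upset_def)
      then show False using m by (simp add: mult.commute)
    qed
    then have "a \<in> monomial_ideal (powers_upset N X) \<inter> carrier (mpoly_ring X)"
      using a unfolding R monomial_ideal_def by blast
    then have aI: "a \<in> Idl\<^bsub>R\<^esub> ((\<lambda>v. mvar v ^ N) ` X)" unfolding R by (subst genideal_powers) auto
    have "Idl\<^bsub>R\<^esub> ((\<lambda>v. mvar v ^ N) ` X) \<subseteq> {a \<in> carrier R. a \<odot>\<^bsub>M\<^esub> x = \<zero>\<^bsub>M\<^esub>}"
      by (rule M.R.genideal_minimal[OF M.annihilator_ideal[OF x]])
        (use N mvar_power_in_carrier R in auto)
    then show "a \<odot>\<^bsub>M\<^esub> x = \<zero>\<^bsub>M\<^esub>" using aI by blast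
  qed
  moreover have "\<forall>v\<in>X. (mvar v ^ N) \<odot>\<^bsub>M\<^esub> x = \<zero>\<^bsub>M\<^esub>"
    if "\<forall>a\<in>max_hom_ideal X [^]\<^bsub>ideals_set R\<^esub> N. a \<odot>\<^bsub>M\<^esub> x = \<zero>\<^bsub>M\<^esub>" for N :: nat
  proof
    fix v assume "v \<in> X"
    from mvar_power_in_max_power[OF this, of N] have "mvar v ^ N \<in> max_hom_ideal X [^]\<^bsub>ideals_set R\<^esub> N"
      unfolding R .
    then show "(mvar v ^ N) \<odot>\<^bsub>M\<^esub> x = \<zero>\<^bsub>M\<^esub>" using that by simp
  qed
  moreover have "x \<in> carrier (torsion R (max_hom_ideal X) M) \<longleftrightarrow> x \<in> carrier M \<and>
      (\<exists>N::nat. \<forall>a\<in>max_hom_ideal X [^]\<^bsub>ideals_set R\<^esub> N. a \<odot>\<^bsub>M\<^esub> x = \<zero>\<^bsub>M\<^esub>)"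
    by (simp add: torsion_def)
  ultimately show ?thesis by (meson)
qed

lemma ring_as_module_module:
  assumes "cring R" shows "module R (ring_as_module R)"
proof -
  interpret cring R by fact
  have "abelian_group (ring_as_module R)"
    by (rule abelian_groupI) (auto simp: ring_as_module_def a_ac intro: bexI[of _ "\<ominus>\<^bsub>R\<^esub> _"] l_neg)
  then show ?thesis
    by (intro moduleI assms) (auto simp: ring_as_module_def l_distr r_distr m_assoc)
qed

lemma mkoszul_mpoly_ring:
  fixes z :: "'i set \<Rightarrow> ('w \<Rightarrow>\<^sub>0 nat) \<Rightarrow>\<^sub>0 'k::field"
  assumes "g ` set vs \<subseteq> carrier (mpoly_ring X)" "\<And>F. z F \<in> carrier (mpoly_ring X)"
  shows "mkoszul (ring_as_module (mpoly_ring X)) g vs z F = koszul g vs z F"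
  using assms
proof (induction vs arbitrary: z F)
  case Nil
  then show ?case by (simp add: ring_as_module_def)
next
  case (Cons v vs)
  interpret R: cring "mpoly_ring X :: (('w \<Rightarrow>\<^sub>0 nat) \<Rightarrow>\<^sub>0 'k) ring" by (rule mpoly_ring_cring)
  interpret M: module "mpoly_ring X :: (('w \<Rightarrow>\<^sub>0 nat) \<Rightarrow>\<^sub>0 'k) ring" "ring_as_module (mpoly_ring X)"
    by (rule ring_as_module_module[OF mpoly_ring_cring])
  have g: "g v \<in> carrier (mpoly_ring X)" "g ` set vs \<subseteq> carrier (mpoly_ring X)" using Cons.prems by auto
  have minus: "a \<ominus>\<^bsub>ring_as_module (mpoly_ring X)\<^esub> b = a \<ominus>\<^bsub>mpoly_ring X\<^esub> b" for a b :: "('w \<Rightarrow>\<^sub>0 nat) \<Rightarrow>\<^sub>0 'k"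
    by (simp add: a_minus_def a_inv_def m_inv_def ring_as_module_def)
  have carr: "carrier (ring_as_module (mpoly_ring X)) = carrier (mpoly_ring X)"
    by (simp add: ring_as_module_def)
  have IH: "mkoszul (ring_as_module (mpoly_ring X)) g vs y F = koszul g vs y F"
    and cl: "koszul g vs y F \<in> carrier (mpoly_ring X)" if y: "\<And>F. y F \<in> carrier (mpoly_ring X)" for y F
  proof -
    show eq: "mkoszul (ring_as_module (mpoly_ring X)) g vs y F = koszul g vs y F" by (rule Cons.IH[OF g(2) y])
    have "mkoszul (ring_as_module (mpoly_ring X)) g vs y F \<in> carrier (mpoly_ring X)"
      using M.mkoszul_closed[OF g(2), of y F] y unfolding carr by blast
    then show "koszul g vs y F \<in> carrier (mpoly_ring X)" unfolding eq .
  qed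
  have "g v * z (F - {v}) \<in> carrier (mpoly_ring X)"
    using R.m_closed[OF g(1) Cons.prems(2)[of "F - {v}"]] by simp
  then have dif: "g v * z (F - {v}) \<ominus>\<^bsub>mpoly_ring X\<^esub> koszul g vs (\<lambda>G. z (insert v G)) (F - {v}) =
      g v * z (F - {v}) - koszul g vs (\<lambda>G. z (insert v G)) (F - {v})"
    by (rule mpoly_ring_minus) (intro cl Cons.prems(2))
  have smult: "a \<odot>\<^bsub>ring_as_module (mpoly_ring X)\<^esub> b = a * b" for a b :: "('w \<Rightarrow>\<^sub>0 nat) \<Rightarrow>\<^sub>0 'k"
    by (simp add: ring_as_module_def)
  have "mkoszul (ring_as_module (mpoly_ring X)) g vs z F = koszul g vs z F"
    "mkoszul (ring_as_module (mpoly_ring X)) g vs (\<lambda>G. z (insert v G)) (F - {v}) =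
      koszul g vs (\<lambda>G. z (insert v G)) (F - {v})"
    by (intro IH Cons.prems(2))+
  then show ?case by (simp add: smult minus dif)
qed

lemma quot_module_coset_hom:
  assumes R: "cring R" and I: "ideal I R" and M: "module R M"
    and \<epsilon>: "\<epsilon> \<in> mod_hom R (quot_module R I) M"
  shows "(\<lambda>r. \<epsilon> (I +>\<^bsub>R\<^esub> r)) \<in> mod_hom R (ring_as_module R) M"
proof -
  interpret R: cring R by fact
  interpret I: ideal I R by fact
  note Q = quot_module_module[OF R I]
  have cl: "I +>\<^bsub>R\<^esub> r \<in> carrier (quot_module R I)" if "r \<in> carrier R" for r
    using that ring_hom_closed[OF I.rcos_ring_hom] by (simp add: quot_module_def)
  note E = mod_homD[OF Q M \<epsilon>]
  have "\<epsilon> (I +>\<^bsub>R\<^esub> (r \<oplus>\<^bsub>R\<^esub> s)) = \<epsilon> (I +>\<^bsub>R\<^esub> r) \<oplus>\<^bsub>M\<^esub> \<epsilon> (I +>\<^bsub>R\<^esub> s)"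
    if "r \<in> carrier R" "s \<in> carrier R" for r s
    using E(2)[OF cl cl] that ring_hom_add[OF I.rcos_ring_hom] by (simp add: quot_module_def)
  moreover have "\<epsilon> (I +>\<^bsub>R\<^esub> (a \<otimes>\<^bsub>R\<^esub> r)) = a \<odot>\<^bsub>M\<^esub> \<epsilon> (I +>\<^bsub>R\<^esub> r)"
    if "a \<in> carrier R" "r \<in> carrier R" for a r
    using E(3)[OF _ cl] that ring_hom_mult[OF I.rcos_ring_hom] by (simp add: quot_module_def)
  ultimately show ?thesis
    using E(1)[OF cl] by (auto simp: mod_hom_def hom_def ring_as_module_def)
qed

text \<open>A cochain with values in the kernel of \<open>\<delta> 0\<close> lifts along \<open>\<epsilon>\<close> to a cochain of polynomials, which is a
cocycle modulo the ideal; the vanishing of its class is transported back.  The powers of the variables are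
a regular sequence.\<close>

lemma koszul_resolution_of_depth:
  fixes X :: "'w set" and M :: "('w \<Rightarrow>\<^sub>0 nat) set" and K :: "'k::field itself"
    and R :: "(('w \<Rightarrow>\<^sub>0 nat) \<Rightarrow>\<^sub>0 'k) ring" and J :: "nat \<Rightarrow> (('w \<Rightarrow>\<^sub>0 nat) \<Rightarrow>\<^sub>0 'k, 'c) module"
  assumes R: "R = mpoly_ring X" and M: "upset M" and vs: "distinct vs" "set vs = X"
    and depth: "monomial_depth_ge K vs d M" and N: "N \<ge> 1"
    and res: "injective_resolution R (quot_module R (monomial_ideal M \<inter> carrier R)) \<epsilon> J \<delta>"
  shows "koszul_resolution R J \<delta> (\<lambda>v. mvar v ^ N) vs d"
proof -
  let ?I = "monomial_ideal M \<inter> carrier R"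
  let ?g = "\<lambda>v. mvar v ^ N :: ('w \<Rightarrow>\<^sub>0 nat) \<Rightarrow>\<^sub>0 'k"
  let ?e = "\<lambda>r. \<epsilon> (?I +>\<^bsub>R\<^esub> r)"
  have cr: "cring R" unfolding R by (rule mpoly_ring_cring)
  interpret R: cring R by (rule cr)
  have idI: "ideal ?I R" unfolding R by (rule ideal_monomial_ideal[OF M])
  interpret I: ideal ?I R by (rule idI)
  note Q = quot_module_module[OF cr idI]
  interpret Q: module R "quot_module R ?I" by (rule Q)
  have inj: "injective_module R (J i)" for i using res by (simp add: injective_resolution_def)
  have mods: "module R (J i)" for i using inj by (simp add: injective_module_def)
  interpret J: module R "J i" for i by (rule mods)
  have \<epsilon>: "\<epsilon> \<in> mod_hom R (quot_module R ?I) (J 0)" "inj_on \<epsilon> (carrier (quot_module R ?I))"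
    "\<epsilon> ` carrier (quot_module R ?I) = mod_ker (J 0) (J 1) (\<delta> 0)"
    using res by (simp_all add: injective_resolution_def)
  have e: "?e \<in> mod_hom R (ring_as_module R) (J 0)" by (rule quot_module_coset_hom[OF cr idI mods \<epsilon>(1)])
  note RM = ring_as_module_module[OF cr]
  have carr: "carrier (ring_as_module R) = carrier R" by (simp add: ring_as_module_def)
  have cl: "?I +>\<^bsub>R\<^esub> r \<in> carrier (quot_module R ?I)" if "r \<in> carrier R" for r
    using that ring_hom_closed[OF I.rcos_ring_hom] by (simp add: quot_module_def)
  have e_ker: "\<delta> 0 (?e r) = \<zero>\<^bsub>J 1\<^esub>" "?e r \<in> carrier (J 0)" if "r \<in> carrier R" for r
  proof -
    have "?e r \<in> mod_ker (J 0) (J 1) (\<delta> 0)" unfolding \<epsilon>(3)[symmetric] using cl[OF that] by blast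
    then show "\<delta> 0 (?e r) = \<zero>\<^bsub>J 1\<^esub>" "?e r \<in> carrier (J 0)" by (simp_all add: mod_ker_def)
  qed
  have e_surj: "\<exists>r\<in>carrier R. x = ?e r" if "x \<in> carrier (J 0)" "\<delta> 0 x = \<zero>\<^bsub>J 1\<^esub>" for x
  proof -
    have "x \<in> \<epsilon> ` carrier (quot_module R ?I)" unfolding \<epsilon>(3) mod_ker_def using that by simp
    then obtain A where A: "A \<in> carrier (quot_module R ?I)" "x = \<epsilon> A" by blast
    then obtain r where "r \<in> carrier R" "A = ?I +>\<^bsub>R\<^esub> r"
      by (auto simp: quot_module_def FactRing_def A_RCOSETS_def')
    then show ?thesis using A by blast
  qed
  have e_zero: "?e r = \<zero>\<^bsub>J 0\<^esub> \<longleftrightarrow> r \<in> ?I" if r: "r \<in> carrier R" for r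
  proof -
    have z: "\<epsilon> \<zero>\<^bsub>quot_module R ?I\<^esub> = \<zero>\<^bsub>J 0\<^esub>" by (rule mod_homD(4)[OF Q mods \<epsilon>(1)])
    have zI: "\<zero>\<^bsub>quot_module R ?I\<^esub> = ?I" by (simp add: quot_module_def FactRing_def)
    have "?e r = \<zero>\<^bsub>J 0\<^esub> \<longleftrightarrow> ?I +>\<^bsub>R\<^esub> r = ?I"
      using inj_onD[OF \<epsilon>(2), of "?I +>\<^bsub>R\<^esub> r" ?I] z zI cl[OF r] Q.M.zero_closed by auto
    also have "\<dots> \<longleftrightarrow> r \<in> ?I"
      using R.a_coset_join1[OF _ r I.a_subgroup] R.a_coset_join2[OF r I.a_subgroup] by blast
    finally show ?thesis .
  qed
  have g: "?g ` set vs \<subseteq> carrier R" unfolding R vs(2) by (auto intro: mvar_power_in_carrier)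
  have e_koszul: "mkoszul (J 0) ?g vs (\<lambda>G. ?e (r G)) F = ?e (koszul ?g vs r F)"
    and k_closed: "koszul ?g vs r F \<in> carrier R" if r: "\<And>F. r F \<in> carrier R" for r F
  proof -
    have k: "mkoszul (ring_as_module R) ?g vs r F = koszul ?g vs r F"
      unfolding R by (rule mkoszul_mpoly_ring) (use g r R in auto)
    from mkoszul_hom[OF RM mods e g, of r F, unfolded carr k, OF r]
    show "mkoszul (J 0) ?g vs (\<lambda>G. ?e (r G)) F = ?e (koszul ?g vs r F)" "koszul ?g vs r F \<in> carrier R"
      by blast+
  qed
  have kdepth: "koszul_depth_ge ?g vs d (monomial_ideal M)"
    by (rule koszul_depth_ge_power[OF ring_ideal_monomial_ideal[OF M] vs(1) N])
      (use depth in \<open>simp add: monomial_depth_ge_def\<close>)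
  show ?thesis
  proof
    show "injective_module R (J i)" for i by (rule inj)
    show "\<delta> i \<in> mod_hom R (J i) (J (Suc i))" for i using res by (simp add: injective_resolution_def)
    show "\<delta> i ` carrier (J i) = mod_ker (J (Suc i)) (J (Suc (Suc i))) (\<delta> (Suc i))" for i
      using res by (simp add: injective_resolution_def)
    show "?g ` set vs \<subseteq> carrier R" by (rule g)
    show "distinct vs" by (rule vs(1))
    show "regular_list R ?g vs" unfolding R by (rule regular_list_powers) (use vs in auto)
  next
    fix p and z :: "'w set \<Rightarrow> 'c"
    assume p: "int p < d" and z: "\<And>F. z F \<in> carrier (J 0)"
      and \<delta>z: "\<forall>F\<subseteq>set vs. card F = p \<longrightarrow> \<delta> 0 (z F) = \<zero>\<^bsub>J 1\<^esub>"
      and dz: "\<forall>F\<subseteq>set vs. card F = Suc p \<longrightarrow> mkoszul (J 0) ?g vs z F = \<zero>\<^bsub>J 0\<^esub>"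
    have "\<forall>F. \<exists>r. r \<in> carrier R \<and> (F \<subseteq> set vs \<longrightarrow> card F = p \<longrightarrow> z F = ?e r)"
    proof
      fix F show "\<exists>r. r \<in> carrier R \<and> (F \<subseteq> set vs \<longrightarrow> card F = p \<longrightarrow> z F = ?e r)"
      proof (cases "F \<subseteq> set vs \<and> card F = p")
        case True
        then show ?thesis using e_surj[OF z] \<delta>z by blast
      qed (use R.zero_closed in blast)
    qed
    from choice[OF this] obtain r where rc: "\<And>F. r F \<in> carrier R"
      and r: "\<And>F. F \<subseteq> set vs \<Longrightarrow> card F = p \<Longrightarrow> z F = ?e (r F)" by blast
    have "\<forall>F\<subseteq>set vs. card F = Suc p \<longrightarrow> koszul ?g vs r F \<in> monomial_ideal M"
    proof (intro allI impI)
      fix F assume F: "F \<subseteq> set vs" "card F = Suc p"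
      have "?e (koszul ?g vs r F) = mkoszul (J 0) ?g vs (\<lambda>G. ?e (r G)) F" by (rule e_koszul[OF rc, symmetric])
      also have "\<dots> = mkoszul (J 0) ?g vs z F"
      proof (rule mkoszul_cong)
        fix u assume "u \<in> F"
        then have "F - {u} \<subseteq> set vs" "card (F - {u}) = p" using F by auto
        then show "?e (r (F - {u})) = z (F - {u})" using r by simp
      qed
      finally show "koszul ?g vs r F \<in> monomial_ideal M"
        using dz F e_zero[OF k_closed[OF rc]] by simp
    qed
    from koszul_vanishesD[OF koszul_depth_geD[OF kdepth p] this]
    obtain w where w: "\<And>F. F \<subseteq> set vs \<Longrightarrow> card F = p \<Longrightarrow> r F - koszul ?g vs w F \<in> monomial_ideal M" by blast
    \<comment> \<open>The cochain \<open>w\<close> may involve variables outside \<open>X\<close>; dropping those monomials commutes with the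
      differential and does not affect \<open>r\<close>.\<close>
    let ?r = "restrict_keys {m. keys m \<subseteq> X} :: (('w \<Rightarrow>\<^sub>0 nat) \<Rightarrow>\<^sub>0 'k) \<Rightarrow> _"
    have rid: "?r a = a" if "a \<in> carrier R" for a
      by (rule poly_mapping_eqI)
        (use that in \<open>auto simp: lookup_restrict_keys when_def R in_carrier_mpoly_ring in_keys_iff\<close>)
    have rR: "?r a \<in> carrier R" for a by (auto simp: R in_carrier_mpoly_ring keys_restrict_keys)
    have rk: "?r (koszul ?g vs w F) = koszul ?g vs (\<lambda>G. ?r (w G)) F" for F
      by (rule restrict_keys_koszul[where a = "\<lambda>v. Poly_Mapping.single v N"])
        (use vs in \<open>auto simp: mvar_power keys_nat_add split: if_splits\<close>)
    show "\<exists>w. (\<forall>F. w F \<in> carrier (J 0) \<and> \<delta> 0 (w F) = \<zero>\<^bsub>J 1\<^esub>) \<and>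
        (\<forall>F\<subseteq>set vs. card F = p \<longrightarrow> z F = mkoszul (J 0) ?g vs w F)"
    proof (rule exI[of _ "\<lambda>G. ?e (?r (w G))"], intro conjI allI impI)
      show "?e (?r (w F)) \<in> carrier (J 0)" "\<delta> 0 (?e (?r (w F))) = \<zero>\<^bsub>J 1\<^esub>" for F
        using e_ker[OF rR] by auto
      fix F assume F: "F \<subseteq> set vs" "card F = p"
      let ?k = "koszul ?g vs (\<lambda>G. ?r (w G)) F"
      have kc: "?k \<in> carrier R" by (rule k_closed[OF rR])
      have "?r (r F - koszul ?g vs w F) \<in> monomial_ideal M"
        using w[OF F] by (auto simp: monomial_ideal_def keys_restrict_keys)
      then have "r F - ?k \<in> monomial_ideal M" by (simp add: restrict_keys_diff rid[OF rc] rk)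
      moreover have rk': "r F \<ominus>\<^bsub>R\<^esub> ?k = r F - ?k" using mpoly_ring_minus rc kc unfolding R by blast
      ultimately have kM: "r F \<ominus>\<^bsub>R\<^esub> ?k \<in> monomial_ideal M" by simp
      have cl': "r F \<ominus>\<^bsub>R\<^esub> ?k \<in> carrier R" by (rule R.minus_closed[OF rc kc])
      have "?e (r F \<ominus>\<^bsub>R\<^esub> ?k) = \<zero>\<^bsub>J 0\<^esub>" using e_zero[OF cl'] kM cl' by blast
      moreover have "r F \<ominus>\<^bsub>ring_as_module R\<^esub> ?k = r F \<ominus>\<^bsub>R\<^esub> ?k"
        by (simp add: a_minus_def a_inv_def m_inv_def ring_as_module_def)
      moreover have "?e (r F \<ominus>\<^bsub>ring_as_module R\<^esub> ?k) = ?e (r F) \<ominus>\<^bsub>J 0\<^esub> ?e ?k"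
        by (rule mod_homD(5)[OF RM mods e]) (simp_all add: carr rc kc)
      ultimately have "?e (r F) \<ominus>\<^bsub>J 0\<^esub> ?e ?k = \<zero>\<^bsub>J 0\<^esub>" by (simp only:)
      from J.M.diff_eq_zero[OF _ _ this] have "?e (r F) = ?e ?k" using e_ker(2) rc kc by blast
      then show "z F = mkoszul (J 0) ?g vs (\<lambda>G. ?e (?r (w G))) F"
        using r[OF F] e_koszul[OF rR] by simp
    qed
  qed
qed

text \<open>A torsion cocycle is killed by a power of every variable.  The lift provided by the resolution is killed
by the same powers, hence is torsion.\<close>

lemma local_cohomology_vanishes:
  fixes X :: "'w set" and M :: "('w \<Rightarrow>\<^sub>0 nat) set" and K :: "'k::field itself"
    and R :: "(('w \<Rightarrow>\<^sub>0 nat) \<Rightarrow>\<^sub>0 'k) ring"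
  assumes R: "R = mpoly_ring X" and M: "upset M" and vs: "distinct vs" "set vs = X"
    and depth: "monomial_depth_ge K vs d M" and i: "int i < d"
  shows "\<not> local_cohomology_nonzero TYPE('c) R (max_hom_ideal X)
      (quot_module R (monomial_ideal M \<inter> carrier R)) i"
proof
  assume "local_cohomology_nonzero TYPE('c) R (max_hom_ideal X)
      (quot_module R (monomial_ideal M \<inter> carrier R)) i"
  then obtain \<epsilon> and J :: "nat \<Rightarrow> (('w \<Rightarrow>\<^sub>0 nat) \<Rightarrow>\<^sub>0 'k, 'c) module" and \<delta>
    where res: "injective_resolution R (quot_module R (monomial_ideal M \<inter> carrier R)) \<epsilon> J \<delta>"
      and H: "carrier (cohomology (\<lambda>i. torsion R (max_hom_ideal X) (J i)) \<delta> i) \<noteq>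
        {\<one>\<^bsub>cohomology (\<lambda>i. torsion R (max_hom_ideal X) (J i)) \<delta> i\<^esub>}"
    unfolding local_cohomology_nonzero_def Let_def by blast
  have X: "finite X" using vs by auto
  interpret K1: koszul_resolution R J \<delta> "\<lambda>v. mvar v ^ 1" vs d
    by (rule koszul_resolution_of_depth[OF R M vs depth _ res]) simp
  let ?C = "\<lambda>i. torsion R (max_hom_ideal X) (J i)"
  let ?Z = "cocycles ?C \<delta> i" and ?B = "coboundaries ?C \<delta> i"
  have tors: "x \<in> carrier (?C i) \<longleftrightarrow> x \<in> carrier (J i) \<and> (\<exists>N. \<forall>v\<in>X. (mvar v ^ N) \<odot>\<^bsub>J i\<^esub> x = \<zero>\<^bsub>J i\<^esub>)"
    for i x by (rule torsion_iff[OF R X K1.mods])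
  have ops [simp]: "zero (?C i) = zero (J i)" "add (?C i) = add (J i)" for i
    by (simp_all add: torsion_def)
  have mv: "mvar v ^ N \<in> carrier R" if "v \<in> X" for v N
    using mvar_power_in_carrier[OF that] R by simp
  have killed_mono: "(mvar v ^ N') \<odot>\<^bsub>J i\<^esub> x = \<zero>\<^bsub>J i\<^esub>"
    if x: "x \<in> carrier (J i)" "(mvar v ^ N) \<odot>\<^bsub>J i\<^esub> x = \<zero>\<^bsub>J i\<^esub>" "v \<in> X" and NN: "N \<le> N'" for i x v N N'
  proof -
    have "mvar v ^ N' = mvar v ^ (N' - N) \<otimes>\<^bsub>R\<^esub> mvar v ^ N"
      unfolding R mpoly_ring_simps using NN by (simp flip: power_add)
    then show ?thesis using x mv[OF x(3)] K1.J.smult_assoc1[of "mvar v ^ (N' - N)" "mvar v ^ N" x i] by simp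
  qed
  \<comment> \<open>The exponent \<open>N\<close> depends on the cocycle, hence a new Koszul sequence for each cocycle.  The successor
    makes the exponent positive, as the passage to powers needs.\<close>
  have ZB: "?Z \<subseteq> ?B"
  proof
    fix z assume "z \<in> ?Z"
    then have z: "z \<in> carrier (?C i)" "\<delta> i z = \<zero>\<^bsub>J (Suc i)\<^esub>"
      by (simp_all add: cocycles_def mod_ker_def)
    then obtain N where zc: "z \<in> carrier (J i)" and N: "\<And>v. v \<in> X \<Longrightarrow> (mvar v ^ N) \<odot>\<^bsub>J i\<^esub> z = \<zero>\<^bsub>J i\<^esub>"
      using tors by blast
    interpret KN: koszul_resolution R J \<delta> "\<lambda>v. mvar v ^ Suc N" vs d
      by (rule koszul_resolution_of_depth[OF R M vs depth _ res]) simp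
    have gz: "(mvar v ^ Suc N) \<odot>\<^bsub>J i\<^esub> z = \<zero>\<^bsub>J i\<^esub>" if "v \<in> set vs" for v
      using killed_mono[OF zc N, of v "Suc N"] that vs by simp
    show "z \<in> ?B"
    proof (cases i)
      case 0
      have "z = \<zero>\<^bsub>J 0\<^esub>"
        by (rule KN.killed_cocycle_zero) (use i z zc gz 0 in auto)
      then show ?thesis using 0 by (simp add: coboundaries_def)
    next
      case (Suc q)
      have "\<exists>y\<in>carrier (J q). \<delta> q y = z \<and> (\<forall>v\<in>set vs. (mvar v ^ Suc N) \<odot>\<^bsub>J q\<^esub> y = \<zero>\<^bsub>J q\<^esub>)"
        by (rule KN.killed_cocycle_lift) (use i z zc gz Suc in auto)
      then obtain y where "y \<in> carrier (J q)" "\<delta> q y = z"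
        "\<forall>v\<in>X. (mvar v ^ Suc N) \<odot>\<^bsub>J q\<^esub> y = \<zero>\<^bsub>J q\<^esub>" using vs by auto
      then have "y \<in> carrier (?C q)" "\<delta> q y = z" using tors by blast+
      then show ?thesis using Suc by (auto simp: coboundaries_def)
    qed
  qed
  have tors_sub: "x \<ominus>\<^bsub>J i\<^esub> y \<in> carrier (?C i)" if x: "x \<in> carrier (?C i)" and y: "y \<in> carrier (?C i)" for i x y
  proof -
    obtain N where xc: "x \<in> carrier (J i)" and N: "\<And>v. v \<in> X \<Longrightarrow> (mvar v ^ N) \<odot>\<^bsub>J i\<^esub> x = \<zero>\<^bsub>J i\<^esub>"
      using x tors by blast
    obtain N' where yc: "y \<in> carrier (J i)" and N': "\<And>v. v \<in> X \<Longrightarrow> (mvar v ^ N') \<odot>\<^bsub>J i\<^esub> y = \<zero>\<^bsub>J i\<^esub>"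
      using y tors by blast
    have "(mvar v ^ (N + N')) \<odot>\<^bsub>J i\<^esub> (x \<ominus>\<^bsub>J i\<^esub> y) = \<zero>\<^bsub>J i\<^esub>" if v: "v \<in> X" for v
      using killed_mono[OF xc N[OF v] v, of "N + N'"] killed_mono[OF yc N'[OF v] v, of "N + N'"]
        K1.J.smult_r_diff[OF mv[OF v] xc yc] K1.J.M.diff_zero[OF K1.J.M.zero_closed] by simp
    then show ?thesis using tors xc yc K1.J.M.minus_closed by blast
  qed
  have zeroC: "\<zero>\<^bsub>J i\<^esub> \<in> carrier (?C i)" for i
    using tors K1.J.M.zero_closed K1.J.smult_r_null mv by blast
  have B: "?B \<subseteq> carrier (J i) \<and> (\<forall>x\<in>?B. \<forall>y\<in>?B. x \<ominus>\<^bsub>J i\<^esub> y \<in> ?B)"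
  proof (cases i)
    case 0
    then show ?thesis by (simp add: coboundaries_def K1.J.M.diff_self)
  next
    case (Suc q)
    have Bq: "coboundaries ?C \<delta> (Suc q) = \<delta> q ` carrier (?C q)" by (simp add: coboundaries_def)
    have sub: "a \<in> carrier (J q)" if "a \<in> carrier (?C q)" for a using tors that by blast
    have "\<delta> q a \<ominus>\<^bsub>J i\<^esub> \<delta> q b \<in> \<delta> q ` carrier (?C q)" if "a \<in> carrier (?C q)" "b \<in> carrier (?C q)" for a b
      unfolding Suc K1.\<delta>_hom(5)[OF sub[OF that(1)] sub[OF that(2)], symmetric]
      using tors_sub[OF that] by (rule imageI)
    moreover have "\<delta> q ` carrier (?C q) \<subseteq> carrier (J (Suc q))"
      using K1.\<delta>_hom(1)[OF sub] by blast
    ultimately show ?thesis unfolding Suc Bq by blast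
  qed
  have zeroZ: "\<zero>\<^bsub>J i\<^esub> \<in> ?Z"
    using zeroC[of i] K1.\<delta>_hom(4)[of i] by (simp add: cocycles_def mod_ker_def)
  let ?G = "(add_monoid (?C i))\<lparr>carrier := ?Z\<rparr>"
  have coset: "?B #>\<^bsub>?G\<^esub> a = ?B" if a: "a \<in> ?Z" for a
  proof -
    have aB: "a \<in> ?B" and 0: "\<zero>\<^bsub>J i\<^esub> \<in> ?B" using a ZB zeroZ by blast+
    have carr: "b \<in> carrier (J i)" if "b \<in> ?B" for b using B that by blast
    have "b \<oplus>\<^bsub>J i\<^esub> a \<in> ?B" if b: "b \<in> ?B" for b
    proof -
      have "b \<ominus>\<^bsub>J i\<^esub> (\<zero>\<^bsub>J i\<^esub> \<ominus>\<^bsub>J i\<^esub> a) \<in> ?B" using B aB b 0 by blast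
      then show ?thesis using carr[OF aB] carr[OF b] by (simp add: K1.J.M.minus_eq)
    qed
    moreover have "\<exists>c\<in>?B. b = c \<oplus>\<^bsub>J i\<^esub> a" if b: "b \<in> ?B" for b
    proof (rule bexI[of _ "b \<ominus>\<^bsub>J i\<^esub> a"])
      show "b = (b \<ominus>\<^bsub>J i\<^esub> a) \<oplus>\<^bsub>J i\<^esub> a"
        using carr[OF aB] carr[OF b] by (simp add: K1.J.M.minus_eq K1.J.M.a_assoc K1.J.M.l_neg)
      show "b \<ominus>\<^bsub>J i\<^esub> a \<in> ?B" using B aB b by blast
    qed
    ultimately show ?thesis by (auto simp: r_coset_def)
  qed
  have "carrier (cohomology ?C \<delta> i) = (\<lambda>a. ?B #>\<^bsub>?G\<^esub> a) ` ?Z"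
    by (simp add: cohomology_def carrier_FactGroup)
  also have "\<dots> = {?B}" using coset zeroZ by auto
  also have "\<dots> = {\<one>\<^bsub>cohomology ?C \<delta> i\<^esub>}" by (simp add: cohomology_def)
  finally show False using H by contradiction
qed

lemma simple_graph_whisker:
  assumes "simple_graph V E" "U \<subseteq> V"
  shows "simple_graph (whisker_verts V U) (whisker_edges E U)"
  unfolding simple_graph_def
proof (intro conjI ballI)
  show "finite (whisker_verts V U)"
    using assms by (auto simp: simple_graph_def whisker_verts_def intro: finite_subset)
  fix e assume "e \<in> whisker_edges E U"
  then consider e' where "e' \<in> E" "e = Inl ` e'" | x where "x \<in> U" "e = {Inl x, Inr x}"
    unfolding whisker_edges_def by blast
  then show "\<exists>u\<in>whisker_verts V U. \<exists>v\<in>whisker_verts V U. u \<noteq> v \<and> e = {u, v}"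
  proof cases
    case 1
    then obtain u v where "u \<in> V" "v \<in> V" "u \<noteq> v" "e' = {u, v}"
      using assms(1) unfolding simple_graph_def by blast
    then show ?thesis using 1 unfolding whisker_verts_def
      by (intro bexI[of _ "Inl u"] bexI[of _ "Inl v"]) auto
  next
    case 2
    then show ?thesis using assms(2) unfolding whisker_verts_def
      by (intro bexI[of _ "Inl x"] bexI[of _ "Inr x"]) auto
  qed
qed

theorem lemma1p3:
  fixes V U :: "'v set" and E :: "'v set set" and t :: nat
    and R :: "((('v + 'v) \<Rightarrow>\<^sub>0 nat) \<Rightarrow>\<^sub>0 'k::field) ring"
    and \<mm> I :: "((('v + 'v) \<Rightarrow>\<^sub>0 nat) \<Rightarrow>\<^sub>0 'k) set"
  assumes "forest V E"
    and "U \<subseteq> V"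
    and "R = mpoly_ring (whisker_verts V U)"
    and "\<mm> = max_hom_ideal (whisker_verts V U)"
    and "I = edge_ideal (whisker_verts V U) (whisker_edges E U)"
    and "t \<ge> 1"
  shows "ereal_of_enat (depth TYPE('c) R \<mm> (quot_module R (I [^]\<^bsub>ideals_set R\<^esub> t)))
           \<ge> ereal (real (card U) - real t + 1)"
proof -
  let ?X = "whisker_verts V U" and ?W = "whisker_edges E U"
  have simple: "simple_graph ?X ?W"
    using assms(1,2) by (intro simple_graph_whisker) (simp_all add: forest_def)
  then obtain vs where vs: "set vs = ?X" "distinct vs"
    using finite_distinct_list[of ?X] by (auto simp: simple_graph_def)
  have "monomial_depth_ge TYPE('k) vs (int (card U) - int t + 1) (edge_power ?W t)"
    using whiskered_forest_depth[OF assms(1,2)] vs by (intro whisker_depth_boundD) auto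
  note vanishes = local_cohomology_vanishes[OF assms(3) upset_edge_power vs(2,1) this,
      folded assms(4), where ?'c = 'c]
  have power: "I [^]\<^bsub>ideals_set R\<^esub> t = monomial_ideal (edge_power ?W t) \<inter> carrier R"
    unfolding assms(3,5) by (rule edge_ideal_power[OF simple])
  let ?S = "{i. local_cohomology_nonzero TYPE('c) R \<mm> (quot_module R (I [^]\<^bsub>ideals_set R\<^esub> t)) i}"
  have ge: "real (card U) - real t + 1 \<le> real i" if "i \<in> ?S" for i
  proof -
    have "\<not> int i < int (card U) - int t + 1" using vanishes[of i] that unfolding power by blast
    then show ?thesis by linarith
  qed
  show ?thesis
  proof (cases "?S = {}")
    case True
    have "Inf (enat ` ?S) = \<infinity>" unfolding True by (simp add: Inf_enat_def)
    then show ?thesis unfolding depth_def by simp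
  next
    case False
    then obtain i0 where "i0 \<in> ?S" by blast
    from wellorder_InfI[OF imageI[OF this, of enat]] have "Inf (enat ` ?S) \<in> enat ` ?S" .
    then obtain i where i: "i \<in> ?S" "Inf (enat ` ?S) = enat i" by blast
    show ?thesis unfolding depth_def i(2) using ge[OF i(1)] by simp
  qed
qed

end
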